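(* Let $\mathcal{U}\subset\mathbb{R}^p$ be a regular set, and let the plant $\dot x=f(x,u)$ with steady-state map $h:\mathbb{R}^p\to\mathbb{R}^n$ satisfy the Plant Assumption on $\mathcal{U}$. Let $\Phi:\mathbb{R}^n\times\mathbb{R}^p\to\mathbb{R}$ be continuously differentiable with locally Lipschitz gradient, and let $L>0$ be such that $$\left\| H(u)^T\left(\nabla\Phi(x',u)^T-\nabla\Phi(x,u)^T\right)\right\|\le L\|x'-x\|\qquad\text{for all } x,x'\in\mathbb{R}^n,\ u\in\mathcal{U} .$$ Let $W:\mathbb{R}^n\times\mathbb{R}^p\to\mathbb{R}$ be a Lyapunov function for the plant with constants $\alpha,\beta,\gamma,\zeta>0$ as defined in the context. Suppose that $\tilde\Phi(u):=\Phi(h(u),u)$ has compact level sets and that $0<\epsilon<\frac{\gamma}{\zeta L}$. Then all trajectories (Carath\'eodory solutions with $u(0)\in\mathcal{U}$) of $$\dot x=f(x,u),\qquad \dot u=\left[-\epsilon H(u)^T\,\nabla\Phi(x,u)^T\right]^u_{\mathcal{U}}$$ are complete and converge to the set of critical points of the problem $$\min_{x,u}\ \Phi(x,u)\quad\text{subject to}\quad x=h(u),\ u\in\mathcal{U}.$$ Furthermore, asymptotically stable equilibrium points of this system are strict local minimizers of this problem, and strict local minimizers of this problem are stable equilibria of the system (stability being understood on the state space $\mathbb{R}^n\times\mathcal{U}$).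
   Context: Notation: $\nabla$ denotes the Jacobian (a row vector for scalar functions), so $\nabla\Phi(x,u)^T\in\mathbb{R}^{n+p}$ is the gradient of $\Phi$ with respect to $(x,u)$. $\|\cdot\|$ is the Euclidean norm or the induced matrix norm. $H(u)^T:=\begin{bmatrix}\nabla h(u)^T & I_p\end{bmatrix}\in\mathbb{R}^{p\times(n+p)}$. A function $V$ has compact level sets if $\{u: V(u)\le c\}$ is compact for every $c\in\mathbb{R}$. Regular set: $\mathcal{U}=\{u\in\mathbb{R}^p\mid \xi(u)=0,\ \omega(u)\le0\}$ with $\xi:\mathbb{R}^p\to\mathbb{R}^s$ and $\omega:\mathbb{R}^p\to\mathbb{R}^q$ continuously differentiable, such that for every $u\in\mathcal{U}$, with active set $I(u)=\{j\mid\omega_j(u)=0\}$, the matrix obtained by stacking $\nabla\xi(u)$ and $\nabla\omega_{I(u)}(u)$ has full row rank $s+|I(u)|$. The tangent cone at $u\in\mathcal U$ is $T_u\mathcal{U}=\{w\mid\nabla\xi(u)w=0,\ \nabla\omega_{I(u)}(u)w\le0\}$ and the normal cone is $N_u\mathcal{U}=\{\eta\mid\langle w,\eta\rangle\le0\ \forall w\in T_u\mathcal{U}\}$. The projection operator is $[v]^u_{\mathcal{U}}:=\arg\min_{w\in T_u\mathcal{U}}\|v-w\|^2$. A (Carath\'eodory) solution is an absolutely continuous function $(x,u)$ with $u(t)\in\mathcal{U}$ for all $t$ that satisfies the differential equations for almost all $t$; it is complete if defined for all $t\ge0$. Plant Assumption on $\mathcal{U}$: $f:\mathbb{R}^n\times\mathbb{R}^p\to\mathbb{R}^n$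 is continuously differentiable and, on $\mathbb{R}^n\times\mathcal{U}$, $\ell_x$-Lipschitz in $x$ and $\ell_u$-Lipschitz in $u$. The map $h:\mathbb{R}^p\to\mathbb{R}^n$ is continuously differentiable, $\ell$-Lipschitz on $\mathcal{U}$, and satisfies $f(h(u),u)=0$ for all $u\in\mathcal{U}$. There exist $\tau,K>0$ such that for every $x_0\in\mathbb{R}^n$ and every constant $\hat u\in\mathcal{U}$ the solution of $\dot x=f(x,\hat u)$, $x(0)=x_0$, satisfies $\|x(t)-h(\hat u)\|\le K\|x_0-h(\hat u)\|e^{-\tau t}$ for all $t\ge 0$. Lyapunov function $W$ with constants $\alpha,\beta,\gamma,\zeta>0$: $W$ is differentiable and for all $x\in\mathbb{R}^n$, $u\in\mathcal{U}$: $\alpha\|x-h(u)\|^2\le W(x,u)\le\beta\|x-h(u)\|^2$, $\ \nabla_xW(x,u)f(x,u)\le-\gamma\|x-h(u)\|^2$, $\ \|\nabla_uW(x,u)\|\le\zeta\|x-h(u)\|$. Critical point of the problem: $(x^\star,u^\star)$ with $u^\star\in\mathcal{U}$, $x^\star=h(u^\star)$, satisfying the first-order (KKT) conditions, i.e. $-H(u^\star)^T\nabla\Phi(x^\star,u^\star)^T\in N_{u^\star}\mathcal{U}$. A feasible point is a strict local minimizer if it has strictly smaller cost than all other feasible points in some neighborhood of it. Stability and asymptotic stability are in the sense of Lyapunov. *)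

theory Defs
  imports "HOL-Analysis.Analysis"
begin

section \<open>Differentiability\<close>

definition C1 :: "('a::real_normed_vector \<Rightarrow> 'b::real_normed_vector) \<Rightarrow> bool" where
  "C1 F \<longleftrightarrow> (\<exists>F' :: 'a \<Rightarrow> 'a \<Rightarrow>\<^sub>L 'b.
     (\<forall>x. (F has_derivative blinfun_apply (F' x)) (at x)) \<and> continuous_on UNIV F')"

definition grad :: "('a::real_inner \<Rightarrow> real) \<Rightarrow> 'a \<Rightarrow> 'a" where
  "grad g x = (THE D. GDERIV g x :> D)"

definition grad_x :: "('a::real_inner \<times> 'b::real_inner \<Rightarrow> real) \<Rightarrow> 'a \<times> 'b \<Rightarrow> 'a" where
  "grad_x g = (\<lambda>(x, u). grad (\<lambda>y. g (y, u)) x)"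

definition grad_u :: "('a::real_inner \<times> 'b::real_inner \<Rightarrow> real) \<Rightarrow> 'a \<times> 'b \<Rightarrow> 'b" where
  "grad_u g = (\<lambda>(x, u). grad (\<lambda>v. g (x, v)) u)"

definition locally_Lipschitz :: "('a::metric_space \<Rightarrow> 'b::metric_space) \<Rightarrow> bool" where
  "locally_Lipschitz F \<longleftrightarrow> (\<forall>x. \<exists>r>0. \<exists>C. C-lipschitz_on (ball x r) F)"

definition compact_level_sets :: "('a::topological_space \<Rightarrow> real) \<Rightarrow> bool" where
  "compact_level_sets V \<longleftrightarrow> (\<forall>c. compact {u. V u \<le> c})"


section \<open>Regular sets, tangent and normal cones, projection\<close>

text \<open>The constraint maps into \<open>R\<^sup>s\<close> and \<open>R\<^sup>q\<close> are given by their components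
  \<open>\<xi> i\<close> for \<open>i < s\<close> and \<open>\<omega> j\<close> for \<open>j < q\<close>, so that \<open>s = 0\<close> and \<open>q = 0\<close> are allowed.\<close>

definition constraint_set ::
  "nat \<Rightarrow> (nat \<Rightarrow> real ^ 'p \<Rightarrow> real) \<Rightarrow> nat \<Rightarrow> (nat \<Rightarrow> real ^ 'p \<Rightarrow> real) \<Rightarrow> (real ^ 'p) set" where
  "constraint_set s \<xi> q \<omega> = {u. (\<forall>i<s. \<xi> i u = 0) \<and> (\<forall>j<q. \<omega> j u \<le> 0)}"

definition active_set :: "nat \<Rightarrow> (nat \<Rightarrow> real ^ 'p \<Rightarrow> real) \<Rightarrow> real ^ 'p \<Rightarrow> nat set" where
  "active_set q \<omega> u = {j. j < q \<and> \<omega> j u = 0}"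

text \<open>The set whose dimension is taken below consists of the rows of the stacked Jacobians of
  \<open>\<xi>\<close> and of the active part of \<open>\<omega>\<close>, so the dimension is the row rank of that matrix.\<close>

definition regular_constraints ::
  "nat \<Rightarrow> (nat \<Rightarrow> real ^ 'p \<Rightarrow> real) \<Rightarrow> nat \<Rightarrow> (nat \<Rightarrow> real ^ 'p \<Rightarrow> real) \<Rightarrow> bool" where
  "regular_constraints s \<xi> q \<omega> \<longleftrightarrow>
     (\<forall>i<s. C1 (\<xi> i)) \<and> (\<forall>j<q. C1 (\<omega> j)) \<and>
     (\<forall>u \<in> constraint_set s \<xi> q \<omega>.
        dim ((\<lambda>i. grad (\<xi> i) u) ` {..<s} \<union> (\<lambda>j. grad (\<omega> j) u) ` active_set q \<omega> u)
          = s + card (active_set q \<omega> u))"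

definition tangent_cone ::
  "nat \<Rightarrow> (nat \<Rightarrow> real ^ 'p \<Rightarrow> real) \<Rightarrow> nat \<Rightarrow> (nat \<Rightarrow> real ^ 'p \<Rightarrow> real)
     \<Rightarrow> real ^ 'p \<Rightarrow> (real ^ 'p) set" where
  "tangent_cone s \<xi> q \<omega> u =
     {w. (\<forall>i<s. grad (\<xi> i) u \<bullet> w = 0) \<and> (\<forall>j\<in>active_set q \<omega> u. grad (\<omega> j) u \<bullet> w \<le> 0)}"

definition normal_cone ::
  "nat \<Rightarrow> (nat \<Rightarrow> real ^ 'p \<Rightarrow> real) \<Rightarrow> nat \<Rightarrow> (nat \<Rightarrow> real ^ 'p \<Rightarrow> real)
     \<Rightarrow> real ^ 'p \<Rightarrow> (real ^ 'p) set" where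
  "normal_cone s \<xi> q \<omega> u = {\<eta>. \<forall>w\<in>tangent_cone s \<xi> q \<omega> u. w \<bullet> \<eta> \<le> 0}"

definition tangent_proj ::
  "nat \<Rightarrow> (nat \<Rightarrow> real ^ 'p \<Rightarrow> real) \<Rightarrow> nat \<Rightarrow> (nat \<Rightarrow> real ^ 'p \<Rightarrow> real)
     \<Rightarrow> real ^ 'p \<Rightarrow> real ^ 'p \<Rightarrow> real ^ 'p" where
  "tangent_proj s \<xi> q \<omega> u v = arg_min_on (\<lambda>w. (norm (v - w))\<^sup>2) (tangent_cone s \<xi> q \<omega> u)"


section \<open>Dynamical systems on a set of states\<close>

definition AC_on :: "real \<Rightarrow> real \<Rightarrow> (real \<Rightarrow> 'a::metric_space) \<Rightarrow> bool" where
  "AC_on a b z \<longleftrightarrow> (\<forall>e>0. \<exists>d>0. \<forall>D :: (real \<times> real) set.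
     finite D \<and> (\<forall>(l, r)\<in>D. a \<le> l \<and> l \<le> r \<and> r \<le> b) \<and>
     pairwise (\<lambda>k k'. disjnt {fst k<..<snd k} {fst k'<..<snd k'}) D \<and>
     (\<Sum>(l, r)\<in>D. r - l) < d
     \<longrightarrow> (\<Sum>(l, r)\<in>D. dist (z l) (z r)) < e)"

text \<open>A solution lives on an interval \<open>I\<close> with left endpoint \<open>0\<close>, of any of the forms \<open>{0..T}\<close>,
  \<open>{0..<T}\<close>, \<open>{0..}\<close>; absolute continuity is required on compact subintervals.  The degenerate
  interval \<open>{0}\<close> is admitted, so that a maximal solution starts at every point of \<open>X\<close> and the
  completeness of all maximal solutions includes local existence.\<close>

definition solution_on ::
  "'a::euclidean_space set \<Rightarrow> ('a \<Rightarrow> 'a) \<Rightarrow> real set \<Rightarrow> (real \<Rightarrow> 'a) \<Rightarrow> bool" where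
  "solution_on X F I z \<longleftrightarrow>
     is_interval I \<and> 0 \<in> I \<and> I \<subseteq> {0..} \<and>
     (\<forall>a b. {a..b} \<subseteq> I \<longrightarrow> AC_on a b z) \<and>
     (\<forall>t\<in>I. z t \<in> X) \<and>
     (AE t in lebesgue. t \<in> I \<longrightarrow> (z has_vector_derivative F (z t)) (at t within I))"

definition maximal_solution ::
  "'a::euclidean_space set \<Rightarrow> ('a \<Rightarrow> 'a) \<Rightarrow> real set \<Rightarrow> (real \<Rightarrow> 'a) \<Rightarrow> bool" where
  "maximal_solution X F I z \<longleftrightarrow> solution_on X F I z \<and>
     (\<forall>J y. solution_on X F J y \<and> I \<subseteq> J \<and> (\<forall>t\<in>I. y t = z t) \<longrightarrow> J = I)"

definition converges_to_set :: "(real \<Rightarrow> 'a::metric_space) \<Rightarrow> 'a set \<Rightarrow> bool" where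
  "converges_to_set z S \<longleftrightarrow> (\<forall>e>0. \<forall>\<^sub>F t in at_top. \<exists>c\<in>S. dist (z t) c < e)"

definition equilibrium :: "'a::euclidean_space set \<Rightarrow> ('a \<Rightarrow> 'a) \<Rightarrow> 'a \<Rightarrow> bool" where
  "equilibrium X F c \<longleftrightarrow> c \<in> X \<and> F c = 0"

definition stable_equilibrium :: "'a::euclidean_space set \<Rightarrow> ('a \<Rightarrow> 'a) \<Rightarrow> 'a \<Rightarrow> bool" where
  "stable_equilibrium X F c \<longleftrightarrow> equilibrium X F c \<and>
     (\<forall>e>0. \<exists>d>0. \<forall>I z. solution_on X F I z \<and> dist (z 0) c < d \<longrightarrow> (\<forall>t\<in>I. dist (z t) c < e))"

definition asymptotically_stable_equilibrium ::
  "'a::euclidean_space set \<Rightarrow> ('a \<Rightarrow> 'a) \<Rightarrow> 'a \<Rightarrow> bool" where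
  "asymptotically_stable_equilibrium X F c \<longleftrightarrow> stable_equilibrium X F c \<and>
     (\<exists>d>0. \<forall>I z. maximal_solution X F I z \<and> dist (z 0) c < d \<longrightarrow>
        I = {0..} \<and> (z \<longlongrightarrow> c) at_top)"


section \<open>Plant, Lyapunov function, feedback system and optimization problem\<close>

definition plant_assumption ::
  "(real ^ 'p) set \<Rightarrow> ((real ^ 'n) \<times> (real ^ 'p) \<Rightarrow> real ^ 'n) \<Rightarrow> (real ^ 'p \<Rightarrow> real ^ 'n)
     \<Rightarrow> real \<Rightarrow> real \<Rightarrow> real \<Rightarrow> bool" where
  "plant_assumption U f h lx lu l \<longleftrightarrow>
     C1 f \<and>
     (\<forall>u\<in>U. lx-lipschitz_on UNIV (\<lambda>x. f (x, u))) \<and>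
     (\<forall>x. lu-lipschitz_on U (\<lambda>u. f (x, u))) \<and>
     C1 h \<and> l-lipschitz_on U h \<and> (\<forall>u\<in>U. f (h u, u) = 0) \<and>
     (\<exists>\<tau>>0. \<exists>K>0. \<forall>x0. \<forall>u\<in>U. \<forall>x.
        x 0 = x0 \<and> (\<forall>t\<ge>0. (x has_vector_derivative f (x t, u)) (at t within {0..}))
        \<longrightarrow> (\<forall>t\<ge>0. norm (x t - h u) \<le> K * norm (x0 - h u) * exp (- \<tau> * t)))"

definition plant_Lyapunov ::
  "(real ^ 'p) set \<Rightarrow> ((real ^ 'n) \<times> (real ^ 'p) \<Rightarrow> real ^ 'n) \<Rightarrow> (real ^ 'p \<Rightarrow> real ^ 'n)
     \<Rightarrow> ((real ^ 'n) \<times> (real ^ 'p) \<Rightarrow> real) \<Rightarrow> real \<Rightarrow> real \<Rightarrow> real \<Rightarrow> real \<Rightarrow> bool" where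
  "plant_Lyapunov U f h W \<alpha> \<beta> \<gamma> \<zeta> \<longleftrightarrow>
     0 < \<alpha> \<and> 0 < \<beta> \<and> 0 < \<gamma> \<and> 0 < \<zeta> \<and>
     (\<forall>z. W differentiable (at z)) \<and>
     (\<forall>x. \<forall>u\<in>U.
        \<alpha> * (norm (x - h u))\<^sup>2 \<le> W (x, u) \<and> W (x, u) \<le> \<beta> * (norm (x - h u))\<^sup>2 \<and>
        grad_x W (x, u) \<bullet> f (x, u) \<le> - \<gamma> * (norm (x - h u))\<^sup>2 \<and>
        norm (grad_u W (x, u)) \<le> \<zeta> * norm (x - h u))"

text \<open>Multiplication of a vector of \<open>R\<^sup>n \<times> R\<^sup>p\<close> by the block row matrix consisting of the
  transposed Jacobian of \<open>h\<close> at \<open>u\<close> and the identity matrix of size \<open>p\<close>.\<close>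

definition HT :: "(real ^ 'p \<Rightarrow> real ^ 'n) \<Rightarrow> real ^ 'p \<Rightarrow> (real ^ 'n) \<times> (real ^ 'p) \<Rightarrow> real ^ 'p" where
  "HT h u v = transpose (jacobian h (at u)) *v fst v + mat 1 *v snd v"

definition feedback_system ::
  "nat \<Rightarrow> (nat \<Rightarrow> real ^ 'p \<Rightarrow> real) \<Rightarrow> nat \<Rightarrow> (nat \<Rightarrow> real ^ 'p \<Rightarrow> real)
     \<Rightarrow> ((real ^ 'n) \<times> (real ^ 'p) \<Rightarrow> real ^ 'n) \<Rightarrow> (real ^ 'p \<Rightarrow> real ^ 'n)
     \<Rightarrow> ((real ^ 'n) \<times> (real ^ 'p) \<Rightarrow> real) \<Rightarrow> real
     \<Rightarrow> (real ^ 'n) \<times> (real ^ 'p) \<Rightarrow> (real ^ 'n) \<times> (real ^ 'p)" where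
  "feedback_system s \<xi> q \<omega> f h \<Phi> \<epsilon> = (\<lambda>(x, u).
     (f (x, u), tangent_proj s \<xi> q \<omega> u (- \<epsilon> *\<^sub>R HT h u (grad \<Phi> (x, u)))))"

definition critical_points ::
  "nat \<Rightarrow> (nat \<Rightarrow> real ^ 'p \<Rightarrow> real) \<Rightarrow> nat \<Rightarrow> (nat \<Rightarrow> real ^ 'p \<Rightarrow> real)
     \<Rightarrow> (real ^ 'p \<Rightarrow> real ^ 'n) \<Rightarrow> ((real ^ 'n) \<times> (real ^ 'p) \<Rightarrow> real)
     \<Rightarrow> ((real ^ 'n) \<times> (real ^ 'p)) set" where
  "critical_points s \<xi> q \<omega> h \<Phi> =
     {(x, u). u \<in> constraint_set s \<xi> q \<omega> \<and> x = h u \<and>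
        - HT h u (grad \<Phi> (x, u)) \<in> normal_cone s \<xi> q \<omega> u}"

definition strict_local_minimizer ::
  "('a::metric_space \<Rightarrow> real) \<Rightarrow> 'a set \<Rightarrow> 'a \<Rightarrow> bool" where
  "strict_local_minimizer \<Phi> S c \<longleftrightarrow> c \<in> S \<and>
     (\<exists>r>0. \<forall>z\<in>S. z \<noteq> c \<and> dist z c < r \<longrightarrow> \<Phi> c < \<Phi> z)"

end

theory Submission
  imports Defs
begin

text \<open>
Write \<open>z = (x, u)\<close>, let \<open>F\<close> be the closed-loop vector field and put
\<open>V z = \<Phi> (h u, u) + (L / \<zeta>) * W z\<close>.  The whole theorem follows from one inequality,
\<open>DV(z) F(z) \<le> - c * |F(z)|\<^sup>2\<close> on the state space, with some \<open>c > 0\<close> (\<open>V_dissipation\<close>).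
To see it, let \<open>r = |x - h u|\<close> and let \<open>w\<close> be the \<open>u\<close>-component of \<open>F z\<close>, the projection of
\<open>v = - \<epsilon> H(u)\<^sup>T \<nabla>\<Phi>(x, u)\<close> onto the tangent cone.  Projection onto a closed convex cone gives
\<open>v \<bullet> w = |w|\<^sup>2\<close>.  Replacing \<open>\<nabla>\<Phi>(x, u)\<close> by \<open>\<nabla>\<Phi>(h u, u)\<close> costs at most \<open>L r |w|\<close>, and the
\<open>u\<close>-dependence of \<open>W\<close> costs another \<open>\<zeta> r |w|\<close>, so that the derivative of \<open>V\<close> is at most
\<open>- |w|\<^sup>2 / \<epsilon> + 2 L r |w| - (L \<gamma> / \<zeta>) r\<^sup>2\<close>.  This quadratic form is negative definite precisely when
\<open>\<epsilon> < \<gamma> / (\<zeta> L)\<close>, and \<open>|F z|\<^sup>2 \<le> lx\<^sup>2 r\<^sup>2 + |w|\<^sup>2\<close>.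

The rest is carried out for an abstract field \<open>F z\<close>, the projection of a continuous drive \<open>g z\<close> onto the
contingent cone of a closed set \<open>S\<close> at \<open>z\<close>, where these cones are convex and depend inner
semicontinuously on the point, and \<open>V\<close> has compact sublevel sets in \<open>S\<close>
(locale \<open>dissipative_projected_system\<close>).  Although \<open>F\<close> is discontinuous, \<open>|F|\<close> is bounded away from \<open>0\<close>
on every compact set without equilibria (\<open>field_bounded_away_from_zero\<close>).  Trajectories are Lipschitz,
so one that stayed away from the equilibria at arbitrarily late times would lower \<open>V\<close> by a fixed
amount infinitely often, which is impossible since \<open>V\<close> is bounded below on sublevel sets.  Local minima of \<open>V\<close>
are equilibria because \<open>0 \<le> DV(z) F(z)\<close> there, and stability is Lyapunov's argument.
Conversely, near an asymptotically stable equilibrium \<open>V\<close> decreases along a trajectory to its value at the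
equilibrium, and it cannot be constant along a trajectory that moves.

A maximal solution may a priori be confined to a point, so completeness contains an existence theorem
(\<open>bounded_projected_solution\<close>): the Euler scheme that projects each step back onto \<open>S\<close> has a pointwise
cluster point \<open>z\<close>.  Wherever \<open>z\<close> has a derivative \<open>d\<close>, passing to the limit yields \<open>g \<bullet> w \<le> d \<bullet> w\<close> for all tangent
\<open>w\<close>; as both \<open>d\<close> and \<open>- d\<close> are tangent to \<open>S\<close>, this identifies \<open>d\<close> as the projection of \<open>g\<close>.  That \<open>z\<close> is
differentiable almost everywhere is Lebesgue's theorem for Lipschitz functions
(\<open>AE_differentiable_Lipschitz\<close>).  Since \<open>W\<close> is merely differentiable, \<open>V\<close> along a solution is not known in
advance to be absolutely continuous; \<open>growth_bound\<close> is the mean value inequality that still applies.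

For \<open>S = UNIV \<times> U\<close> the required properties of the cones come from the rank condition, through vectors
dual to the active constraint gradients: \<open>inner_semicontinuous_tangent_cone\<close> and
\<open>tangent_cone_subset_contingent_cone\<close>.
Finally, equilibria are the critical points (\<open>zeros_eq_critical_points\<close>), and \<open>V \<ge> \<Phi>\<close> with equality on the
graph of \<open>h\<close> transfers strict local minima between \<open>V\<close> and the optimization problem
(\<open>strict_local_minimizer_V_iff\<close>).
\<close>

section \<open>Lipschitz curves are differentiable almost everywhere\<close>

lemma small_positive:
  fixes a b c K :: real
  assumes "0 < a" "0 < b" "0 < c" "0 \<le> K"
  obtains \<kappa> where "0 < \<kappa>" "\<kappa> \<le> a" "\<kappa> \<le> b" "\<kappa> * K \<le> c"
proof -
  have m: "0 < min a (min b (c / (K + 1)))" using assms by simp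
  then obtain \<kappa> where \<kappa>: "0 < \<kappa>" "\<kappa> < min a (min b (c / (K + 1)))" using dense by blast
  then have "\<kappa> * (K + 1) \<le> c" using assms(4) by (simp add: pos_less_divide_eq)
  moreover have "\<kappa> * K \<le> \<kappa> * (K + 1)" using \<kappa>(1) by (intro mult_left_mono) auto
  ultimately have "\<kappa> * K \<le> c" by linarith
  then show ?thesis using that[of \<kappa>] \<kappa> by simp
qed

text \<open>The intervals of slope at most \<open>p\<close> form a Vitali cover of \<open>A\<close>.  A disjoint countable subfamily catches \<open>A\<close>
up to a null set, whose Lipschitz image is null again; as \<open>f\<close> is increasing, the images of the chosen
intervals are disjoint intervals whose lengths are at most \<open>p\<close> times the original ones.\<close>

lemma image_outer_measure_le_open:
  fixes f :: "real \<Rightarrow> real"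
  assumes lip: "C-lipschitz_on UNIV f" and mono: "strict_mono f" and p: "0 \<le> p"
    and G: "open G" "A \<subseteq> G"
    and slope: "\<And>x d. x \<in> A \<Longrightarrow> 0 < d \<Longrightarrow>
        \<exists>l r. l < r \<and> r - l < d \<and> l \<le> x \<and> x \<le> r \<and> f r - f l \<le> p * (r - l)"
  shows "outer_measure_of lebesgue (f ` A) \<le> ennreal p * emeasure lebesgue G"
proof -
  \<comment> \<open>Intervals are encoded as balls with centre \<open>a\<close> and radius \<open>r\<close>.\<close>
  define K where "K = {(a::real, r::real). 0 < r \<and> cball a r \<subseteq> G \<and> f (a + r) - f (a - r) \<le> p * (2 * r)}"
  have cov: "\<exists>i. i \<in> K \<and> x \<in> cball (fst i) (snd i) \<and> snd i < d" if x: "x \<in> A" and d: "0 < d" for x d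
  proof -
    obtain \<rho> where \<rho>: "0 < \<rho>" "ball x \<rho> \<subseteq> G"
      using G x open_contains_ball by blast
    obtain l r where lr: "l < r" "r - l < min d \<rho>" "l \<le> x" "x \<le> r" "f r - f l \<le> p * (r - l)"
      using slope[OF x, of "min d \<rho>"] d \<rho> by auto
    let ?a = "(l + r) / 2" and ?r = "(r - l) / 2"
    have e: "?a + ?r = r" "?a - ?r = l" by (simp_all add: field_simps)
    have c: "cball ?a ?r = {l..r}" unfolding cball_eq_atLeastAtMost e ..
    have "cball ?a ?r \<subseteq> G" unfolding c using lr \<rho>(2) by (force simp: dist_real_def subset_iff)
    then have "(?a, ?r) \<in> K" unfolding K_def using lr e by (simp add: field_simps)
    moreover have "x \<in> cball ?a ?r" unfolding c using lr by simp
    moreover have "?r < d" using lr by simp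
    ultimately show ?thesis by (intro exI[of _ "(?a, ?r)"]) simp
  qed
  obtain I where I: "countable I" "I \<subseteq> K"
     "pairwise (\<lambda>i j. disjnt (cball (fst i) (snd i)) (cball (fst j) (snd j))) I"
     "negligible (A - (\<Union>i \<in> I. cball (fst i) (snd i)))"
  proof (rule Vitali_covering_theorem_cballs[of K snd A fst])
    show "0 < snd i" if "i \<in> K" for i using that by (auto simp: K_def)
  qed (use cov in blast)+
  let ?B = "\<lambda>i. cball (fst i) (snd i) :: real set"
  have cont: "continuous_on T f" for T
    using lip lipschitz_on_continuous_on continuous_on_subset by blast
  have fB: "f ` ?B i = {f (fst i - snd i)..f (fst i + snd i)}" if "i \<in> I" for i
  proof -
    have "fst i - snd i \<le> fst i + snd i" using that I(2) by (auto simp: K_def)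
    then show ?thesis
      unfolding cball_eq_atLeastAtMost
    proof (intro subset_antisym subsetI)
      fix y assume "y \<in> {f (fst i - snd i)..f (fst i + snd i)}"
      then show "y \<in> f ` {fst i - snd i..fst i + snd i}"
        using IVT'[of f "fst i - snd i" y "fst i + snd i"] cont
          \<open>fst i - snd i \<le> fst i + snd i\<close> by fastforce
    qed (use mono in \<open>auto simp: strict_mono_less_eq\<close>)
  qed
  have inj: "inj f" using mono strict_mono_imp_inj_on by blast
  define H where "H = (\<Union>i\<in>I. f ` ?B i) \<union> f ` (A - (\<Union>i\<in>I. ?B i))"
  have neg: "negligible (f ` (A - (\<Union>i\<in>I. ?B i)))"
  proof (rule negligible_locally_Lipschitz_image[OF _ I(4)])
    fix x show "\<exists>T B. open T \<and> x \<in> T \<and> (\<forall>y\<in>(A - \<Union> (?B ` I)) \<inter> T. norm (f y - f x) \<le> B * norm (y - x))"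
      using lip by (intro exI[of _ UNIV] exI[of _ C]) (auto simp: lipschitz_on_def dist_norm)
  qed simp
  have "emeasure lebesgue (\<Union>i\<in>I. f ` ?B i) = (\<integral>\<^sup>+i. emeasure lebesgue (f ` ?B i) \<partial>count_space I)"
  proof (rule emeasure_UN_countable[OF _ I(1)])
    show "f ` ?B i \<in> sets lebesgue" if "i \<in> I" for i by (simp add: fB[OF that])
    show "disjoint_family_on (\<lambda>i. f ` ?B i) I"
      using I(3) inj unfolding disjoint_family_on_def pairwise_def disjnt_def
      by (metis image_Int image_empty)
  qed
  also have "\<dots> \<le> (\<integral>\<^sup>+i. ennreal p * emeasure lebesgue (?B i) \<partial>count_space I)"
  proof (rule nn_integral_mono)
    fix i assume "i \<in> space (count_space I)"
    then have i: "i \<in> I" by simp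
    obtain a r where ar: "i = (a, r)" "0 < r" "f (a + r) - f (a - r) \<le> p * (2 * r)"
      using i I(2) by (auto simp: K_def)
    have "f (a - r) \<le> f (a + r)" using mono ar(2) by (simp add: strict_mono_less_eq)
    then have "emeasure lebesgue (f ` ?B i) = ennreal (f (a + r) - f (a - r))"
      using fB[OF i] unfolding ar(1) by simp
    also have "\<dots> \<le> ennreal (p * (2 * r))" using ar(3) by (rule ennreal_leI)
    also have "\<dots> = ennreal p * emeasure lebesgue (?B i)"
      unfolding ar(1) cball_eq_atLeastAtMost using ar(2) p by (simp add: ennreal_mult)
    finally show "emeasure lebesgue (f ` ?B i) \<le> ennreal p * emeasure lebesgue (?B i)" .
  qed
  also have "\<dots> = ennreal p * (\<integral>\<^sup>+i. emeasure lebesgue (?B i) \<partial>count_space I)"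
    by (rule nn_integral_cmult) simp
  also have "(\<integral>\<^sup>+i. emeasure lebesgue (?B i) \<partial>count_space I) = emeasure lebesgue (\<Union>i\<in>I. ?B i)"
    using I(1,3) by (intro emeasure_UN_countable[symmetric])
      (auto simp: disjoint_family_on_def pairwise_def disjnt_def)
  also have "ennreal p * \<dots> \<le> ennreal p * emeasure lebesgue G"
  proof (intro mult_left_mono emeasure_mono)
    show "(\<Union>i\<in>I. ?B i) \<subseteq> G" using I(2) unfolding K_def by fastforce
  qed (use G(1) in auto)
  finally have le: "emeasure lebesgue (\<Union>i\<in>I. f ` ?B i) \<le> ennreal p * emeasure lebesgue G" .
  have sets: "(\<Union>i\<in>I. f ` ?B i) \<in> sets lebesgue" "f ` (A - (\<Union>i\<in>I. ?B i)) \<in> null_sets lebesgue"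
    using I(1) neg by (auto simp: fB negligible_iff_null_sets intro!: sets.countable_UN')
  have "f ` A \<subseteq> H" unfolding H_def by blast
  then have "outer_measure_of lebesgue (f ` A) \<le> outer_measure_of lebesgue H" by (rule outer_measure_of_mono)
  also have "\<dots> = emeasure lebesgue (\<Union>i\<in>I. f ` ?B i)"
    unfolding H_def outer_measure_of_eq[OF sets.Un[OF sets(1) null_setsD2[OF sets(2)]]]
    by (rule emeasure_Un_null_set[OF sets])
  finally show ?thesis using le by (rule order_trans)
qed

lemma image_outer_measure_le_slope:
  fixes f :: "real \<Rightarrow> real"
  assumes lip: "C-lipschitz_on UNIV f" and mono: "strict_mono f" and p: "0 \<le> p"
    and slope: "\<And>x d. x \<in> A \<Longrightarrow> 0 < d \<Longrightarrow>
        \<exists>l r. l < r \<and> r - l < d \<and> l \<le> x \<and> x \<le> r \<and> f r - f l \<le> p * (r - l)"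
  shows "outer_measure_of lebesgue (f ` A) \<le> ennreal p * outer_measure_of lebesgue A"
proof (rule ennreal_le_epsilon)
  fix e :: real assume "0 < e"
  then obtain \<kappa> where \<kappa>: "0 < \<kappa>" "\<kappa> * p \<le> e" using small_positive[of 1 1 e p] p by auto
  obtain E where E: "E \<in> sets lebesgue" "A \<subseteq> E" "outer_measure_of lebesgue A = emeasure lebesgue E"
    using outer_measure_of_attain[of A lebesgue] by auto
  obtain T where T: "open T" "E \<subseteq> T" "T - E \<in> lmeasurable" "emeasure lebesgue (T - E) < ennreal \<kappa>"
    by (rule sets_lebesgue_outer_open[OF E(1) \<kappa>(1)])
  have "A \<subseteq> T" using E(2) T(2) by blast
  have "emeasure lebesgue T = emeasure lebesgue E + emeasure lebesgue (T - E)"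
    using E(1) T(1,2) by (subst plus_emeasure) (auto simp: Un_absorb1)
  also have "\<dots> \<le> outer_measure_of lebesgue A + ennreal \<kappa>"
    using T(4) E(3) by (intro add_mono) auto
  finally have "ennreal p * emeasure lebesgue T \<le> ennreal p * (outer_measure_of lebesgue A + ennreal \<kappa>)"
    by (rule mult_left_mono) simp
  also have "\<dots> = ennreal p * outer_measure_of lebesgue A + ennreal (\<kappa> * p)"
    using p \<kappa>(1) by (simp add: distrib_left ennreal_mult mult.commute)
  also have "\<dots> \<le> ennreal p * outer_measure_of lebesgue A + ennreal e"
    using \<kappa>(2) by (intro add_left_mono ennreal_leI)
  finally show "outer_measure_of lebesgue (f ` A) \<le> ennreal p * outer_measure_of lebesgue A + ennreal e"
    using image_outer_measure_le_open[OF lip mono p T(1) \<open>A \<subseteq> T\<close> slope] order_trans by blast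
qed

text \<open>The previous bound applied to \<open>f\<close>, and to its inverse, whose slopes are at most \<open>1 / q\<close> near \<open>f ` A\<close>, shows that
the outer measure of \<open>A\<close> is at most \<open>p / q < 1\<close> times itself.  That \<open>f\<close> expands distances makes it
bijective with a Lipschitz inverse.\<close>

lemma negligible_two_slopes_bounded:
  fixes f :: "real \<Rightarrow> real"
  assumes lip: "C-lipschitz_on UNIV f" and expand: "\<And>x y. x \<le> y \<Longrightarrow> y - x \<le> f y - f x"
    and pq: "0 < p" "p < q" and A: "bounded A"
    and slopep: "\<And>x d. x \<in> A \<Longrightarrow> 0 < d \<Longrightarrow>
        \<exists>l r. l < r \<and> r - l < d \<and> l \<le> x \<and> x \<le> r \<and> f r - f l \<le> p * (r - l)"
    and slopeq: "\<And>x d. x \<in> A \<Longrightarrow> 0 < d \<Longrightarrow>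
        \<exists>l r. l < r \<and> r - l < d \<and> l \<le> x \<and> x \<le> r \<and> q * (r - l) \<le> f r - f l"
  shows "negligible A"
proof -
  have mono: "strict_mono f"
  proof (rule strict_monoI)
    fix x y :: real assume "x < y"
    then show "f x < f y" using expand[of x y] by linarith
  qed
  have contf: "continuous_on UNIV f" using lip lipschitz_on_continuous_on by blast
  have surj: "surj f"
  proof -
    have "\<exists>x. f x = y" for y
    proof -
      define b where "b = \<bar>y - f 0\<bar>"
      have "f (-b) \<le> y" "y \<le> f b" using expand[of "-b" 0] expand[of 0 b] by (auto simp: b_def)
      then show ?thesis
        using IVT'[of f "-b" y b] contf continuous_on_subset by (force simp: b_def)
    qed
    then show ?thesis by (metis surjI)
  qed
  \<comment> \<open>The inverse turns the lower slope bound \<open>q\<close> into the upper slope bound \<open>1 / q\<close>.\<close>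
  define g where "g = inv f"
  have inj: "inj f" using mono strict_mono_imp_inj_on by blast
  have gf: "g (f x) = x" for x using inj by (simp add: g_def)
  have fg: "f (g y) = y" for y using surj by (simp add: g_def surj_f_inv_f)
  have gmono: "strict_mono g"
    by (rule strict_monoI) (metis fg linorder_not_less mono strict_mono_less_eq)
  have glip: "1-lipschitz_on UNIV g"
  proof (rule lipschitz_onI)
    fix x y :: real
    show "dist (g x) (g y) \<le> 1 * dist x y"
      using expand[of "g x" "g y"] expand[of "g y" "g x"]
      by (cases "g x \<le> g y") (auto simp: fg dist_real_def)
  qed simp
  have gslope: "\<exists>l r. l < r \<and> r - l < d \<and> l \<le> y \<and> y \<le> r \<and> g r - g l \<le> (1 / q) * (r - l)"
    if y: "y \<in> f ` A" and d: "0 < d" for y d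
  proof -
    obtain x where x: "x \<in> A" "y = f x" using y by blast
    have C: "0 \<le> C" using lip lipschitz_on_nonneg by blast
    obtain l r where lr: "l < r" "r - l < d / (C + 1)" "l \<le> x" "x \<le> r" "q * (r - l) \<le> f r - f l"
      using slopeq[OF x(1), of "d / (C + 1)"] d C by auto
    have "f r - f l \<le> C * (r - l)"
      using lipschitz_onD[OF lip, of r l] lr by (simp add: dist_real_def)
    also have "\<dots> \<le> (C + 1) * (r - l)" using lr by (simp add: algebra_simps)
    also have "\<dots> < d" using lr(2) C by (simp add: field_simps)
    finally have "f r - f l < d" .
    then show ?thesis
      using lr x mono pq gf
      by (intro exI[of _ "f l"] exI[of _ "f r"]) (auto simp: strict_mono_less strict_mono_less_eq field_simps)
  qed
  obtain E where E: "E \<in> sets lebesgue" "A \<subseteq> E" "outer_measure_of lebesgue A = emeasure lebesgue E"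
    using outer_measure_of_attain[of A lebesgue] by auto
  obtain R where "A \<subseteq> ball 0 R" using A bounded_subset_ballD by blast
  then have "emeasure lebesgue E \<le> emeasure lebesgue (ball (0::real) R)"
    using outer_measure_of_mono[of A "ball 0 R" lebesgue] E(3) by simp
  also have "\<dots> < \<infinity>" using emeasure_bounded_finite[of "ball (0::real) R"] by simp
  finally obtain m where m: "0 \<le> m" "emeasure lebesgue E = ennreal m"
    by (metis ennreal_cases infinity_ennreal_def less_irrefl)
  have q: "0 \<le> p" "0 \<le> 1 / q" using pq by auto
  have "g ` f ` A = A" by (simp add: image_image gf)
  then have "ennreal m \<le> ennreal (1 / q) * outer_measure_of lebesgue (f ` A)"
    using image_outer_measure_le_slope[of 1 g "1 / q" "f ` A", OF glip gmono q(2) gslope] E(3) m(2) by simp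
  also have "\<dots> \<le> ennreal (1 / q) * (ennreal p * ennreal m)"
    using image_outer_measure_le_slope[of C f p A, OF lip mono q(1) slopep] E(3) m(2) by (intro mult_left_mono) auto
  also have "\<dots> = ennreal (p / q * m)" using q m(1) by (simp add: mult.assoc flip: ennreal_mult)
  finally have "m \<le> p / q * m" using q m(1) pq by simp
  then have "m * q \<le> m * p" using pq by (simp add: field_simps)
  then have "m = 0" using m(1) pq mult_strict_left_mono[of p q m] by linarith
  then have "negligible E" using E(1) m(2) by (simp add: negligible_iff_null_sets null_setsI)
  then show ?thesis using E(2) by (rule negligible_subset)
qed

text \<open>If no pair \<open>p < q\<close> of rational numbers separates slopes of arbitrarily short intervals around \<open>x\<close>, these slopes
converge, and their limit is the derivative.\<close>

lemma AE_differentiable_expanding_Lipschitz: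
  fixes f :: "real \<Rightarrow> real"
  assumes lip: "C-lipschitz_on UNIV f" and expand: "\<And>x y. x \<le> y \<Longrightarrow> y - x \<le> f y - f x"
  shows "negligible {x. \<not> f differentiable (at x)}"
proof -
  define P where "P q x \<longleftrightarrow> (\<forall>d>0. \<exists>l r. l < r \<and> r - l < d \<and> l \<le> x \<and> x \<le> r \<and> f r - f l \<le> q * (r - l))"
    for q x :: real
  define Q where "Q q x \<longleftrightarrow> (\<forall>d>0. \<exists>l r. l < r \<and> r - l < d \<and> l \<le> x \<and> x \<le> r \<and> q * (r - l) \<le> f r - f l)"
    for q x :: real
  define N where "N = (\<Union>(p, q) \<in> {(p, q). p \<in> \<rat> \<and> q \<in> \<rat> \<and> 0 < p \<and> p < q}. {x. P p x \<and> Q q x})"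
  have "negligible N"
    unfolding N_def
  proof (rule negligible_countable_Union)
    have "countable (\<rat> \<times> \<rat> :: (real \<times> real) set)" by (intro countable_SIGMA countable_rat)
    then have "countable {(p::real, q::real). p \<in> \<rat> \<and> q \<in> \<rat> \<and> 0 < p \<and> p < q}"
      by (rule countable_subset[rotated]) auto
    then show "countable ((\<lambda>(p, q). {x. P p x \<and> Q q x}) ` {(p, q). p \<in> \<rat> \<and> q \<in> \<rat> \<and> 0 < p \<and> p < q})"
      by (rule countable_image)
  next
    fix T assume "T \<in> (\<lambda>(p, q). {x. P p x \<and> Q q x}) ` {(p, q). p \<in> \<rat> \<and> q \<in> \<rat> \<and> 0 < p \<and> p < q}"
    then obtain p q where "0 < p" "p < q" "T = {x. P p x \<and> Q q x}" by auto
    moreover have "negligible {x. P p x \<and> Q q x}"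
      unfolding negligible_on_intervals[of "{x. P p x \<and> Q q x}"]
    proof (intro allI)
      fix a b
      show "negligible ({x. P p x \<and> Q q x} \<inter> cbox a b)"
        by (rule negligible_two_slopes_bounded[OF lip expand \<open>0 < p\<close> \<open>p < q\<close>])
          (auto simp: P_def Q_def bounded_Int)
    qed
    ultimately show "negligible T" by simp
  qed
  moreover have "f differentiable (at x)" if x: "x \<notin> N" for x
  proof -
    have C: "f r - f l \<le> C * (r - l)" if "l < r" for l r
      using lipschitz_onD[OF lip, of r l] that by (simp add: dist_real_def)
    have Q1: "Q 1 x"
      unfolding Q_def
    proof (intro allI impI)
      fix d :: real assume "0 < d"
      then show "\<exists>l r. l < r \<and> r - l < d \<and> l \<le> x \<and> x \<le> r \<and> 1 * (r - l) \<le> f r - f l"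
        using expand[of x "x + d/2"] by (intro exI[of _ x] exI[of _ "x + d/2"]) auto
    qed
    have QC: "q \<le> C" if Qq: "Q q x" for q
    proof -
      obtain l r where "l < r" "q * (r - l) \<le> f r - f l"
        using Qq zero_less_one unfolding Q_def by blast
      then have "q * (r - l) \<le> C * (r - l)" using C[of l r] by linarith
      then show ?thesis using \<open>l < r\<close> by simp
    qed
    \<comment> \<open>The upper derivative of \<open>f\<close> at \<open>x\<close> with respect to shrinking intervals.\<close>
  define D where "D = Sup {q. Q q x}"
    have bdd: "bdd_above {q. Q q x}" using QC by (intro bdd_aboveI[of _ C]) simp
    have D1: "1 \<le> D" unfolding D_def using Q1 bdd by (intro cSup_upper) auto
    have "(f has_field_derivative D) (at x)"
      unfolding has_field_derivative_iff
    proof (rule LIM_I)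
      fix e :: real assume e: "0 < e"
      have "\<not> Q (D + e/2) x"
        using cSup_upper[of "D + e/2" "{q. Q q x}"] bdd e D_def by auto
      then obtain d1 where d1: "0 < d1"
        "\<And>l r. l < r \<Longrightarrow> r - l < d1 \<Longrightarrow> l \<le> x \<Longrightarrow> x \<le> r \<Longrightarrow> f r - f l < (D + e/2) * (r - l)"
        unfolding Q_def by (metis not_le)
      define e' where "e' = min e (1/2)"
      have e': "0 < e'" "e' \<le> e" "e' < D" using e D1 by (auto simp: e'_def)
      obtain q0 where q0: "Q q0 x" "D - e'/4 < q0"
        using less_cSupD[of "{q. Q q x}" "D - e'/4"] Q1 e' D_def by auto
      obtain q where q: "q \<in> \<rat>" "D - e'/2 < q" "q < D - e'/4"
        using Rats_dense_in_real[of "D - e'/2" "D - e'/4"] e' by auto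
      obtain p where p: "p \<in> \<rat>" "D - e' < p" "p < D - e'/2"
        using Rats_dense_in_real[of "D - e'" "D - e'/2"] e' by auto
      have "Q q x"
        unfolding Q_def
      proof (intro allI impI)
        fix d :: real assume "0 < d"
        then obtain l r where lr: "l < r" "r - l < d" "l \<le> x" "x \<le> r" "q0 * (r - l) \<le> f r - f l"
          using q0(1) unfolding Q_def by blast
        have "q * (r - l) \<le> q0 * (r - l)" using q q0 lr by (intro mult_right_mono) auto
        then have "q * (r - l) \<le> f r - f l" using lr(5) by linarith
        then show "\<exists>l r. l < r \<and> r - l < d \<and> l \<le> x \<and> x \<le> r \<and> q * (r - l) \<le> f r - f l"
          using lr by blast
      qed
      moreover have "0 < p" "p < q" using p q e' by auto
      ultimately have "\<not> P p x" using x p(1) q(1) unfolding N_def by blast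
      then obtain d2 where d2: "0 < d2"
        "\<And>l r. l < r \<Longrightarrow> r - l < d2 \<Longrightarrow> l \<le> x \<Longrightarrow> x \<le> r \<Longrightarrow> p * (r - l) < f r - f l"
        unfolding P_def by (metis not_le)
      have two: "\<bar>(f r - f l) / (r - l) - D\<bar> < e"
        if lr: "l < r" "r - l < min d1 d2" "l \<le> x" "x \<le> r" for l r
      proof -
        have "(f r - f l) / (r - l) < D + e/2" "p < (f r - f l) / (r - l)"
          using d1(2)[of l r] d2(2)[of l r] lr by (simp_all add: field_simps)
        then show ?thesis using p e' by linarith
      qed
      show "\<exists>s>0. \<forall>y. y \<noteq> x \<and> norm (y - x) < s \<longrightarrow> norm ((f y - f x) / (y - x) - D) < e"
      proof (intro exI[of _ "min d1 d2"] conjI allI impI)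
        fix y assume y: "y \<noteq> x \<and> norm (y - x) < min d1 d2"
        show "norm ((f y - f x) / (y - x) - D) < e"
        proof (cases "x < y")
          case True
          then show ?thesis using two[of x y] y by auto
        next
          case False
          moreover have "(f y - f x) / (y - x) = (f x - f y) / (x - y)"
            by (metis minus_diff_eq minus_divide_divide)
          ultimately show ?thesis using two[of y x] y by auto
        qed
      qed (use d1 d2 in auto)
    qed
    then show ?thesis by (metis field_differentiable_def field_differentiable_imp_differentiable)
  qed
  ultimately show ?thesis by (metis (mono_tags, lifting) mem_Collect_eq negligible_subset subsetI)
qed

text \<open>Adding the linear function \<open>(C + 1) * x\<close> to a component makes it expanding and changes nothing about
differentiability.\<close>

theorem AE_differentiable_Lipschitz:
  fixes f :: "real \<Rightarrow> 'a::euclidean_space"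
  assumes lip: "C-lipschitz_on UNIV f"
  shows "negligible {x. \<not> f differentiable (at x)}"
proof -
  have neg: "negligible {x. \<not> (\<lambda>x. f x \<bullet> b) differentiable (at x)}" if b: "b \<in> Basis" for b
  proof -
    define g where "g x = f x \<bullet> b + (C + 1) * x" for x
    have Cb: "\<bar>f x \<bullet> b - f y \<bullet> b\<bar> \<le> C * \<bar>x - y\<bar>" for x y
    proof -
      have "\<bar>(f x - f y) \<bullet> b\<bar> \<le> norm (f x - f y)" using b by (rule Basis_le_norm)
      also have "\<dots> \<le> C * \<bar>x - y\<bar>" using lipschitz_onD[OF lip, of x y] by (simp add: dist_norm)
      finally show ?thesis by (simp add: inner_diff_left)
    qed
    have C: "0 \<le> C" using lip lipschitz_on_nonneg by blast
    have "(2 * C + 1)-lipschitz_on UNIV g"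
    proof (rule lipschitz_onI)
      fix x y :: real
      have "dist (g x) (g y) \<le> \<bar>f x \<bullet> b - f y \<bullet> b\<bar> + \<bar>(C + 1) * (x - y)\<bar>"
        unfolding g_def dist_real_def by (simp add: algebra_simps abs_if split: if_splits)
      also have "\<dots> \<le> (2 * C + 1) * dist x y"
      proof -
        have "\<bar>(C + 1) * (x - y)\<bar> = (C + 1) * \<bar>x - y\<bar>" using C by (simp add: abs_mult)
        then show ?thesis using Cb[of x y] by (simp add: dist_real_def algebra_simps)
      qed
      finally show "dist (g x) (g y) \<le> (2 * C + 1) * dist x y" .
    qed (use C in simp)
    moreover have "y - x \<le> g y - g x" if "x \<le> y" for x y
      using Cb[of x y] that unfolding g_def by (simp add: algebra_simps abs_if split: if_splits)
    ultimately have "negligible {x. \<not> g differentiable (at x)}"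
      by (rule AE_differentiable_expanding_Lipschitz)
    moreover have "(\<lambda>x. f x \<bullet> b) differentiable (at x)" if "g differentiable (at x)" for x
    proof -
      have "(\<lambda>x. g x - (C + 1) * x) differentiable (at x)"
        using that by (intro derivative_intros)
      then show ?thesis by (simp add: g_def)
    qed
    ultimately show ?thesis by (metis (mono_tags, lifting) mem_Collect_eq negligible_subset subsetI)
  qed
  have "{x. \<not> f differentiable (at x)} = (\<Union>b\<in>Basis. {x. \<not> (\<lambda>x. f x \<bullet> b) differentiable (at x)})"
    by (auto simp: differentiable_componentwise_within[of f])
  also have "negligible \<dots>" using neg by (intro negligible_Union) auto
  finally show ?thesis .
qed

section \<open>Mean value inequalities with an exceptional null set\<close>

text \<open>Suppose the bound fails and tilt \<open>\<psi>\<close> to a function \<open>\<phi>\<close> with \<open>\<phi> a < \<phi> b\<close> that has negative derivative off \<open>N\<close>.  At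
the last time at which \<open>\<phi>\<close> takes a given intermediate value it cannot have a negative derivative, so every intermediate
value is attained on \<open>N\<close>.  But \<open>\<phi> ` N\<close> is null.  The Lipschitz bounds are centred at the points
of \<open>N\<close>, which is what a composition with a merely differentiable function provides.\<close>

lemma growth_bound:
  fixes \<psi> :: "real \<Rightarrow> real"
  assumes ab: "a \<le> b" and cont: "continuous_on {a..b} \<psi>" and N: "negligible N"
    and lip: "\<And>t. t \<in> N \<Longrightarrow> t \<in> {a..b} \<Longrightarrow>
      \<exists>T B. open T \<and> t \<in> T \<and> (\<forall>s\<in>{a..b} \<inter> T. \<bar>\<psi> s - \<psi> t\<bar> \<le> B * \<bar>s - t\<bar>)"
    and der: "\<And>t. a < t \<Longrightarrow> t < b \<Longrightarrow> t \<notin> N \<Longrightarrow> \<exists>D\<le>c. (\<psi> has_real_derivative D) (at t)"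
  shows "\<psi> b - \<psi> a \<le> c * (b - a)"
proof (rule ccontr)
  assume "\<not> ?thesis"
  then have gt: "c * (b - a) < \<psi> b - \<psi> a" by simp
  then have "a < b" using ab by (cases "a = b") auto
  then have "c < (\<psi> b - \<psi> a) / (b - a)" using gt by (simp add: field_simps)
  then obtain c' where "c < c'" "c' < (\<psi> b - \<psi> a) / (b - a)" using dense by blast
  then have c': "c < c'" "c' * (b - a) < \<psi> b - \<psi> a" using \<open>a < b\<close> by (auto simp: field_simps)
  define \<phi> where "\<phi> t = \<psi> t - c' * t" for t
  have \<phi>ab: "\<phi> a < \<phi> b" using c' by (simp add: \<phi>_def algebra_simps)
  have cont\<phi>: "continuous_on {a..b} \<phi>" unfolding \<phi>_def by (intro continuous_intros cont)
  have "{\<phi> a<..<\<phi> b} \<subseteq> \<phi> ` (N \<inter> {a..b})"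
  proof
    fix y assume "y \<in> {\<phi> a<..<\<phi> b}"
    then have y: "\<phi> a < y" "y < \<phi> b" by auto
    define A where "A = {t \<in> {a..b}. \<phi> t \<le> y}"
    have "compact A"
    proof -
      have "closed A" unfolding A_def
        by (intro continuous_on_closed_Collect_le cont\<phi> continuous_intros closed_atLeastAtMost)
      moreover have "bounded A" by (rule bounded_subset[of "{a..b}"]) (auto simp: A_def)
      ultimately show ?thesis by (simp add: compact_eq_bounded_closed)
    qed
    moreover have "a \<in> A" using y \<open>a < b\<close> by (simp add: A_def)
    ultimately obtain t where t: "t \<in> A" "\<And>s. s \<in> A \<Longrightarrow> s \<le> t"
      using compact_attains_sup[of A] by blast
    have t': "a \<le> t" "t \<le> b" "\<phi> t \<le> y" using t(1) by (auto simp: A_def)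
    have above: "y < \<phi> s" if "t < s" "s \<le> b" for s
      using t(2)[of s] that t' unfolding A_def by force
    have "t < b" using t' y by (cases "t = b") auto
    have yt: "\<phi> t = y"
    proof -
      obtain x where "t \<le> x" "x \<le> b" "\<phi> x = y"
        using IVT'[of \<phi> t y b] t' y continuous_on_subset[OF cont\<phi>, of "{t..b}"] by auto
      then show ?thesis using above[of x] by (cases "x = t") auto
    qed
    then have "a < t" using t' y by (cases "a = t") auto
    have "t \<in> N"
    proof (rule ccontr)
      assume "t \<notin> N"
      then obtain D where D: "D \<le> c" "(\<psi> has_real_derivative D) (at t)"
        using der \<open>a < t\<close> \<open>t < b\<close> by blast
      have "(\<phi> has_real_derivative (D - c')) (at t)"
        unfolding \<phi>_def using D(2) by (auto intro!: derivative_eq_intros)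
      then obtain d where d: "0 < d" "\<And>h. 0 < h \<Longrightarrow> h < d \<Longrightarrow> \<phi> (t + h) < \<phi> t"
        using DERIV_neg_dec_right[of \<phi> "D - c'" t] D(1) c'(1) by auto
      define h where "h = min (d / 2) (b - t)"
      have "0 < h" "h < d" "t + h \<le> b" using d \<open>t < b\<close> by (auto simp: h_def)
      then show False using d(2)[of h] above[of "t + h"] yt by auto
    qed
    then show "y \<in> \<phi> ` (N \<inter> {a..b})" using t' yt by auto
  qed
  moreover have "negligible (\<phi> ` (N \<inter> {a..b}))"
  proof (rule negligible_locally_Lipschitz_image)
    show "negligible (N \<inter> {a..b})" using N by (rule negligible_Int[OF disjI1])
    fix t assume t: "t \<in> N \<inter> {a..b}"
    then obtain T B where T: "open T" "t \<in> T" "\<forall>s\<in>{a..b} \<inter> T. \<bar>\<psi> s - \<psi> t\<bar> \<le> B * \<bar>s - t\<bar>"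
      using lip[of t] by blast
    have "norm (\<phi> s - \<phi> t) \<le> (B + \<bar>c'\<bar>) * norm (s - t)" if "s \<in> N \<inter> {a..b} \<inter> T" for s
    proof -
      have "norm (\<phi> s - \<phi> t) \<le> \<bar>\<psi> s - \<psi> t\<bar> + \<bar>c' * (s - t)\<bar>"
        using abs_triangle_ineq4[of "\<psi> s - \<psi> t" "c' * (s - t)"]
        unfolding \<phi>_def by (simp add: right_diff_distrib)
      moreover have "\<bar>\<psi> s - \<psi> t\<bar> \<le> B * \<bar>s - t\<bar>" using T(3) that by blast
      ultimately show ?thesis by (simp add: abs_mult distrib_right)
    qed
    then show "\<exists>T B. open T \<and> t \<in> T \<and> (\<forall>s\<in>N \<inter> {a..b} \<inter> T. norm (\<phi> s - \<phi> t) \<le> B * norm (s - t))"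
      using T(1,2) by blast
  qed simp
  ultimately have "negligible {\<phi> a<..<\<phi> b}" by (rule negligible_subset[rotated])
  then show False using \<phi>ab negligible_interval(2)[of "\<phi> a" "\<phi> b"] by simp
qed

definition disjoint_intervals :: "real \<Rightarrow> real \<Rightarrow> (real \<times> real) set \<Rightarrow> bool" where
  "disjoint_intervals a b D \<longleftrightarrow> finite D \<and> (\<forall>(l, r)\<in>D. a \<le> l \<and> l \<le> r \<and> r \<le> b) \<and>
     pairwise (\<lambda>k k'. disjnt {fst k<..<snd k} {fst k'<..<snd k'}) D"

lemma AC_on_iff:
  "AC_on a b z \<longleftrightarrow> (\<forall>e>0. \<exists>d>0. \<forall>D. disjoint_intervals a b D \<and> (\<Sum>(l, r)\<in>D. r - l) < d
     \<longrightarrow> (\<Sum>(l, r)\<in>D. dist (z l) (z r)) < e)"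
  by (simp add: AC_on_def disjoint_intervals_def)

text \<open>Cover \<open>N\<close> by an open set \<open>G\<close> so small that absolute continuity bounds the total increment over disjoint intervals inside
\<open>G\<close>.  Every short interval around a point of \<open>N\<close> lies in \<open>G\<close>, every short interval around another point obeys the
derivative bound, and the bisection principle \<open>Bolzano\<close> glues these local estimates together.\<close>

lemma AC_bounded_derivative:
  fixes z :: "real \<Rightarrow> 'a::real_normed_vector"
  assumes ab: "a \<le> b" and AC: "AC_on a b z" and N: "negligible N" and M: "0 \<le> M"
    and der: "\<And>t. t \<in> {a..b} \<Longrightarrow> t \<notin> N \<Longrightarrow>
      \<exists>d. norm d \<le> M \<and> (z has_vector_derivative d) (at t within {a..b})"
  shows "norm (z b - z a) \<le> M * (b - a)"
proof (rule field_le_epsilon)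
  fix e :: real assume e: "0 < e"
  obtain \<eta> where \<eta>: "0 < \<eta>" "\<eta> * (b - a) \<le> e / 2"
    using small_positive[of 1 1 "e / 2" "b - a"] e ab by auto
  obtain \<delta> where \<delta>: "0 < \<delta>" "\<And>D. disjoint_intervals a b D \<Longrightarrow> (\<Sum>(l, r)\<in>D. r - l) < \<delta>
      \<Longrightarrow> (\<Sum>(l, r)\<in>D. dist (z l) (z r)) < e / 2"
    using AC[unfolded AC_on_iff, rule_format, OF half_gt_zero[OF e]] by blast
  obtain G where G: "open G" "N \<subseteq> G" "G \<in> lmeasurable" "measure lebesgue G < \<delta>"
  proof -
    obtain G where G: "open G" "N \<subseteq> G" "G - N \<in> lmeasurable" "emeasure lebesgue (G - N) < ennreal \<delta>"
      using sets_lebesgue_outer_open[OF negligible_imp_sets[OF N] \<delta>(1)] by blast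
    have eq: "G = (G - N) \<union> N" using G(2) by auto
    have "G \<in> lmeasurable" using eq G(3) negligible_imp_measurable[OF N] fmeasurable.Un by metis
    moreover have "measure lebesgue G = measure lebesgue (G - N)"
      using N eq G(3) by (metis fmeasurableD measure_Un_null_set negligible_iff_null_sets)
    moreover have "measure lebesgue (G - N) < \<delta>"
      using G(3,4) by (simp add: emeasure_eq_measure2 ennreal_less_iff)
    ultimately show ?thesis using that G by simp
  qed
  define Q where "Q l r D \<longleftrightarrow> disjoint_intervals l r D \<and> (\<forall>(l', r')\<in>D. l' < r' \<and> {l'<..<r'} \<subseteq> G) \<and>
     norm (z r - z l) \<le> (M + \<eta>) * (r - l) + (\<Sum>(l', r')\<in>D. dist (z l') (z r'))" for l r D
  define P where "P l r \<longleftrightarrow> (a \<le> l \<longrightarrow> r \<le> b \<longrightarrow> (\<exists>D. Q l r D))" for l r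
  have "P a b"
    using ab
  proof (induction rule: Bolzano)
    case (trans l m r)
    show ?case
      unfolding P_def
    proof (intro impI)
      assume lr: "a \<le> l" "r \<le> b"
      obtain D1 D2 where D: "Q l m D1" "Q m r D2"
        using trans lr unfolding P_def by force
      then have D1: "disjoint_intervals l m D1" "\<forall>(l', r')\<in>D1. l' < r' \<and> {l'<..<r'} \<subseteq> G"
        and D2: "disjoint_intervals m r D2" "\<forall>(l', r')\<in>D2. l' < r' \<and> {l'<..<r'} \<subseteq> G"
        and n: "norm (z m - z l) \<le> (M + \<eta>) * (m - l) + (\<Sum>(l', r')\<in>D1. dist (z l') (z r'))"
          "norm (z r - z m) \<le> (M + \<eta>) * (r - m) + (\<Sum>(l', r')\<in>D2. dist (z l') (z r'))"
        by (auto simp: Q_def)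
      have dj: "disjnt {fst k<..<snd k} {fst k'<..<snd k'}" if "k \<in> D1" "k' \<in> D2" for k k'
        using D1(1) D2(1) that unfolding disjoint_intervals_def by (fastforce simp: disjnt_def)
      have "D1 \<inter> D2 = {}"
        using D1 D2 unfolding disjoint_intervals_def by fastforce
      then have sum: "(\<Sum>(l', r')\<in>D1 \<union> D2. dist (z l') (z r')) =
          (\<Sum>(l', r')\<in>D1. dist (z l') (z r')) + (\<Sum>(l', r')\<in>D2. dist (z l') (z r'))"
        using D1(1) D2(1) unfolding disjoint_intervals_def by (intro sum.union_disjoint) auto
      have "norm (z r - z l) \<le> norm (z m - z l) + norm (z r - z m)"
        using norm_triangle_ineq[of "z m - z l" "z r - z m"] by simp
      then have "norm (z r - z l) \<le> (M + \<eta>) * (r - l) + (\<Sum>(l', r')\<in>D1 \<union> D2. dist (z l') (z r'))"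
        using n sum by (simp add: algebra_simps)
      moreover have "\<forall>(l', r')\<in>D1 \<union> D2. l \<le> l' \<and> l' \<le> r' \<and> r' \<le> r"
        using D1(1) D2(1) trans(3,4) unfolding disjoint_intervals_def by fastforce
      moreover have "pairwise (\<lambda>k k'. disjnt {fst k<..<snd k} {fst k'<..<snd k'}) (D1 \<union> D2)"
        using D1(1) D2(1) dj disjnt_sym unfolding disjoint_intervals_def pairwise_def by blast
      ultimately have "Q l r (D1 \<union> D2)"
        using D1 D2 by (simp add: Q_def disjoint_intervals_def ball_Un)
      then show "\<exists>D. Q l r D" ..
    qed
  next
    case (local t)
    show ?case
    proof (cases "t \<in> N")
      case True
      then obtain \<rho> where \<rho>: "0 < \<rho>" "ball t \<rho> \<subseteq> G" using G(1,2) open_contains_ball by blast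
      have "P l r" if lr: "l \<le> t" "t \<le> r" "r - l < \<rho>" for l r
      proof (cases "l = r")
        case False
        have "{l<..<r} \<subseteq> ball t \<rho>" using lr by (auto simp: dist_real_def)
        then show ?thesis
          unfolding P_def Q_def disjoint_intervals_def using False lr \<rho>(2) M \<eta>(1)
          by (intro impI exI[of _ "{(l, r)}"]) (auto simp: dist_norm norm_minus_commute)
      qed (simp add: P_def Q_def disjoint_intervals_def exI[of _ "{}"])
      then show ?thesis using \<rho>(1) by blast
    next
      case False
      then obtain v where v: "norm v \<le> M" "(z has_vector_derivative v) (at t within {a..b})"
        using der local by (meson atLeastAtMost_iff)
      then obtain d where d: "0 < d" "\<And>s. s \<in> {a..b} \<Longrightarrow> norm (s - t) < d \<Longrightarrow>
          norm (z s - z t - (s - t) *\<^sub>R v) \<le> \<eta> * norm (s - t)"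
        unfolding has_vector_derivative_def has_derivative_within_alt using \<eta>(1) by blast
      have near: "norm (z s - z t) \<le> (M + \<eta>) * \<bar>s - t\<bar>" if "s \<in> {a..b}" "\<bar>s - t\<bar> < d" for s
      proof -
        have "norm (z s - z t) \<le> norm (z s - z t - (s - t) *\<^sub>R v) + norm ((s - t) *\<^sub>R v)"
          using norm_triangle_ineq[of "z s - z t - (s - t) *\<^sub>R v" "(s - t) *\<^sub>R v"] by simp
        also have "\<dots> \<le> \<eta> * \<bar>s - t\<bar> + \<bar>s - t\<bar> * M"
          using d(2)[of s] that v(1) by (intro add_mono) (auto intro: mult_left_mono)
        finally show ?thesis by (simp add: algebra_simps)
      qed
      have "P l r" if lr: "l \<le> t" "t \<le> r" "r - l < d" for l r
        unfolding P_def
      proof (intro impI exI[of _ "{}"])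
        assume "a \<le> l" "r \<le> b"
        then have "norm (z l - z t) \<le> (M + \<eta>) * \<bar>l - t\<bar>" "norm (z r - z t) \<le> (M + \<eta>) * \<bar>r - t\<bar>"
          using near[of l] near[of r] lr by auto
        moreover have "norm (z r - z l) \<le> norm (z r - z t) + norm (z l - z t)"
          using norm_triangle_ineq4[of "z r - z t" "z l - z t"] by simp
        ultimately show "Q l r {}"
          using lr by (simp add: Q_def disjoint_intervals_def algebra_simps)
      qed
      then show ?thesis using d(1) by blast
    qed
  qed
  then obtain D where Q: "Q a b D" unfolding P_def by blast
  then have D: "finite D" "\<forall>(l', r')\<in>D. l' < r' \<and> {l'<..<r'} \<subseteq> G"
     "pairwise (\<lambda>k k'. disjnt {fst k<..<snd k} {fst k'<..<snd k'}) D"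
     "norm (z b - z a) \<le> (M + \<eta>) * (b - a) + (\<Sum>(l', r')\<in>D. dist (z l') (z r'))"
    by (auto simp: Q_def disjoint_intervals_def)
  have "(\<Sum>(l, r)\<in>D. r - l) = (\<Sum>k\<in>D. measure lebesgue {fst k<..<snd k})"
    by (rule sum.cong) (use D(2) in auto)
  also have "\<dots> = measure lebesgue (\<Union>k\<in>D. {fst k<..<snd k})"
    using D(1,3) by (intro measure_UNION'[symmetric]) auto
  also have "\<dots> \<le> measure lebesgue G"
    using D(1,2) G by (intro measure_mono_fmeasurable) force+
  also have "\<dots> < \<delta>" by (rule G)
  finally have "(\<Sum>(l, r)\<in>D. dist (z l) (z r)) < e / 2"
    using Q by (intro \<delta>(2)) (simp_all add: Q_def)
  then show "norm (z b - z a) \<le> M * (b - a) + e"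
    using D(4) \<eta>(2) by (simp add: distrib_right)
qed

lemma Lipschitz_imp_AC_on:
  fixes z :: "real \<Rightarrow> 'a::metric_space"
  assumes "M-lipschitz_on {a..b} z"
  shows "AC_on a b z"
  unfolding AC_on_iff
proof (intro allI impI)
  fix e :: real assume e: "0 < e"
  have M: "0 \<le> M" using assms lipschitz_on_nonneg by blast
  have "(\<Sum>(l, r)\<in>D. dist (z l) (z r)) < e"
    if D: "disjoint_intervals a b D \<and> (\<Sum>(l, r)\<in>D. r - l) < e / (M + 1)" for D
  proof -
    have "(\<Sum>(l, r)\<in>D. dist (z l) (z r)) \<le> (\<Sum>(l, r)\<in>D. (M + 1) * (r - l))"
    proof (rule sum_mono, clarify)
      fix l r assume "(l, r) \<in> D"
      then have lr: "a \<le> l" "l \<le> r" "r \<le> b" using D unfolding disjoint_intervals_def by auto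
      then have "dist (z l) (z r) \<le> M * (r - l)"
        using lipschitz_onD[OF assms, of l r] by (simp add: dist_real_def)
      also have "\<dots> \<le> (M + 1) * (r - l)" using lr by (intro mult_right_mono) auto
      finally show "dist (z l) (z r) \<le> (M + 1) * (r - l)" .
    qed
    also have "\<dots> = (M + 1) * (\<Sum>(l, r)\<in>D. r - l)" by (simp add: sum_distrib_left case_prod_unfold)
    also have "\<dots> < e" using D M by (simp add: pos_less_divide_eq mult.commute)
    finally show ?thesis .
  qed
  then show "\<exists>d>0. \<forall>D. disjoint_intervals a b D \<and> (\<Sum>(l, r)\<in>D. r - l) < d
      \<longrightarrow> (\<Sum>(l, r)\<in>D. dist (z l) (z r)) < e"
    using e M by (intro exI[of _ "e / (M + 1)"]) auto
qed

section \<open>Growth along solutions\<close>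

lemma solution_on_AE_derivative:
  assumes "solution_on X F I z"
  obtains N where "negligible N"
    "\<And>t. t \<in> I \<Longrightarrow> t \<notin> N \<Longrightarrow> (z has_vector_derivative F (z t)) (at t within I)"
proof -
  have "AE t in lebesgue. t \<in> I \<longrightarrow> (z has_vector_derivative F (z t)) (at t within I)"
    using assms by (simp add: solution_on_def)
  then obtain N where "N \<in> null_sets lebesgue"
    "{t \<in> space lebesgue. \<not> (t \<in> I \<longrightarrow> (z has_vector_derivative F (z t)) (at t within I))} \<subseteq> N"
    by (auto simp: eventually_ae_filter)
  then show ?thesis using that[of N] by (auto simp: negligible_iff_null_sets)
qed

lemma solution_Lipschitz:
  assumes sol: "solution_on X F I z" and sub: "{a..b} \<subseteq> I" and M: "0 \<le> M"
    and bd: "\<And>t. t \<in> {a..b} \<Longrightarrow> norm (F (z t)) \<le> M"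
  shows "M-lipschitz_on {a..b} z"
proof -
  obtain N where N: "negligible N"
    "\<And>t. t \<in> I \<Longrightarrow> t \<notin> N \<Longrightarrow> (z has_vector_derivative F (z t)) (at t within I)"
    using solution_on_AE_derivative[OF sol] by blast
  have le: "norm (z r - z l) \<le> M * (r - l)" if lr: "a \<le> l" "l \<le> r" "r \<le> b" for l r
  proof (rule AC_bounded_derivative[OF lr(2) _ N(1) M])
    have sub': "{l..r} \<subseteq> I" using sub lr by auto
    then show "AC_on l r z" using sol by (simp add: solution_on_def)
    fix t assume t: "t \<in> {l..r}" "t \<notin> N"
    have "(z has_vector_derivative F (z t)) (at t within {l..r})"
      by (rule has_vector_derivative_within_subset[OF N(2) sub']) (use t sub' in auto)
    then show "\<exists>d. norm d \<le> M \<and> (z has_vector_derivative d) (at t within {l..r})"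
      using bd[of t] t lr by auto
  qed
  show ?thesis
  proof (rule lipschitz_onI[OF _ M])
    fix x y assume "x \<in> {a..b}" "y \<in> {a..b}"
    then show "dist (z x) (z y) \<le> M * dist x y"
      using le[of x y] le[of y x]
      by (cases "x \<le> y") (auto simp: dist_norm norm_minus_commute)
  qed
qed

lemma has_derivative_imp_pointwise_Lipschitz:
  assumes "(V has_derivative V') (at x)"
  obtains B \<delta> where "0 \<le> B" "0 < \<delta>" "\<forall>y. norm (y - x) < \<delta> \<longrightarrow> norm (V y - V x) \<le> B * norm (y - x)"
proof -
  have bl: "bounded_linear V'" using assms has_derivative_bounded_linear by blast
  obtain \<delta> where \<delta>: "0 < \<delta>" "\<And>y. norm (y - x) < \<delta> \<Longrightarrow> norm (V y - V x - V' (y - x)) \<le> 1 * norm (y - x)"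
    using assms zero_less_one unfolding has_derivative_at_alt by blast
  have "norm (V y - V x) \<le> (onorm V' + 1) * norm (y - x)" if "norm (y - x) < \<delta>" for y
  proof -
    have "norm (V y - V x) \<le> norm (V y - V x - V' (y - x)) + norm (V' (y - x))"
      using norm_triangle_ineq[of "V y - V x - V' (y - x)" "V' (y - x)"] by simp
    also have "\<dots> \<le> 1 * norm (y - x) + onorm V' * norm (y - x)"
      using \<delta>(2)[OF that] onorm[OF bl] by (intro add_mono)
    finally show ?thesis by (simp add: algebra_simps)
  qed
  then show ?thesis using that[of "onorm V' + 1" \<delta>] \<delta>(1) onorm_pos_le[OF bl] by simp
qed

text \<open>A differentiable \<open>V\<close> is pointwise Lipschitz at every point, hence so is its composition with a Lipschitz curve, even at the
times at which the curve has no derivative.\<close>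

lemma solution_growth:
  fixes V :: "'a::euclidean_space \<Rightarrow> real"
  assumes sol: "solution_on X F I z" and sub: "{a..b} \<subseteq> I" and ab: "a \<le> b"
    and lip: "M-lipschitz_on {a..b} z"
    and V: "\<And>x. (V has_derivative V' x) (at x)"
    and bd: "\<And>t. t \<in> {a..b} \<Longrightarrow> V' (z t) (F (z t)) \<le> c"
  shows "V (z b) - V (z a) \<le> c * (b - a)"
proof -
  obtain N where N: "negligible N"
    "\<And>t. t \<in> I \<Longrightarrow> t \<notin> N \<Longrightarrow> (z has_vector_derivative F (z t)) (at t within I)"
    using solution_on_AE_derivative[OF sol] by blast
  have M: "0 \<le> M" using lip lipschitz_on_nonneg by blast
  have contV: "continuous_on UNIV V"
    using V by (meson continuous_at_imp_continuous_on has_derivative_continuous)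
  show ?thesis
  proof (rule growth_bound[OF ab _ N(1)])
    show "continuous_on {a..b} (\<lambda>t. V (z t))"
      by (rule continuous_on_compose2[OF contV lipschitz_on_continuous_on[OF lip]]) simp
  next
    fix t assume t: "t \<in> N" "t \<in> {a..b}"
    obtain B \<delta> where B: "0 \<le> B" "0 < \<delta>"
      "\<forall>y. norm (y - z t) < \<delta> \<longrightarrow> norm (V y - V (z t)) \<le> B * norm (y - z t)"
      by (rule has_derivative_imp_pointwise_Lipschitz[OF V[of "z t"]])
    have "\<bar>V (z s) - V (z t)\<bar> \<le> B * M * \<bar>s - t\<bar>" if "s \<in> {a..b} \<inter> ball t (\<delta> / (M + 1))" for s
    proof -
      have zz: "norm (z s - z t) \<le> M * \<bar>s - t\<bar>"
        using lipschitz_onD[OF lip, of s t] that t by (simp add: dist_norm)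
      have st: "\<bar>s - t\<bar> < \<delta> / (M + 1)" using that by (simp add: dist_real_def abs_minus_commute)
      have "M * \<bar>s - t\<bar> \<le> (M + 1) * \<bar>s - t\<bar>" by (intro mult_right_mono) auto
      also have "\<dots> < \<delta>" using st M by (simp add: pos_less_divide_eq mult.commute)
      finally have "norm (V (z s) - V (z t)) \<le> B * norm (z s - z t)" using zz B(3) by simp
      also have "\<dots> \<le> B * (M * \<bar>s - t\<bar>)" using zz B(1) by (rule mult_left_mono)
      finally show ?thesis by simp
    qed
    moreover have "0 < \<delta> / (M + 1)" using B(2) M by simp
    ultimately show "\<exists>T B. open T \<and> t \<in> T \<and> (\<forall>s\<in>{a..b} \<inter> T. \<bar>V (z s) - V (z t)\<bar> \<le> B * \<bar>s - t\<bar>)"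
      by (intro exI[of _ "ball t (\<delta> / (M + 1))"] exI[of _ "B * M"]) auto
  next
    fix t assume t: "a < t" "t < b" "t \<notin> N"
    have "t \<in> I" using t sub by auto
    have "(z has_vector_derivative F (z t)) (at t within {a<..<b})"
      by (rule has_vector_derivative_within_subset[OF N(2)[OF \<open>t \<in> I\<close> t(3)]]) (use sub in auto)
    then have "(z has_vector_derivative F (z t)) (at t)"
      using t by (simp add: at_within_open[of t "{a<..<b}"])
    then have "((\<lambda>t. V (z t)) has_vector_derivative V' (z t) (F (z t))) (at t)"
      using vector_derivative_diff_chain_within[of z "F (z t)" t UNIV V "V' (z t)"] V[of "z t"]
      by (simp add: o_def has_derivative_at_withinI)
    then show "\<exists>D\<le>c. ((\<lambda>t. V (z t)) has_real_derivative D) (at t)"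
      using bd[of t] t by (auto simp: has_real_derivative_iff_has_vector_derivative)
  qed
qed

section \<open>Contingent cones and projections onto them\<close>

text \<open>The Bouligand tangent cone; the same \<open>e\<close> bounds the step length and the relative error.\<close>

definition contingent_cone :: "'a::real_normed_vector set \<Rightarrow> 'a \<Rightarrow> 'a set" where
  "contingent_cone S z = {w. \<forall>e>0. \<exists>s. 0 < s \<and> s < e \<and> (\<exists>y\<in>S. norm (y - z - s *\<^sub>R w) \<le> e * s)}"

definition inner_semicontinuous_on :: "'a::real_normed_vector set \<Rightarrow> ('a \<Rightarrow> 'a set) \<Rightarrow> bool" where
  "inner_semicontinuous_on S T \<longleftrightarrow>
     (\<forall>z\<in>S. \<forall>w\<in>T z. \<forall>e>0. \<exists>d>0. \<forall>y\<in>S. dist y z < d \<longrightarrow> (\<exists>w'\<in>T y. norm (w' - w) \<le> e))"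

lemma zero_in_contingent_cone: "z \<in> S \<Longrightarrow> 0 \<in> contingent_cone S z"
  unfolding contingent_cone_def
proof (clarsimp)
  fix e :: real assume "z \<in> S" "0 < e"
  then show "\<exists>s>0. s < e \<and> (\<exists>y\<in>S. norm (y - z) \<le> e * s)"
    by (intro exI[of _ "e/2"] conjI bexI[of _ z]) auto
qed

lemma closed_contingent_cone: "closed (contingent_cone S z)"
  unfolding closure_subset_eq[symmetric]
proof
  fix w assume w: "w \<in> closure (contingent_cone S z)"
  show "w \<in> contingent_cone S z"
    unfolding contingent_cone_def
  proof (intro CollectI allI impI)
    fix e :: real assume e: "0 < e"
    then obtain w' where w': "w' \<in> contingent_cone S z" "dist w' w < e/2"
      using w unfolding closure_approachable by (meson half_gt_zero)
    then obtain s y where s: "0 < s" "s < e/2" "y \<in> S" "norm (y - z - s *\<^sub>R w') \<le> e/2 * s"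
      unfolding contingent_cone_def using half_gt_zero[OF e] by blast
    have "norm (y - z - s *\<^sub>R w) \<le> norm (y - z - s *\<^sub>R w') + norm (s *\<^sub>R (w' - w))"
      using norm_triangle_ineq[of "y - z - s *\<^sub>R w'" "s *\<^sub>R (w' - w)"] by (simp add: algebra_simps)
    moreover have "norm (s *\<^sub>R (w' - w)) = s * dist w' w" using s by (simp add: dist_norm)
    moreover have "s * dist w' w \<le> s * (e/2)" using w' s by (intro mult_left_mono) auto
    moreover have "s * (e/2) + e/2 * s = e * s" by simp
    ultimately have "norm (y - z - s *\<^sub>R w) \<le> e * s" using s(4) by linarith
    then show "\<exists>s>0. s < e \<and> (\<exists>y\<in>S. norm (y - z - s *\<^sub>R w) \<le> e * s)"
      using s e by (intro exI[of _ s]) auto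
  qed
qed

text \<open>First-order optimality of the closest point in a set that may not be convex: moving from the closest point
into \<open>S\<close> along \<open>w\<close> changes the squared distance by \<open>- 2 s (r \<bullet> w)\<close> up to terms of higher order in the step \<open>s\<close>,
where \<open>r\<close> is the residual.\<close>

lemma closest_point_residual_polar:
  fixes S :: "'a::euclidean_space set"
  assumes S: "closed S" "S \<noteq> {}" and w: "w \<in> contingent_cone S (closest_point S a)"
  shows "(a - closest_point S a) \<bullet> w \<le> 0"
proof -
  define y where "y = closest_point S a"
  define r where "r = a - y"
  define K where "K = 2 * norm r + (norm w + 1)\<^sup>2"
  have K: "0 \<le> K" by (simp add: K_def)
  have main: "2 * (r \<bullet> w) \<le> K * e" if e: "0 < e" "e \<le> 1" for e
  proof -
    obtain s y' where s: "0 < s" "s < e" "y' \<in> S" "norm (y' - y - s *\<^sub>R w) \<le> e * s"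
      using w e(1) unfolding contingent_cone_def y_def by blast
    define \<rho> where "\<rho> = y' - y - s *\<^sub>R w"
    have d: "y' - y = s *\<^sub>R w + \<rho>" by (simp add: \<rho>_def)
    have "norm r \<le> norm (r - (y' - y))"
      using closest_point_le[OF S(1) s(3), of a] by (simp add: y_def r_def dist_norm)
    then have "(norm r)\<^sup>2 \<le> (norm (r - (y' - y)))\<^sup>2" by (simp add: power_mono)
    then have 1: "2 * (r \<bullet> (y' - y)) \<le> (norm (y' - y))\<^sup>2"
      by (simp add: power2_norm_eq_inner inner_diff inner_commute algebra_simps)
    have \<rho>: "norm \<rho> \<le> e * s" using s(4) by (simp add: \<rho>_def)
    have "norm (y' - y) \<le> s * norm w + e * s"
      unfolding d using norm_triangle_ineq[of "s *\<^sub>R w" \<rho>] \<rho> s(1) by simp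
    also have "\<dots> \<le> s * (norm w + 1)" using e s(1) by (simp add: algebra_simps)
    finally have "(norm (y' - y))\<^sup>2 \<le> (s * (norm w + 1))\<^sup>2" by (simp add: power_mono)
    also have "\<dots> = s * s * (norm w + 1)\<^sup>2" by (simp add: power2_eq_square algebra_simps)
    also have "\<dots> \<le> s * e * (norm w + 1)\<^sup>2" using s by (intro mult_right_mono mult_left_mono) auto
    finally have 2: "(norm (y' - y))\<^sup>2 \<le> s * e * (norm w + 1)\<^sup>2" .
    have "- (r \<bullet> \<rho>) \<le> norm r * norm \<rho>" using Cauchy_Schwarz_ineq2[of r \<rho>] by linarith
    also have "\<dots> \<le> norm r * (e * s)" using \<rho> by (intro mult_left_mono) auto
    finally have 3: "- (r \<bullet> \<rho>) \<le> norm r * (e * s)" .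
    have "r \<bullet> (y' - y) = s * (r \<bullet> w) + r \<bullet> \<rho>" unfolding d by (simp add: inner_add_right)
    then have "2 * s * (r \<bullet> w) \<le> s * e * (norm w + 1)\<^sup>2 + 2 * (norm r * (e * s))"
      using 1 2 3 by linarith
    also have "\<dots> = s * (K * e)" by (simp add: K_def algebra_simps)
    finally have "s * (2 * (r \<bullet> w)) \<le> s * (K * e)" by (simp add: algebra_simps)
    then show ?thesis using s(1) by simp
  qed
  have "2 * (r \<bullet> w) \<le> 0"
  proof (rule field_le_epsilon)
    fix \<epsilon> :: real assume "0 < \<epsilon>"
    then obtain e where "0 < e" "e \<le> 1" "e * K \<le> \<epsilon>" using small_positive[of 1 1 \<epsilon> K] K by auto
    then show "2 * (r \<bullet> w) \<le> 0 + \<epsilon>" using main[of e] by (simp add: mult.commute)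
  qed
  then show ?thesis by (simp add: r_def y_def)
qed

text \<open>At an interior time both velocities, forwards and backwards, are tangent.\<close>

lemma derivative_in_contingent_cone:
  assumes der: "(z has_vector_derivative d) (at t)" and \<delta>: "0 < \<delta>"
    and S: "\<And>s. \<bar>s - t\<bar> < \<delta> \<Longrightarrow> z s \<in> S" and \<sigma>: "\<sigma> = 1 \<or> \<sigma> = -1"
  shows "\<sigma> *\<^sub>R d \<in> contingent_cone S (z t)"
  unfolding contingent_cone_def
proof (intro CollectI allI impI)
  fix e :: real assume e: "0 < e"
  then obtain \<eta> where \<eta>: "0 < \<eta>"
    "\<And>s. norm (s - t) < \<eta> \<Longrightarrow> norm (z s - z t - (s - t) *\<^sub>R d) \<le> e * norm (s - t)"
    using der unfolding has_vector_derivative_def has_derivative_at_alt by blast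
  define s where "s = min e (min \<delta> \<eta>) / 2"
  have s: "0 < s" "s < e" "s < \<delta>" "s < \<eta>" using e \<delta> \<eta>(1) by (auto simp: s_def)
  have "\<bar>\<sigma>\<bar> = 1" using \<sigma> by auto
  then have n: "\<bar>\<sigma> * s\<bar> = s" using s(1) by (simp add: abs_mult)
  have "norm (z (t + \<sigma> * s) - z t - s *\<^sub>R \<sigma> *\<^sub>R d) \<le> e * s"
    using \<eta>(2)[of "t + \<sigma> * s"] n s by (simp add: mult.commute)
  moreover have "z (t + \<sigma> * s) \<in> S" using S[of "t + \<sigma> * s"] n s by simp
  ultimately show "\<exists>s>0. s < e \<and> (\<exists>y\<in>S. norm (y - z t - s *\<^sub>R \<sigma> *\<^sub>R d) \<le> e * s)"
    using s by blast
qed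

text \<open>One half of Moreau's decomposition: a tangent part and a polar part that are orthogonal to each other.\<close>

lemma closest_point_cone_eqI:
  fixes T :: "'a::euclidean_space set"
  assumes T: "convex T" "closed T" and d: "d \<in> T" "(g - d) \<bullet> d = 0" "\<And>w. w \<in> T \<Longrightarrow> (g - d) \<bullet> w \<le> 0"
  shows "closest_point T g = d"
proof (rule closest_point_unique[OF T d(1), symmetric], rule ballI)
  fix w assume w: "w \<in> T"
  have "(norm (g - w))\<^sup>2 = (norm (g - d))\<^sup>2 + (norm (d - w))\<^sup>2 + 2 * ((g - d) \<bullet> d - (g - d) \<bullet> w)"
    by (simp add: power2_norm_eq_inner inner_diff inner_commute algebra_simps)
  moreover have "0 \<le> (norm (d - w))\<^sup>2 - 2 * ((g - d) \<bullet> w)"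
    using d(3)[OF w] by (intro order_trans[OF zero_le_power2[of "norm (d - w)"]]) simp
  ultimately have "(norm (g - d))\<^sup>2 \<le> (norm (g - w))\<^sup>2" using d(2) by simp
  then show "dist g d \<le> dist g w" by (simp add: dist_norm)
qed

section \<open>The projected Euler scheme and existence of solutions\<close>

text \<open>Tychonoff's theorem yields a cluster point in the topology of pointwise convergence.  That topology is not
metrizable, so no subsequence need converge, but finitely many times at once can be approximated, which
suffices for the passage to the limit in difference quotients.  The functions may therefore be discontinuous
interpolations.\<close>

lemma pointwise_cluster_point:
  fixes Z :: "nat \<Rightarrow> 't \<Rightarrow> 'a::metric_space"
  assumes K: "\<And>t. compact (K t)" and Z: "\<And>n t. Z n t \<in> K t"
  obtains z where "\<And>t. z t \<in> K t"
    "\<And>A e N. finite A \<Longrightarrow> 0 < e \<Longrightarrow> \<exists>n\<ge>N. \<forall>t\<in>A. dist (Z n t) (z t) < e"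
proof -
  have "compactin (product_topology (\<lambda>t::'t. euclidean::'a topology) UNIV) (PiE UNIV K)"
    unfolding compactin_PiE using K by simp
  then have "compact (PiE UNIV K)" unfolding euclidean_product_topology by simp
  moreover have "eventually (\<lambda>f. f \<in> PiE UNIV K) (filtermap Z sequentially)"
    using Z by (auto simp: eventually_filtermap intro!: always_eventually)
  moreover have "filtermap Z sequentially \<noteq> bot" by (simp add: filtermap_bot_iff)
  ultimately obtain z where z: "z \<in> PiE UNIV K" "inf (nhds z) (filtermap Z sequentially) \<noteq> bot"
    unfolding compact_filter by blast
  show ?thesis
  proof
    show "z t \<in> K t" for t using z(1) by auto
    fix A :: "'t set" and e :: real and N :: nat
    assume A: "finite A" "0 < e"
    define U where "U = {f. \<forall>t\<in>A. f t \<in> ball (z t) e}"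
    have "open U" unfolding U_def by (rule product_topology_basis'[where x="\<lambda>t. t"]) (use A in auto)
    moreover have "z \<in> U" using A by (simp add: U_def)
    ultimately have U: "eventually (\<lambda>f. f \<in> U) (nhds z)" by (rule eventually_nhds_in_open)
    show "\<exists>n\<ge>N. \<forall>t\<in>A. dist (Z n t) (z t) < e"
    proof (rule ccontr)
      assume "\<not> ?thesis"
      then have "\<forall>n\<ge>N. Z n \<notin> U" unfolding U_def by (simp add: dist_commute)
      then have "eventually (\<lambda>f. f \<notin> U) (filtermap Z sequentially)"
        unfolding eventually_filtermap eventually_sequentially by blast
      with U have "eventually (\<lambda>_. False) (inf (nhds z) (filtermap Z sequentially))"
        unfolding eventually_inf by blast
      then show False using z(2) by (simp add: eventually_False)
    qed
  qed
qed

text \<open>Convex and inner semicontinuous contingent cones characterise sets that are regular in the sense of Clarke.\<close>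

locale projected_system =
  fixes S :: "'a::euclidean_space set" and g :: "'a \<Rightarrow> 'a"
  assumes closed_S: "closed S"
    and cont_g: "continuous_on UNIV g"
    and convex_cone: "\<And>z. z \<in> S \<Longrightarrow> convex (contingent_cone S z)"
    and inner_semicont: "inner_semicontinuous_on S (contingent_cone S)"
begin

definition field :: "'a \<Rightarrow> 'a" where
  "field z = closest_point (contingent_cone S z) (g z)"

end

text \<open>Each explicit Euler step is projected onto the set \<open>S\<close> itself rather than onto a tangent cone, so the iterates never
leave \<open>S\<close>.\<close>

primrec projected_Euler :: "'a::euclidean_space set \<Rightarrow> ('a \<Rightarrow> 'a) \<Rightarrow> 'a \<Rightarrow> real \<Rightarrow> nat \<Rightarrow> 'a" where
  "projected_Euler S g z0 \<eta> 0 = z0"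
| "projected_Euler S g z0 \<eta> (Suc k) =
    closest_point S (projected_Euler S g z0 \<eta> k + \<eta> *\<^sub>R g (projected_Euler S g z0 \<eta> k))"

context
  fixes S :: "'a::euclidean_space set" and g :: "'a \<Rightarrow> 'a" and z0 :: 'a and M \<eta> :: real
  assumes S: "closed S" "z0 \<in> S" and M: "\<And>z. z \<in> S \<Longrightarrow> norm (g z) \<le> M" and \<eta>: "0 < \<eta>"
begin

abbreviation "iter \<equiv> projected_Euler S g z0 \<eta>"

lemma Euler_in: "iter k \<in> S"
  using S closest_point_in_set by (cases k) auto

lemma Euler_residual: "norm (iter k + \<eta> *\<^sub>R g (iter k) - iter (Suc k)) \<le> \<eta> * M"
proof -
  have "norm (iter k + \<eta> *\<^sub>R g (iter k) - iter (Suc k)) \<le> norm (iter k + \<eta> *\<^sub>R g (iter k) - iter k)"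
    using closest_point_le[OF S(1) Euler_in[of k], of "iter k + \<eta> *\<^sub>R g (iter k)"] by (simp add: dist_norm)
  also have "\<dots> \<le> \<eta> * M" using M[OF Euler_in] \<eta> by simp
  finally show ?thesis .
qed

lemma Euler_step: "norm (iter (Suc k) - iter k) \<le> 2 * M * \<eta>"
proof -
  have "norm (iter (Suc k) - iter k) \<le> norm (\<eta> *\<^sub>R g (iter k)) + norm (iter k + \<eta> *\<^sub>R g (iter k) - iter (Suc k))"
    using norm_triangle_ineq4[of "\<eta> *\<^sub>R g (iter k)" "iter k + \<eta> *\<^sub>R g (iter k) - iter (Suc k)"] by (simp add: algebra_simps)
  also have "\<dots> \<le> \<eta> * M + \<eta> * M"
    using M[OF Euler_in] \<eta> Euler_residual[of k] by (intro add_mono) simp_all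
  finally show ?thesis by simp
qed

lemma Euler_dist: "i \<le> j \<Longrightarrow> norm (iter j - iter i) \<le> 2 * M * (\<eta> * real (j - i))"
proof (induction j rule: dec_induct)
  case (step n)
  have "norm (iter (Suc n) - iter i) \<le> norm (iter (Suc n) - iter n) + norm (iter n - iter i)"
    using norm_triangle_ineq[of "iter (Suc n) - iter n" "iter n - iter i"] by simp
  also have "\<dots> \<le> 2 * M * \<eta> + 2 * M * (\<eta> * real (n - i))"
    using step.IH Euler_step[of n] by linarith
  also have "\<dots> = 2 * M * (\<eta> * real (Suc n - i))" using step.hyps by (simp add: Suc_diff_le algebra_simps)
  finally show ?case .
qed simp

text \<open>The residual of a projection step is polar to the contingent cone at the new iterate.  By inner semicontinuity \<open>w\<close> is
almost in that cone, so the residual contributes almost nonnegatively to the increment in direction \<open>w\<close>.\<close>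

lemma Euler_increment:
  assumes ij: "i \<le> j"
    and near: "\<And>k. i \<le> k \<Longrightarrow> k \<le> j \<Longrightarrow> dist (iter k) x < \<delta>"
    and cone: "\<And>y. y \<in> S \<Longrightarrow> dist y x < \<delta> \<Longrightarrow> \<exists>w'\<in>contingent_cone S y. norm (w' - w) \<le> e"
    and g: "\<And>y. y \<in> S \<Longrightarrow> dist y x < \<delta> \<Longrightarrow> (g x - g y) \<bullet> w \<le> e"
  shows "(\<eta> * real (j - i)) * (g x \<bullet> w - (1 + M) * e) \<le> (iter j - iter i) \<bullet> w"
  using ij near
proof (induction j rule: dec_induct)
  case (step n)
  have near: "dist (iter n) x < \<delta>" "dist (iter (Suc n)) x < \<delta>" using step.hyps step.prems[of n] step.prems[of "Suc n"] by auto
  define r where "r = iter n + \<eta> *\<^sub>R g (iter n) - iter (Suc n)"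
  have r: "norm r \<le> \<eta> * M" unfolding r_def by (rule Euler_residual)
  obtain w' where w': "w' \<in> contingent_cone S (iter (Suc n))" "norm (w' - w) \<le> e"
    using cone[OF Euler_in near(2)] by blast
  have "r \<bullet> w' \<le> 0"
    using closest_point_residual_polar[of S w' "iter n + \<eta> *\<^sub>R g (iter n)"] S w'(1) by (auto simp: r_def)
  moreover have "- (r \<bullet> (w' - w)) \<le> \<eta> * M * e"
  proof -
    have "- (r \<bullet> (w' - w)) \<le> norm r * norm (w' - w)" using Cauchy_Schwarz_ineq2[of r "w' - w"] by linarith
    also have "\<dots> \<le> \<eta> * M * e" using r w'(2) by (intro mult_mono) (auto intro: order_trans[OF norm_ge_zero])
    finally show ?thesis .
  qed
  ultimately have rw: "r \<bullet> w \<le> \<eta> * M * e" by (simp add: inner_diff_right)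
  have gw: "\<eta> * (g x \<bullet> w - e) \<le> \<eta> * (g (iter n) \<bullet> w)"
    using g[OF Euler_in near(1)] \<eta> by (intro mult_left_mono) (auto simp: inner_diff_left)
  have "iter (Suc n) - iter i = (iter n - iter i) + (\<eta> *\<^sub>R g (iter n) - r)" by (simp add: r_def)
  then have "(iter (Suc n) - iter i) \<bullet> w = (iter n - iter i) \<bullet> w + (\<eta> * (g (iter n) \<bullet> w) - r \<bullet> w)"
    by (simp only: inner_add_left inner_diff_left inner_scaleR_left)
  moreover have "(\<eta> * real (n - i)) * (g x \<bullet> w - (1 + M) * e) \<le> (iter n - iter i) \<bullet> w"
    using step.IH step.prems by simp
  moreover have "(\<eta> * real (Suc n - i)) * (g x \<bullet> w - (1 + M) * e) =
    (\<eta> * real (n - i)) * (g x \<bullet> w - (1 + M) * e) + (\<eta> * (g x \<bullet> w - e) - \<eta> * M * e)"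
    using step.hyps by (simp add: Suc_diff_le algebra_simps)
  ultimately show ?case using rw gw by linarith
qed simp

end

lemma floor_index_diff:
  fixes \<eta> s t :: real
  assumes \<eta>: "0 < \<eta>" and st: "s \<le> t"
  shows "nat \<lfloor>s / \<eta>\<rfloor> \<le> nat \<lfloor>t / \<eta>\<rfloor>" (is "?i \<le> ?j")
    and "\<eta> * real (nat \<lfloor>t / \<eta>\<rfloor> - nat \<lfloor>s / \<eta>\<rfloor>) \<le> (t - s) + \<eta>"
    and "0 \<le> s \<Longrightarrow> (t - s) - \<eta> \<le> \<eta> * real (nat \<lfloor>t / \<eta>\<rfloor> - nat \<lfloor>s / \<eta>\<rfloor>)"
proof -
  have d: "s / \<eta> \<le> t / \<eta>" using \<eta> st by (simp add: divide_right_mono)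
  show ij: "?i \<le> ?j" using d by (intro nat_mono floor_mono)
  have "real (?j - ?i) \<le> t / \<eta> - s / \<eta> + 1"
    using d ij by (simp add: of_nat_diff) linarith
  then have "\<eta> * real (?j - ?i) \<le> \<eta> * (t / \<eta> - s / \<eta> + 1)" using \<eta> by (intro mult_left_mono) auto
  then show "\<eta> * real (?j - ?i) \<le> (t - s) + \<eta>" using \<eta> by (simp add: algebra_simps)
  assume "0 \<le> s"
  then have "0 \<le> s / \<eta>" "0 \<le> t / \<eta>" using \<eta> st by auto
  then have "t / \<eta> - s / \<eta> - 1 \<le> real (?j - ?i)"
    using d ij by (simp add: of_nat_diff) linarith
  then have "\<eta> * (t / \<eta> - s / \<eta> - 1) \<le> \<eta> * real (?j - ?i)" using \<eta> by (intro mult_left_mono) auto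
  then show "(t - s) - \<eta> \<le> \<eta> * real (?j - ?i)" using \<eta> by (simp add: algebra_simps)
qed

context projected_system
begin

text \<open>Averaging \<open>Euler_increment\<close> over a short interval \<open>[t, t + s]\<close> and letting first the step size and then \<open>s\<close> tend to
zero.  Only two values of the curve, at \<open>t\<close> and \<open>t + s\<close>, have to be approximated.\<close>

lemma Euler_limit_derivative:
  fixes Z :: "nat \<Rightarrow> real \<Rightarrow> 'a" and \<eta> :: "nat \<Rightarrow> real"
  assumes z0: "z0 \<in> S" and M: "\<And>z. z \<in> S \<Longrightarrow> norm (g z) \<le> M"
    and \<eta>: "\<And>n. 0 < \<eta> n" "\<eta> \<longlonglongrightarrow> 0"
    and Z: "\<And>n t. Z n t = projected_Euler S g z0 (\<eta> n) (nat \<lfloor>t / \<eta> n\<rfloor>)"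
    and z: "\<And>A e N. finite A \<Longrightarrow> 0 < e \<Longrightarrow> \<exists>n\<ge>N. \<forall>t\<in>A. dist (Z n t) (z t) < e"
    and t: "0 < t" and zt: "z t \<in> S" and der: "(z has_vector_derivative d) (at t)"
    and w: "w \<in> contingent_cone S (z t)"
  shows "g (z t) \<bullet> w \<le> d \<bullet> w"
proof -
  have M0: "0 \<le> M" using M[OF z0] norm_ge_zero order_trans by blast
  have main: "g (z t) \<bullet> w \<le> d \<bullet> w + (3 + M) * e" if e: "0 < e" for e
  proof -
    obtain e1 where e1: "0 < e1" "e1 * norm w \<le> e"
      using small_positive[of 1 1 e "norm w"] e by auto
    obtain \<delta>1 where \<delta>1: "0 < \<delta>1" "\<And>y. y \<in> S \<Longrightarrow> dist y (z t) < \<delta>1 \<Longrightarrow> \<exists>w'\<in>contingent_cone S y. norm (w' - w) \<le> e"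
      using inner_semicont zt w e unfolding inner_semicontinuous_on_def by metis
    obtain \<delta>2 where \<delta>2: "0 < \<delta>2" "\<And>y. dist y (z t) < \<delta>2 \<Longrightarrow> dist (g y) (g (z t)) < e1"
      using cont_g e1(1) unfolding continuous_on_iff by auto metis
    define \<delta> where "\<delta> = min \<delta>1 \<delta>2"
    have \<delta>: "0 < \<delta>" using \<delta>1 \<delta>2 by (simp add: \<delta>_def)
    have gw: "(g (z t) - g y) \<bullet> w \<le> e" if "dist y (z t) < \<delta>" for y
    proof -
      have "(g (z t) - g y) \<bullet> w \<le> norm (g (z t) - g y) * norm w" by (rule norm_cauchy_schwarz)
      also have "\<dots> \<le> e1 * norm w"
        using \<delta>2(2)[of y] that by (intro mult_right_mono) (auto simp: \<delta>_def dist_norm norm_minus_commute)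
      finally show ?thesis using e1 by simp
    qed
    obtain s0 where s0: "0 < s0"
      "\<And>r. norm (r - t) < s0 \<Longrightarrow> norm (z r - z t - (r - t) *\<^sub>R d) \<le> e1 * norm (r - t)"
      using der e1(1) unfolding has_vector_derivative_def has_derivative_at_alt by blast
    obtain s where "0 < s" "s \<le> s0 / 2" "s * (2 * M) \<le> \<delta> / 4"
      using small_positive[of "s0 / 2" "s0 / 2" "\<delta> / 4" "2 * M"] s0(1) \<delta> M0 by auto
    then have s: "0 < s" "s < s0" "2 * M * s \<le> \<delta> / 4" by (auto simp: mult.commute)
    define G where "G = g (z t) \<bullet> w - (1 + M) * e"
    obtain \<kappa> where \<kappa>: "0 < \<kappa>" "\<kappa> \<le> s" "\<kappa> \<le> \<delta> / 4" and \<kappa>': "\<kappa> * (\<bar>G\<bar> + 2 * norm w) \<le> e * s"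
      using small_positive[of s "\<delta> / 4" "e * s" "\<bar>G\<bar> + 2 * norm w"] s e \<delta> by auto
    have "\<forall>\<^sub>F n in sequentially. \<eta> n < \<kappa>" by (rule order_tendstoD(2)[OF \<eta>(2) \<kappa>(1)])
    then obtain N where N: "\<And>n. n \<ge> N \<Longrightarrow> \<eta> n < \<kappa>" unfolding eventually_sequentially by blast
    obtain n where n: "n \<ge> N" "\<forall>r\<in>{t, t + s}. dist (Z n r) (z r) < \<kappa>"
      using z[of "{t, t + s}" \<kappa> N] \<kappa> by auto
    define h where "h = \<eta> n"
    have h: "0 < h" "h < \<kappa>" using \<eta>(1) N n(1) by (auto simp: h_def)
    define y where "y = projected_Euler S g z0 h"
    define i where "i = nat \<lfloor>t / h\<rfloor>"
    define j where "j = nat \<lfloor>(t + s) / h\<rfloor>"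
    have Zij: "Z n t = y i" "Z n (t + s) = y j" by (simp_all add: Z y_def i_def j_def h_def)
    have ts: "t \<le> t + s" "0 \<le> t" using s t by auto
    have ij: "i \<le> j" "h * real (j - i) \<le> s + h" "s - h \<le> h * real (j - i)"
      using floor_index_diff(1)[OF h(1) ts(1)] floor_index_diff(2)[OF h(1) ts(1)]
        floor_index_diff(3)[OF h(1) ts]
      unfolding i_def j_def by (simp_all only: add_diff_cancel_left')
    have near: "dist (y k) (z t) < \<delta>" if k: "i \<le> k" "k \<le> j" for k
    proof -
      have "norm (y k - y i) \<le> 2 * M * (h * real (k - i))"
        unfolding y_def by (rule Euler_dist[OF closed_S z0 M h(1) k(1)])
      also have "\<dots> \<le> 2 * M * (h * real (j - i))"
        using k h M0 by (intro mult_left_mono) auto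
      also have "\<dots> \<le> 2 * M * (s + s)"
        using ij(2) h \<kappa> M0 by (intro mult_left_mono) auto
      also have "\<dots> \<le> \<delta> / 2" using s(3) by simp
      finally have "dist (y k) (y i) \<le> \<delta> / 2" by (simp add: dist_norm)
      moreover have "dist (y i) (z t) < \<delta> / 4" using n(2) \<kappa>(3) Zij by auto
      ultimately show ?thesis using dist_triangle[of "y k" "z t" "y i"] \<delta> by linarith
    qed
    have inc: "(h * real (j - i)) * G \<le> (y j - y i) \<bullet> w"
      unfolding G_def y_def
    proof (rule Euler_increment[OF closed_S z0 M h(1) ij(1)])
      show "dist (projected_Euler S g z0 h k) (z t) < \<delta>" if "i \<le> k" "k \<le> j" for k
        using near[OF that] by (simp add: y_def)
      show "\<exists>w'\<in>contingent_cone S y. norm (w' - w) \<le> e" if "y \<in> S" "dist y (z t) < \<delta>" for y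
        using \<delta>1(2)[OF that(1)] that(2) by (simp add: \<delta>_def)
      show "(g (z t) - g y) \<bullet> w \<le> e" if "y \<in> S" "dist y (z t) < \<delta>" for y
        using gw that by blast
    qed
    have "s * G - h * \<bar>G\<bar> \<le> (h * real (j - i)) * G"
    proof -
      have "\<bar>(s - h * real (j - i)) * G\<bar> \<le> h * \<bar>G\<bar>"
        unfolding abs_mult using ij by (intro mult_right_mono) auto
      then have "(s - h * real (j - i)) * G \<le> h * \<bar>G\<bar>" by linarith
      then show ?thesis by (simp add: left_diff_distrib)
    qed
    moreover have "h * \<bar>G\<bar> \<le> \<kappa> * \<bar>G\<bar>" using h by (intro mult_right_mono) auto
    moreover have "(y j - y i) \<bullet> w \<le> (z (t + s) - z t) \<bullet> w + \<kappa> * (2 * norm w)"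
    proof -
      have small: "v \<bullet> w \<le> \<kappa> * norm w" if "norm v < \<kappa>" for v
        using norm_cauchy_schwarz[of v w] mult_right_mono[of "norm v" \<kappa> "norm w"] that by force
      have "(y j - z (t + s)) \<bullet> w \<le> \<kappa> * norm w" "(z t - y i) \<bullet> w \<le> \<kappa> * norm w"
        using n(2) Zij by (auto intro!: small simp: dist_norm norm_minus_commute)
      then show ?thesis by (simp add: inner_diff_left)
    qed
    moreover have "(z (t + s) - z t) \<bullet> w \<le> s * (d \<bullet> w) + e * s"
    proof -
      have "(z (t + s) - z t - s *\<^sub>R d) \<bullet> w \<le> norm (z (t + s) - z t - s *\<^sub>R d) * norm w"
        by (rule norm_cauchy_schwarz)
      also have "\<dots> \<le> (e1 * s) * norm w"
        using s0(2)[of "t + s"] s by (intro mult_right_mono) auto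
      also have "\<dots> = s * (e1 * norm w)" by simp
      also have "\<dots> \<le> s * e" using e1(2) s by (intro mult_left_mono) auto
      finally show ?thesis by (simp add: inner_diff_left mult.commute)
    qed
    ultimately have "s * G \<le> s * (d \<bullet> w) + e * s + e * s"
      using inc \<kappa>' by (simp add: distrib_left)
    then have "s * G \<le> s * (d \<bullet> w + 2 * e)" by (simp add: algebra_simps)
    then have "G \<le> d \<bullet> w + 2 * e" using s(1) by simp
    then show ?thesis by (simp add: G_def algebra_simps)
  qed
  show ?thesis
  proof (rule field_le_epsilon)
    fix e :: real assume "0 < e"
    then have "0 < e / (3 + M)" using M0 by simp
    from main[OF this] show "g (z t) \<bullet> w \<le> d \<bullet> w + e" using M0 by simp
  qed
qed

text \<open>Testing the limit inequality with \<open>d\<close> and with \<open>- d\<close>, both tangent, gives \<open>(g - d) \<bullet> d = 0\<close>, so \<open>d\<close> is the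
projection of the drive.\<close>

theorem bounded_projected_solution:
  assumes z0: "z0 \<in> S" and M: "\<And>z. z \<in> S \<Longrightarrow> norm (g z) \<le> M"
  obtains z where "z 0 = z0" "solution_on S field {0..} z"
proof -
  have M0: "0 \<le> M" using M[OF z0] norm_ge_zero order_trans by blast
  \<comment> \<open>Step sizes \<open>1 / (n + 1)\<close>; the index of a negative time is truncated to \<open>0\<close>.\<close>
  define \<eta> :: "nat \<Rightarrow> real" where "\<eta> n = inverse (real (Suc n))" for n
  have \<eta>: "0 < \<eta> n" "\<eta> \<longlonglongrightarrow> 0" for n
    unfolding \<eta>_def using LIMSEQ_inverse_real_of_nat by (auto simp del: of_nat_Suc)
  define Z where "Z n t = projected_Euler S g z0 (\<eta> n) (nat \<lfloor>t / \<eta> n\<rfloor>)" for n t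
  have ZS: "Z n t \<in> S" for n t unfolding Z_def by (rule Euler_in[OF closed_S z0 M \<eta>(1)])
  have Zdist: "norm (Z n t - Z n s) \<le> 2 * M * (t - s + \<eta> n)" if st: "s \<le> t" for n s t
  proof -
    have "norm (Z n t - Z n s) \<le> 2 * M * (\<eta> n * real (nat \<lfloor>t / \<eta> n\<rfloor> - nat \<lfloor>s / \<eta> n\<rfloor>))"
      unfolding Z_def by (rule Euler_dist[OF closed_S z0 M \<eta>(1) floor_index_diff(1)[OF \<eta>(1) st]])
    also have "\<dots> \<le> 2 * M * (t - s + \<eta> n)"
      using floor_index_diff(2)[OF \<eta>(1) st] M0 by (intro mult_left_mono) auto
    finally show ?thesis .
  qed
  define K where "K t = cball z0 (2 * M * (\<bar>t\<bar> + 1))" for t :: real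
  have Z0: "Z n 0 = z0" for n by (simp add: Z_def)
  have ZK: "Z n t \<in> K t" for n t
  proof -
    have "\<eta> n \<le> 1" by (simp add: \<eta>_def inverse_le_1_iff)
    then have "2 * M * (\<bar>t\<bar> + \<eta> n) \<le> 2 * M * (\<bar>t\<bar> + 1)" using M0 by (intro mult_left_mono) auto
    moreover have "norm (z0 - Z n t) \<le> 2 * M * (\<bar>t\<bar> + \<eta> n)"
      using Zdist[of 0 t n] Zdist[of t 0 n] by (cases "0 \<le> t") (auto simp: Z0 norm_minus_commute)
    ultimately show ?thesis by (simp add: K_def dist_norm)
  qed
  have "compact (K t)" for t by (simp add: K_def)
  then obtain z where z: "\<And>t. z t \<in> K t"
    "\<And>A e N. finite A \<Longrightarrow> 0 < e \<Longrightarrow> \<exists>n\<ge>N. \<forall>t\<in>A. dist (Z n t) (z t) < e"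
    using pointwise_cluster_point[of K Z] ZK by metis
  have zS: "z t \<in> S" for t
  proof -
    have "\<exists>y\<in>S. dist y (z t) < e" if "0 < e" for e
      using z(2)[of "{t}" e 0] that ZS by auto
    then show ?thesis using closed_S closure_approachable[of "z t" S] by auto
  qed
  have "dist z0 (z 0) < e" if "0 < e" for e using z(2)[of "{0}" e 0] that by (auto simp: Z0)
  then have z00: "z 0 = z0" by (metis dist_pos_lt order_less_irrefl)
  have le: "norm (z t - z s) \<le> 2 * M * (t - s)" if st: "s \<le> t" for s t
  proof (rule field_le_epsilon)
    fix e :: real assume e: "0 < e"
    obtain e1 where e1: "0 < e1" "e1 * (2 * M + 2) \<le> e"
      using small_positive[of 1 1 e "2 * M + 2"] e M0 by auto
    have "\<forall>\<^sub>F n in sequentially. \<eta> n < e1" by (rule order_tendstoD(2)[OF \<eta>(2) e1(1)])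
    then obtain N where N: "\<And>n. n \<ge> N \<Longrightarrow> \<eta> n < e1" unfolding eventually_sequentially by blast
    obtain n where n: "n \<ge> N" "\<forall>r\<in>{s, t}. dist (Z n r) (z r) < e1"
      using z(2)[of "{s, t}" e1 N] e1 by auto
    have "dist (z t) (z s) \<le> dist (z t) (Z n t) + dist (Z n t) (Z n s) + dist (Z n s) (z s)"
      using dist_triangle[of "z t" "z s" "Z n t"] dist_triangle[of "Z n t" "z s" "Z n s"] by linarith
    also have "\<dots> \<le> e1 + 2 * M * (t - s + \<eta> n) + e1"
      using n(2) Zdist[OF st, of n] by (intro add_mono) (auto simp: dist_norm norm_minus_commute)
    also have "\<dots> \<le> e1 + 2 * M * (t - s + e1) + e1"
      using N[OF n(1)] M0 by (intro add_mono mult_left_mono) auto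
    also have "\<dots> \<le> 2 * M * (t - s) + e" using e1(2) by (simp add: algebra_simps)
    finally show "norm (z t - z s) \<le> 2 * M * (t - s) + e" by (simp add: dist_norm)
  qed
  have lip: "(2 * M)-lipschitz_on UNIV z"
  proof (rule lipschitz_onI)
    fix s t :: real
    show "dist (z s) (z t) \<le> 2 * M * dist s t"
      using le[of s t] le[of t s] by (cases "s \<le> t") (auto simp: dist_norm norm_minus_commute)
  qed (use M0 in simp)
  \<comment> \<open>The curve is constant at negative times, so its behaviour at time \<open>0\<close> says nothing about the field.\<close>
  define N where "N = insert 0 {t. \<not> z differentiable (at t)}"
  have N: "N \<in> null_sets lebesgue"
    unfolding N_def negligible_iff_null_sets[symmetric]
    using AE_differentiable_Lipschitz[OF lip] by simp
  have der: "(z has_vector_derivative field (z t)) (at t)" if t: "0 < t" "t \<notin> N" for t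
  proof -
    have "z differentiable (at t)" using t(2) by (simp add: N_def)
    then obtain d where d: "(z has_vector_derivative d) (at t)"
      using vector_derivative_works by blast
    have lower: "g (z t) \<bullet> w \<le> d \<bullet> w" if "w \<in> contingent_cone S (z t)" for w
      by (rule Euler_limit_derivative[OF z0 M \<eta> _ z(2) t(1) zS d that]) (simp_all add: Z_def)
    have tan: "d \<in> contingent_cone S (z t)" "- d \<in> contingent_cone S (z t)"
      using derivative_in_contingent_cone[OF d zero_less_one zS, of 1]
        derivative_in_contingent_cone[OF d zero_less_one zS, of "-1"] by auto
    have "field (z t) = d"
      unfolding field_def
    proof (rule closest_point_cone_eqI[OF convex_cone[OF zS] closed_contingent_cone tan(1)])
      show "(g (z t) - d) \<bullet> d = 0"
        using lower[OF tan(1)] lower[OF tan(2)] by (simp add: inner_diff_left)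
      show "(g (z t) - d) \<bullet> w \<le> 0" if "w \<in> contingent_cone S (z t)" for w
        using lower[OF that] by (simp add: inner_diff_left)
    qed
    then show ?thesis using d by simp
  qed
  have "solution_on S field {0..} z"
    unfolding solution_on_def
  proof (intro conjI allI impI ballI)
    show "AC_on a b z" for a b
      using lipschitz_on_subset[OF lip] by (rule Lipschitz_imp_AC_on) simp
    show "AE t in lebesgue. t \<in> {0..} \<longrightarrow> (z has_vector_derivative field (z t)) (at t within {0..})"
    proof (rule AE_I'[OF N], rule subsetI, rule ccontr)
      fix t assume "t \<in> {t \<in> space lebesgue. \<not> (t \<in> {0..} \<longrightarrow>
        (z has_vector_derivative field (z t)) (at t within {0..}))}" and t: "t \<notin> N"
      moreover have "t \<noteq> 0" using t by (auto simp: N_def)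
      ultimately show False using der[of t] has_vector_derivative_at_within by fastforce
    qed
  qed (use zS in \<open>auto simp: is_interval_ci\<close>)
  with z00 show ?thesis by (rule that)
qed

end

section \<open>Restriction and concatenation of solutions\<close>

lemma AC_on_imp_continuous_on:
  fixes z :: "real \<Rightarrow> 'a::metric_space"
  assumes "AC_on a b z"
  shows "continuous_on {a..b} z"
  unfolding continuous_on_iff
proof (intro ballI allI impI)
  fix x e assume x: "x \<in> {a..b}" and e: "(0::real) < e"
  obtain d where d: "0 < d" "\<And>D. disjoint_intervals a b D \<Longrightarrow> (\<Sum>(l, r)\<in>D. r - l) < d
      \<Longrightarrow> (\<Sum>(l, r)\<in>D. dist (z l) (z r)) < e"
    using assms[unfolded AC_on_iff, rule_format, OF e] by blast
  have *: "dist (z l) (z r) < e" if "a \<le> l" "l \<le> r" "r \<le> b" "r - l < d" for l r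
    using d(2)[of "{(l, r)}"] that by (simp add: disjoint_intervals_def)
  have "dist (z y) (z x) < e" if "y \<in> {a..b}" "dist y x < d" for y
  proof (cases "x \<le> y")
    case True
    then show ?thesis using x that *[of x y] by (subst dist_commute) (auto simp: dist_real_def)
  next
    case False
    then show ?thesis using x that *[of y x] by (auto simp: dist_real_def)
  qed
  then show "\<exists>d>0. \<forall>y\<in>{a..b}. dist y x < d \<longrightarrow> dist (z y) (z x) < e" using d(1) by blast
qed

lemma solution_on_subset:
  assumes sol: "solution_on X F I z" and J: "is_interval J" "0 \<in> J" "J \<subseteq> I"
  shows "solution_on X F J z"
proof -
  have "AE t in lebesgue. t \<in> I \<longrightarrow> (z has_vector_derivative F (z t)) (at t within I)"
    using sol by (simp add: solution_on_def)
  then have "AE t in lebesgue. t \<in> J \<longrightarrow> (z has_vector_derivative F (z t)) (at t within J)"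
    by (rule AE_mp) (use J(3) has_vector_derivative_within_subset in \<open>auto intro!: AE_I2\<close>)
  then show ?thesis using sol J unfolding solution_on_def by blast
qed

lemma solution_on_field_cong:
  assumes sol: "solution_on X F I z" and eq: "\<And>t. t \<in> I \<Longrightarrow> F (z t) = G (z t)"
  shows "solution_on X G I z"
proof -
  have "AE t in lebesgue. t \<in> I \<longrightarrow> (z has_vector_derivative F (z t)) (at t within I)"
    using sol by (simp add: solution_on_def)
  then have "AE t in lebesgue. t \<in> I \<longrightarrow> (z has_vector_derivative G (z t)) (at t within I)"
    by (rule AE_mp) (use eq in \<open>auto intro!: AE_I2\<close>)
  then show ?thesis using sol unfolding solution_on_def by blast
qed

lemma solution_onI:
  fixes z :: "real \<Rightarrow> 'a::euclidean_space"
  assumes "is_interval I" "0 \<in> I" "I \<subseteq> {0..}"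
    and "\<And>a b. {a..b} \<subseteq> I \<Longrightarrow> \<exists>M. M-lipschitz_on {a..b} z"
    and "\<And>t. t \<in> I \<Longrightarrow> z t \<in> X"
    and N: "negligible N"
    and der: "\<And>t. t \<in> I \<Longrightarrow> t \<notin> N \<Longrightarrow> (z has_vector_derivative F (z t)) (at t within I)"
  shows "solution_on X F I z"
proof -
  have "N \<in> null_sets lebesgue" using N by (simp add: negligible_iff_null_sets)
  then have "AE t in lebesgue. t \<in> I \<longrightarrow> (z has_vector_derivative F (z t)) (at t within I)"
    by (rule AE_I') (use der in blast)
  then show ?thesis using assms(1-5) Lipschitz_imp_AC_on unfolding solution_on_def by blast
qed

lemma solution_on_continuous:
  assumes "solution_on X F I z" "{a..b} \<subseteq> I"
  shows "continuous_on {a..b} z"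
  using assms by (auto simp: solution_on_def intro: AC_on_imp_continuous_on)

section \<open>The projected field\<close>

lemma contingent_cone_scaleR:
  assumes w: "w \<in> contingent_cone S z" and r: "0 < r"
  shows "r *\<^sub>R w \<in> contingent_cone S z"
  unfolding contingent_cone_def
proof (intro CollectI allI impI)
  fix e :: real assume e: "0 < e"
  have "0 < min (e * r) (e / r)" using e r by simp
  then obtain s y where s: "0 < s" "s < min (e * r) (e / r)" "y \<in> S"
      "norm (y - z - s *\<^sub>R w) \<le> min (e * r) (e / r) * s"
    using w unfolding contingent_cone_def by blast
  have "norm (y - z - (s / r) *\<^sub>R r *\<^sub>R w) \<le> min (e * r) (e / r) * s" using s(4) r by simp
  also have "\<dots> \<le> (e / r) * s" using s(1) by (intro mult_right_mono) auto
  finally have "norm (y - z - (s / r) *\<^sub>R r *\<^sub>R w) \<le> e * (s / r)" by simp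
  moreover have "0 < s / r" "s / r < e" using s r by (auto simp: pos_divide_less_eq)
  ultimately show "\<exists>s>0. s < e \<and> (\<exists>y\<in>S. norm (y - z - s *\<^sub>R r *\<^sub>R w) \<le> e * s)"
    using s(3) by blast
qed

context projected_system
begin

lemma field_in_cone: "z \<in> S \<Longrightarrow> field z \<in> contingent_cone S z"
  unfolding field_def using closest_point_in_set[OF closed_contingent_cone] zero_in_contingent_cone by fast

lemma field_orthogonal:
  assumes z: "z \<in> S"
  shows "(g z - field z) \<bullet> field z = 0"
proof -
  note dot = closest_point_dot[OF convex_cone[OF z] closed_contingent_cone, of _ "g z", folded field_def]
  have "(g z - field z) \<bullet> (0 - field z) \<le> 0" by (rule dot[OF zero_in_contingent_cone[OF z]])
  moreover have "(g z - field z) \<bullet> (2 *\<^sub>R field z - field z) \<le> 0"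
    by (rule dot[OF contingent_cone_scaleR[OF field_in_cone[OF z]]]) simp
  ultimately show ?thesis by (simp add: scaleR_2)
qed

lemma field_residual_polar:
  assumes z: "z \<in> S" and w: "w \<in> contingent_cone S z"
  shows "g z \<bullet> w \<le> field z \<bullet> w"
proof -
  have "(g z - field z) \<bullet> (w - field z) \<le> 0"
    unfolding field_def by (rule closest_point_dot[OF convex_cone[OF z] closed_contingent_cone w])
  then show ?thesis using field_orthogonal[OF z] by (simp add: inner_diff_right inner_diff_left)
qed

lemma norm_field_le:
  assumes z: "z \<in> S"
  shows "norm (field z) \<le> norm (g z)"
proof -
  have "norm (field z) * norm (field z) = g z \<bullet> field z"
    using field_orthogonal[OF z] by (simp add: inner_diff_left power2_norm_eq_inner flip: power2_eq_square)
  also have "\<dots> \<le> norm (g z) * norm (field z)" by (rule norm_cauchy_schwarz)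
  finally show ?thesis by (cases "field z = 0") auto
qed

lemma field_bounded_on_compact:
  assumes K: "compact K" "K \<subseteq> S"
  obtains M where "0 < M" "\<forall>z\<in>K. norm (field z) \<le> M"
proof -
  have "compact (g ` K)" using K cont_g continuous_on_subset compact_continuous_image by blast
  then obtain B where B: "0 < B" "\<forall>y\<in>g ` K. norm y \<le> B" using compact_imp_bounded bounded_pos by metis
  then show ?thesis using that[of B] norm_field_le K(2) by (meson image_eqI order_trans subsetD)
qed

text \<open>The closedness of the graph of the normal cone in disguise: if projections of \<open>g (x n)\<close> vanish in the limit, then the
limit of \<open>g (x n)\<close> is polar to every tangent vector at \<open>z\<close>, because each such vector is approximated by tangent
vectors at \<open>x n\<close>.\<close>

lemma field_limit_zero:
  assumes zn: "\<And>n. x n \<in> S" "x \<longlonglongrightarrow> z" and z: "z \<in> S" and lim: "(\<lambda>n. norm (field (x n))) \<longlonglongrightarrow> 0"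
  shows "field z = 0"
proof -
  have gx: "(\<lambda>n. g (x n)) \<longlonglongrightarrow> g z"
    by (rule continuous_on_tendsto_compose[OF cont_g zn(2)]) auto
  have polar: "g z \<bullet> w \<le> 0" if w: "w \<in> contingent_cone S z" for w
  proof -
    have main: "g z \<bullet> w \<le> norm (g z) * e" if e: "0 < e" for e
    proof -
      obtain d where d: "0 < d" "\<And>y. y \<in> S \<Longrightarrow> dist y z < d \<Longrightarrow> \<exists>w'\<in>contingent_cone S y. norm (w' - w) \<le> e"
        using inner_semicont z w e unfolding inner_semicontinuous_on_def by metis
      have "\<forall>\<^sub>F n in sequentially. dist (x n) z < d" using zn(2) d(1) by (rule tendstoD)
      then have ev: "\<forall>\<^sub>F n in sequentially. g (x n) \<bullet> w \<le> norm (field (x n)) * (norm w + e) + norm (g (x n)) * e"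
      proof (rule eventually_mono)
        fix n assume "dist (x n) z < d"
        then obtain w' where w': "w' \<in> contingent_cone S (x n)" "norm (w' - w) \<le> e"
          using d(2)[OF zn(1)] by blast
        have "g (x n) \<bullet> w = g (x n) \<bullet> w' - g (x n) \<bullet> (w' - w)" by (simp add: inner_diff_right)
        moreover have "g (x n) \<bullet> w' \<le> norm (field (x n)) * (norm w + e)"
        proof -
          have "g (x n) \<bullet> w' \<le> field (x n) \<bullet> w'" by (rule field_residual_polar[OF zn(1) w'(1)])
          also have "\<dots> \<le> norm (field (x n)) * norm w'" by (rule norm_cauchy_schwarz)
          also have "norm w' \<le> norm w + e" using w'(2) norm_triangle_ineq2[of w' w] by linarith
          finally show ?thesis by (simp add: mult_left_mono)
        qed
        moreover have "- (g (x n) \<bullet> (w' - w)) \<le> norm (g (x n)) * e"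
        proof -
          have "- (g (x n) \<bullet> (w' - w)) \<le> norm (g (x n)) * norm (w' - w)"
            using Cauchy_Schwarz_ineq2[of "g (x n)" "w' - w"] by linarith
          also have "\<dots> \<le> norm (g (x n)) * e" using w'(2) by (intro mult_left_mono) auto
          finally show ?thesis .
        qed
        ultimately show "g (x n) \<bullet> w \<le> norm (field (x n)) * (norm w + e) + norm (g (x n)) * e" by linarith
      qed
      have "g z \<bullet> w \<le> 0 * (norm w + e) + norm (g z) * e"
        by (rule tendsto_le[OF sequentially_bot _ _ ev]) (intro tendsto_intros gx lim)+
      then show ?thesis by simp
    qed
    show ?thesis
    proof (rule field_le_epsilon)
      fix e :: real assume e: "0 < e"
      have ng: "0 < norm (g z) + 1" by (simp add: add_nonneg_pos)
      have "g z \<bullet> w \<le> norm (g z) * (e / (norm (g z) + 1))" using e ng by (intro main) simp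
      also have "\<dots> \<le> (norm (g z) + 1) * (e / (norm (g z) + 1))" using e ng by (intro mult_right_mono) auto
      finally show "g z \<bullet> w \<le> 0 + e" using ng by simp
    qed
  qed
  show ?thesis
    unfolding field_def
    by (rule closest_point_cone_eqI[OF convex_cone[OF z] closed_contingent_cone zero_in_contingent_cone[OF z]])
      (use polar in auto)
qed

lemma field_bounded_away_from_zero:
  assumes K: "compact K" "K \<subseteq> S" and nz: "\<And>z. z \<in> K \<Longrightarrow> field z \<noteq> 0"
  obtains \<mu> where "0 < \<mu>" "\<forall>z\<in>K. \<mu> \<le> (norm (field z))\<^sup>2"
proof (rule ccontr)
  assume not: "\<not> thesis"
  have "\<exists>z\<in>K. norm (field z) < inverse (real (Suc n))" for n
  proof (rule ccontr)
    assume "\<not> ?thesis"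
    then have "\<forall>z\<in>K. (inverse (real (Suc n)))\<^sup>2 \<le> (norm (field z))\<^sup>2"
      by (auto simp: not_less intro!: power_mono)
    then show False using not that[of "(inverse (real (Suc n)))\<^sup>2"] by simp
  qed
  then obtain x where x: "\<And>n. x n \<in> K" "\<And>n. norm (field (x n)) < inverse (real (Suc n))" by metis
  obtain l r where l: "l \<in> K" "strict_mono r" "(x \<circ> r) \<longlonglongrightarrow> l"
    using K(1) x(1) unfolding compact_def by metis
  have "(\<lambda>n. norm (field (x n))) \<longlonglongrightarrow> 0"
    by (rule tendsto_sandwich[OF _ _ tendsto_const LIMSEQ_inverse_real_of_nat])
      (use x(2) in \<open>auto intro!: always_eventually less_imp_le simp del: of_nat_Suc\<close>)
  then have "(\<lambda>n. norm (field ((x \<circ> r) n))) \<longlonglongrightarrow> 0"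
    using LIMSEQ_subseq_LIMSEQ[OF _ l(2), of "\<lambda>n. norm (field (x n))" 0] by (simp add: o_def)
  then have "field l = 0"
    using x(1) K(2) l by (intro field_limit_zero[of "x \<circ> r"]) auto
  then show False using nz l(1) by blast
qed

end

lemma solution_on_concat:
  fixes z x :: "real \<Rightarrow> 'a::euclidean_space"
  assumes z: "solution_on X F {0..b} z" and x: "solution_on X F {0..} x"
    and b: "0 \<le> b" and eq: "x 0 = z b"
    and zlip: "\<And>a c. {a..c} \<subseteq> {0..b} \<Longrightarrow> \<exists>M. M-lipschitz_on {a..c} z"
    and xlip: "\<And>a c. {a..c} \<subseteq> {0..} \<Longrightarrow> \<exists>M. M-lipschitz_on {a..c} x"
  shows "solution_on X F {0..} (\<lambda>t. if t \<le> b then z t else x (t - b))"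
proof -
  let ?y = "\<lambda>t. if t \<le> b then z t else x (t - b)"
  obtain N1 where N1: "negligible N1"
    "\<And>t. t \<in> {0..b} \<Longrightarrow> t \<notin> N1 \<Longrightarrow> (z has_vector_derivative F (z t)) (at t within {0..b})"
    by (rule solution_on_AE_derivative[OF z]) blast
  obtain N2 where N2: "negligible N2"
    "\<And>t. t \<in> {0..} \<Longrightarrow> t \<notin> N2 \<Longrightarrow> (x has_vector_derivative F (x t)) (at t within {0..})"
    by (rule solution_on_AE_derivative[OF x]) blast
  show ?thesis
  proof (rule solution_onI)
    fix p q :: real assume pq: "{p..q} \<subseteq> {0..}"
    obtain M1 where M1: "M1-lipschitz_on {0..b} z" using zlip[of 0 b] by auto
    obtain M2 where M2: "M2-lipschitz_on {0..max q b - b} x" using xlip[of 0 "max q b - b"] by auto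
    have "M2-lipschitz_on {b..max q b} (\<lambda>t. x (t - b))"
    proof (rule lipschitz_onI)
      fix s t assume "s \<in> {b..max q b}" "t \<in> {b..max q b}"
      then show "dist (x (s - b)) (x (t - b)) \<le> M2 * dist s t"
        using lipschitz_onD[OF M2, of "s - b" "t - b"] by (simp add: dist_real_def)
    qed (rule lipschitz_on_nonneg[OF M2])
    then have "(max M1 M2)-lipschitz_on {0..max q b} ?y"
      using lipschitz_on_concat_max[OF M1, of M2 "max q b" "\<lambda>t. x (t - b)"] eq by simp
    then have "(max M1 M2)-lipschitz_on {p..q} ?y"
      by (rule lipschitz_on_subset) (use pq in auto)
    then show "\<exists>M. M-lipschitz_on {p..q} ?y" by blast
  next
    show "negligible (insert b (N1 \<union> (+) b ` N2))"
      using N1(1) N2(1) by (simp add: negligible_translation)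
  next
    fix t assume t: "t \<in> {0..}" "t \<notin> insert b (N1 \<union> (+) b ` N2)"
    show "(?y has_vector_derivative F (?y t)) (at t within {0..})"
    proof (cases "t < b")
      case True
      have "at t within {0..b} = at t within {0..}"
        by (rule at_within_nhd[of t "{..<b}"]) (use True in auto)
      then have "(z has_vector_derivative F (z t)) (at t within {0..})"
        using N1(2)[of t] t True by auto
      then have "(?y has_vector_derivative F (z t)) (at t within {0..})"
        by (rule has_vector_derivative_transform_within[of _ _ _ _ "b - t"])
          (use True t in \<open>auto simp: dist_real_def\<close>)
      then show ?thesis using True by simp
    next
      case False
      then have tb: "b < t" using t by auto
      have "t - b \<notin> N2" using t(2) by (metis add.commute diff_add_cancel image_eqI insert_iff UnI2)
      then have "(x has_vector_derivative F (x (t - b))) (at (t - b) within {0..})"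
        using N2(2)[of "t - b"] tb by auto
      then have "(x has_vector_derivative F (x (t - b))) (at (t - b) within {0<..})"
        by (rule has_vector_derivative_within_subset) auto
      then have "(x has_vector_derivative F (x (t - b))) (at (t - b))"
        using tb by (simp add: at_within_open[of "t - b" "{0<..}"])
      moreover have "((\<lambda>t. t - b) has_vector_derivative 1) (at t)"
        by (auto intro!: derivative_eq_intros)
      ultimately have "((\<lambda>t. x (t - b)) has_vector_derivative F (x (t - b))) (at t)"
        using vector_diff_chain_at[of "\<lambda>t. t - b" 1 t x "F (x (t - b))"] by (simp add: o_def)
      then have "((\<lambda>t. x (t - b)) has_vector_derivative F (x (t - b))) (at t within {0..})"
        by (rule has_vector_derivative_at_within)
      then have "(?y has_vector_derivative F (x (t - b))) (at t within {0..})"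
        by (rule has_vector_derivative_transform_within[of _ _ _ _ "t - b"])
          (use tb t in \<open>auto simp: dist_real_def\<close>)
      then show ?thesis using tb by simp
    qed
  next
    fix t :: real assume "t \<in> {0..}"
    then show "?y t \<in> X" using z x unfolding solution_on_def by auto
  qed (auto simp: is_interval_ci)
qed

lemma nonneg_interval_cases:
  fixes I :: "real set"
  assumes I: "is_interval I" "0 \<in> I" "I \<subseteq> {0..}"
  obtains "I = {0..}" | b where "0 \<le> b" "I = {0..b}" | b where "0 < b" "I = {0..<b}"
proof (cases "bdd_above I")
  case False
  have "I = {0..}"
  proof
    show "{0..} \<subseteq> I"
    proof
      fix t :: real assume t: "t \<in> {0..}"
      obtain s where "s \<in> I" "t < s" using False unfolding bdd_above_def by (meson not_le)
      then show "t \<in> I" using I(1,2) t unfolding is_interval_1 by (meson atLeast_iff less_imp_le)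
    qed
  qed (use I in auto)
  then show ?thesis using that by blast
next
  case True
  define b where "b = Sup I"
  have up: "t \<le> b" if "t \<in> I" for t unfolding b_def using that True by (rule cSup_upper)
  have b: "0 \<le> b" using up I(2) by blast
  have below: "t \<in> I" if tb: "0 \<le> t" "t < b" for t
  proof -
    obtain s where "s \<in> I" "t < s" using tb(2) less_cSupE I(2) unfolding b_def by (metis empty_iff)
    then show ?thesis using I(1,2) tb unfolding is_interval_1 by (meson less_imp_le)
  qed
  show ?thesis
  proof (cases "b \<in> I")
    case True
    have "{0..b} \<subseteq> I"
    proof
      fix t assume "t \<in> {0..b}"
      then show "t \<in> I" using below[of t] True by (cases "t = b") auto
    qed
    then have "I = {0..b}" using up I(3) by auto
    then show ?thesis using that b by blast
  next
    case False
    have "I = {0..<b}"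
    proof
      show "I \<subseteq> {0..<b}"
      proof
        fix t assume "t \<in> I"
        then show "t \<in> {0..<b}" using up[of t] I(3) False by (cases "t = b") auto
      qed
    qed (use below in auto)
    moreover have "0 < b" using False b I(2) by (cases "b = 0") auto
    ultimately show ?thesis using that by blast
  qed
qed

section \<open>Dissipative projected systems\<close>

text \<open>Besides showing that minimizers are equilibria, this gives the easy inclusion between the contingent and the
linearised tangent cone of a constraint set, applied to the constraint functions themselves.\<close>

lemma local_minimizer_derivative_nonneg:
  fixes V :: "'a::real_normed_vector \<Rightarrow> real"
  assumes V: "(V has_derivative V') (at x)" and r: "0 < r" and min: "\<And>y. y \<in> S \<Longrightarrow> dist y x < r \<Longrightarrow> V x \<le> V y"
    and w: "w \<in> contingent_cone S x"
  shows "0 \<le> V' w"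
proof (rule ccontr)
  assume neg: "\<not> 0 \<le> V' w"
  have bl: "bounded_linear V'" using V has_derivative_bounded_linear by blast
  obtain B where B: "0 < B" "\<And>v. norm (V' v) \<le> norm v * B"
    using bounded_linear.pos_bounded[OF bl] by blast
  define m where "m = - V' w"
  have m: "0 < m" using neg by (simp add: m_def)
  obtain \<eta> where \<eta>: "0 < \<eta>" and \<eta>w: "\<eta> * (norm w + 1) \<le> m / 4"
    using small_positive[of 1 1 "m / 4" "norm w + 1"] m by auto
  obtain \<delta> where \<delta>: "0 < \<delta>" "\<And>y. norm (y - x) < \<delta> \<Longrightarrow> norm (V y - V x - V' (y - x)) \<le> \<eta> * norm (y - x)"
    using V \<eta> unfolding has_derivative_at_alt by blast
  obtain e where e: "0 < e" "e \<le> 1" "e \<le> m / (4 * B)" and ew: "e * (norm w + 1) \<le> min r \<delta>"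
    using small_positive[of 1 "m / (4 * B)" "min r \<delta>" "norm w + 1"] m B(1) r \<delta>(1) by auto
  obtain s y where s: "0 < s" "s < e" "y \<in> S" "norm (y - x - s *\<^sub>R w) \<le> e * s"
    using w e(1) unfolding contingent_cone_def by blast
  define \<rho> where "\<rho> = y - x - s *\<^sub>R w"
  have yx: "y - x = s *\<^sub>R w + \<rho>" by (simp add: \<rho>_def)
  have \<rho>: "norm \<rho> \<le> e * s" using s(4) by (simp add: \<rho>_def)
  have "norm (y - x) \<le> s * norm w + e * s"
    unfolding yx using norm_triangle_ineq[of "s *\<^sub>R w" \<rho>] \<rho> s(1) by simp
  also have "\<dots> \<le> s * (norm w + 1)" using e(2) s(1) by (simp add: algebra_simps)
  finally have n: "norm (y - x) \<le> s * (norm w + 1)" .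
  also have "\<dots> < e * (norm w + 1)" using s(2) by (intro mult_strict_right_mono) (auto simp: add_nonneg_pos)
  also note ew
  finally have near: "norm (y - x) < r" "norm (y - x) < \<delta>" by auto
  have 1: "V y - V x \<le> V' (y - x) + \<eta> * norm (y - x)" using \<delta>(2)[OF near(2)] by (simp add: abs_le_iff)
  have 2: "V' (y - x) = s * V' w + V' \<rho>"
    unfolding yx using bl by (simp add: linear_simps)
  have 3: "V' \<rho> \<le> s * (m / 4)"
  proof -
    have "V' \<rho> \<le> norm \<rho> * B" using B(2)[of \<rho>] by simp
    also have "\<dots> \<le> (e * s) * B" using \<rho> B(1) by (intro mult_right_mono) auto
    also have "\<dots> \<le> (m / (4 * B) * s) * B" using e(3) s(1) B(1) by (intro mult_right_mono) auto
    also have "\<dots> = s * (m / 4)" using B(1) by simp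
    finally show ?thesis .
  qed
  have "\<eta> * norm (y - x) \<le> \<eta> * (s * (norm w + 1))" using n \<eta> by (intro mult_left_mono) auto
  also have "\<dots> = s * (\<eta> * (norm w + 1))" by (simp only: mult.left_commute)
  also have "\<dots> \<le> s * (m / 4)" using \<eta>w s(1) by (intro mult_left_mono) auto
  finally have 4: "\<eta> * norm (y - x) \<le> s * (m / 4)" .
  have "s * V' w = - (s * m)" by (simp add: m_def)
  then have "V y - V x \<le> - (s * m) + s * (m / 4) + s * (m / 4)" using 1 2 3 4 by linarith
  also have "\<dots> = - (s * (m / 2))" by simp
  finally have "V y - V x \<le> - (s * (m / 2))" .
  moreover have "0 < s * (m / 2)" using s(1) m by simp
  ultimately have "V y < V x" by linarith
  then show False using min[OF s(3)] near(1) by (simp add: dist_norm)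
qed

text \<open>The dissipation inequality bounds the rate of decrease of \<open>V\<close> from below by a multiple of the squared speed, which is more
than monotonicity: a trajectory cannot travel without paying in \<open>V\<close>.\<close>

locale dissipative_projected_system = projected_system S g
  for S :: "'a::euclidean_space set" and g :: "'a \<Rightarrow> 'a" +
  fixes V :: "'a \<Rightarrow> real" and V' :: "'a \<Rightarrow> 'a \<Rightarrow> real" and c :: real
  assumes V_deriv: "\<And>z. (V has_derivative V' z) (at z)"
    and c_pos: "0 < c"
    and dissipation: "\<And>z. z \<in> S \<Longrightarrow> V' z (field z) \<le> - c * (norm (field z))\<^sup>2"
    and compact_sublevel: "\<And>b. compact {z \<in> S. V z \<le> b}"
begin

lemma cont_V: "continuous_on A V"
  using V_deriv by (meson continuous_at_imp_continuous_on has_derivative_continuous)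

lemma solution_locally_Lipschitz:
  assumes sol: "solution_on S field I z" and sub: "{a..b} \<subseteq> I"
  shows "\<exists>M. M-lipschitz_on {a..b} z"
proof -
  have "compact (z ` {a..b})"
    using solution_on_continuous[OF sol sub] by (intro compact_continuous_image) auto
  moreover have "z ` {a..b} \<subseteq> S" using sol sub unfolding solution_on_def by auto
  ultimately obtain M where "0 < M" "\<forall>x\<in>z ` {a..b}. norm (field x) \<le> M"
    by (rule field_bounded_on_compact)
  then show ?thesis using solution_Lipschitz[OF sol sub, of M] by auto
qed

lemma V_decrease:
  assumes sol: "solution_on S field I z" and sub: "{a..b} \<subseteq> I" and ab: "a \<le> b"
    and \<mu>: "\<And>t. t \<in> {a..b} \<Longrightarrow> \<mu> \<le> (norm (field (z t)))\<^sup>2"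
  shows "V (z b) \<le> V (z a) - c * \<mu> * (b - a)"
proof -
  obtain M where M: "M-lipschitz_on {a..b} z" using solution_locally_Lipschitz[OF sol sub] by blast
  have "V (z b) - V (z a) \<le> (- c * \<mu>) * (b - a)"
  proof (rule solution_growth[OF sol sub ab M V_deriv])
    fix t assume t: "t \<in> {a..b}"
    have "z t \<in> S" using sol sub t unfolding solution_on_def by auto
    then have "V' (z t) (field (z t)) \<le> - c * (norm (field (z t)))\<^sup>2" by (rule dissipation)
    also have "\<dots> \<le> - c * \<mu>" using \<mu>[OF t] c_pos by simp
    finally show "V' (z t) (field (z t)) \<le> - c * \<mu>" .
  qed
  then show ?thesis by simp
qed

lemma V_antimono:
  assumes sol: "solution_on S field I z" and t: "s \<in> I" "t \<in> I" "s \<le> t"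
  shows "V (z t) \<le> V (z s)"
proof -
  have "{s..t} \<subseteq> I"
    using sol t unfolding solution_on_def is_interval_1 by (meson atLeastAtMost_iff subsetI)
  from V_decrease[OF sol this t(3), of 0] show ?thesis by simp
qed

lemma solution_in_sublevel:
  assumes sol: "solution_on S field I z" and t: "t \<in> I"
  shows "z t \<in> {x \<in> S. V x \<le> V (z 0)}"
proof -
  have "0 \<in> I" "0 \<le> t" "z t \<in> S" using sol t unfolding solution_on_def by auto
  then show ?thesis using V_antimono[OF sol] t by simp
qed

lemma sublevel_field_bound:
  obtains M where "0 < M" "\<forall>x\<in>{x \<in> S. V x \<le> b}. norm (field x) \<le> M"
  by (rule field_bounded_on_compact[OF compact_sublevel[of b]]) auto

text \<open>Outside a ball containing the initial sublevel set the drive is frozen to a bounded one.  The solution for the bounded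
drive cannot reach the boundary of the ball: up to the first time that it does so it is a solution for the original
drive, so \<open>V\<close> keeps it in the initial sublevel set.\<close>

theorem global_solution:
  assumes z0: "z0 \<in> S"
  obtains z where "z 0 = z0" "solution_on S field {0..} z"
proof -
  define K where "K = {x \<in> S. V x \<le> V z0}"
  have "compact K" unfolding K_def by (rule compact_sublevel)
  then obtain R where R: "0 < R" "K \<subseteq> ball 0 R"
    using compact_imp_bounded bounded_subset_ballD by metis
  define C where "C = cball (0::'a) R"
  define gc where "gc = (\<lambda>x. g (closest_point C x))"
  have C: "convex C" "closed C" "C \<noteq> {}" "compact C" using R by (auto simp: C_def)
  have "continuous_on UNIV gc"
    unfolding gc_def by (rule continuous_on_compose2[OF cont_g continuous_on_closest_point[OF C(1-3)]]) simp
  then interpret clip: projected_system S gc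
    by unfold_locales (use closed_S convex_cone inner_semicont in auto)
  have "compact (g ` C)" using C(4) cont_g continuous_on_subset compact_continuous_image by blast
  then obtain B where B: "\<forall>y\<in>g ` C. norm y \<le> B" using compact_imp_bounded bounded_pos by metis
  have bd: "norm (gc x) \<le> B" for x
    using B closest_point_in_set[OF C(2,3)] by (auto simp: gc_def)
  obtain z where z: "z 0 = z0" "solution_on S clip.field {0..} z"
    using clip.bounded_projected_solution[OF z0 bd] by metis
  have agree: "clip.field x = field x" if "x \<in> C" for x
  proof -
    have "gc x = g x" using that by (simp add: gc_def closest_point_self)
    then show ?thesis by (simp add: clip.field_def field_def)
  qed
  have inC: "z t \<in> C" if t: "0 \<le> t" for t
  proof (rule ccontr)
    assume out: "z t \<notin> C"
    have cont: "continuous_on {a..b} (\<lambda>t. norm (z t))" if "0 \<le> a" for a b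
      by (intro continuous_on_norm solution_on_continuous[OF z(2)]) (use that in auto)
    define A where "A = {r \<in> {0..t}. R \<le> norm (z r)}"
    have "closed A" unfolding A_def
      by (intro continuous_on_closed_Collect_le cont continuous_intros) auto
    moreover have "bounded A" by (rule bounded_subset[of "{0..t}"]) (auto simp: A_def)
    moreover have "t \<in> A" using out t by (simp add: A_def C_def)
    ultimately obtain r where r: "r \<in> A" "\<And>s. s \<in> A \<Longrightarrow> r \<le> s"
      using compact_attains_inf[of A] compact_eq_bounded_closed by blast
    have r0: "0 \<le> r" "r \<le> t" "R \<le> norm (z r)" using r(1) by (auto simp: A_def)
    have z0R: "norm (z 0) < R" using R(2) z0 z(1) by (auto simp: K_def)
    obtain s where s: "0 \<le> s" "s \<le> r" "norm (z s) = R"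
      using IVT'[of "\<lambda>t. norm (z t)" 0 R r] z0R r0 cont[of 0 r] by auto
    have "s \<in> A" using s r0 by (simp add: A_def)
    then have rs: "norm (z r) = R" using r(2)[of s] s by auto
    have inside: "z s \<in> C" if "s \<in> {0..r}" for s
    proof (cases "s = r")
      case False
      then have "s \<notin> A" using r(2)[of s] that by auto
      then show ?thesis using that r0 by (auto simp: A_def C_def)
    qed (simp add: rs C_def)
    have "solution_on S clip.field {0..r} z"
      by (rule solution_on_subset[OF z(2)]) (use r0 in \<open>auto simp: is_interval_cc\<close>)
    then have "solution_on S field {0..r} z"
      by (rule solution_on_field_cong) (use agree inside in blast)
    then have "z r \<in> K" using solution_in_sublevel[of "{0..r}" z r] r0 z(1) by (simp add: K_def)
    then show False using R(2) rs by auto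
  qed
  have "solution_on S field {0..} z"
    using z(2) by (rule solution_on_field_cong) (use agree inC in auto)
  with z(1) show ?thesis by (rule that)
qed

lemma extend_solution:
  assumes sol: "solution_on S field {0..b} z" and b: "0 \<le> b"
  obtains y where "solution_on S field {0..} y" "\<forall>t\<in>{0..b}. y t = z t"
proof -
  have "z b \<in> S" using sol b unfolding solution_on_def by auto
  then obtain x where x: "x 0 = z b" "solution_on S field {0..} x" by (rule global_solution)
  have "solution_on S field {0..} (\<lambda>t. if t \<le> b then z t else x (t - b))"
    by (rule solution_on_concat[OF sol x(2) b x(1)])
      (use solution_locally_Lipschitz[OF sol] solution_locally_Lipschitz[OF x(2)] in blast)+
  then show ?thesis by (rule that) simp
qed

lemma close_solution:
  assumes sol: "solution_on S field {0..<b} z" and b: "0 < b"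
  obtains y where "solution_on S field {0..b} y" "\<forall>t\<in>{0..<b}. y t = z t"
proof -
  obtain M where M: "0 < M" "\<forall>x\<in>{x \<in> S. V x \<le> V (z 0)}. norm (field x) \<le> M"
    by (rule sublevel_field_bound)
  have bd: "norm (field (z t)) \<le> M" if "t \<in> {0..<b}" for t
    using M(2) solution_in_sublevel[OF sol that] by blast
  have "M-lipschitz_on {0..<b} z"
  proof (rule lipschitz_onI)
    fix s t assume st: "s \<in> {0..<b}" "t \<in> {0..<b}"
    have "M-lipschitz_on {0..max s t} z"
      by (rule solution_Lipschitz[OF sol]) (use st M(1) bd in auto)
    then show "dist (z s) (z t) \<le> M * dist s t"
      by (rule lipschitz_onD) (use st in auto)
  qed (use M in simp)
  then obtain y where y: "M-lipschitz_on (closure {0..<b}) y" "\<forall>t\<in>{0..<b}. y t = z t"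
    using lipschitz_extend_closure by blast
  have ylip: "M-lipschitz_on {0..b} y" using y(1) b by simp
  have yS: "y t \<in> S" if t: "t \<in> {0..b}" for t
  proof (cases "t = b")
    case False
    then show ?thesis using y(2) sol t unfolding solution_on_def by auto
  next
    case True
    have "continuous_on (closure {0..<b}) y" using ylip b lipschitz_on_continuous_on by simp
    moreover have "y ` {0..<b} \<subseteq> S" using y(2) sol unfolding solution_on_def by auto
    ultimately have "y ` closure {0..<b} \<subseteq> S" using closed_S by (intro image_closure_subset) auto
    then show ?thesis using True b by auto
  qed
  obtain N where N: "negligible N"
    "\<And>t. t \<in> {0..<b} \<Longrightarrow> t \<notin> N \<Longrightarrow> (z has_vector_derivative field (z t)) (at t within {0..<b})"
    by (rule solution_on_AE_derivative[OF sol]) blast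
  have "solution_on S field {0..b} y"
  proof (rule solution_onI)
    show "\<exists>M. M-lipschitz_on {p..q} y" if "{p..q} \<subseteq> {0..b}" for p q
      using lipschitz_on_subset[OF ylip that] by blast
    show "negligible (insert b N)" using N(1) by simp
    fix t assume t: "t \<in> {0..b}" "t \<notin> insert b N"
    have "at t within {0..<b} = at t within {0..b}"
      by (rule at_within_nhd[of t "{..<b}"]) (use t in auto)
    then have "(z has_vector_derivative field (z t)) (at t within {0..b})"
      using N(2)[of t] t by auto
    then have "(y has_vector_derivative field (z t)) (at t within {0..b})"
      by (rule has_vector_derivative_transform_within[of _ _ _ _ "b - t"])
        (use t y(2) in \<open>auto simp: dist_real_def\<close>)
    then show "(y has_vector_derivative field (y t)) (at t within {0..b})" using t y(2) by auto
  qed (use b yS in \<open>auto simp: is_interval_cc\<close>)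
  then show ?thesis using y(2) by (rule that)
qed

text \<open>A solution on a compact interval continues globally from its endpoint, and a solution on a half-open interval is Lipschitz and
extends to the closure, so neither can be maximal.\<close>

theorem maximal_solution_complete:
  assumes max: "maximal_solution S field I z"
  shows "I = {0..}"
proof -
  have sol: "solution_on S field I z" using max by (simp add: maximal_solution_def)
  have ext: "J = I" if "solution_on S field J y" "I \<subseteq> J" "\<forall>t\<in>I. y t = z t" for J y
    using max that unfolding maximal_solution_def by blast
  have "is_interval I" "0 \<in> I" "I \<subseteq> {0..}" using sol unfolding solution_on_def by auto
  then show ?thesis
  proof (cases rule: nonneg_interval_cases)
    case (2 b)
    obtain y where y: "solution_on S field {0..} y" "\<forall>t\<in>{0..b}. y t = z t"
      by (rule extend_solution[OF sol[unfolded 2(2)] 2(1)])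
    have "{0..b} \<subseteq> {0..}" by auto
    then have "{0..} = {0..b}" using ext[OF y(1)] y(2) unfolding 2(2) by blast
    then show ?thesis using 2(2) by simp
  next
    case (3 b)
    obtain y where y: "solution_on S field {0..b} y" "\<forall>t\<in>{0..<b}. y t = z t"
      by (rule close_solution[OF sol[unfolded 3(2)] 3(1)])
    have "{0..b} = I" by (rule ext[OF y(1)]) (use y(2) 3 in auto)
    moreover have "b \<in> {0..b}" "b \<notin> I" using 3 by auto
    ultimately show ?thesis by blast
  qed
qed

text \<open>Whenever the solution is at distance \<open>e\<close> from the equilibria, the speed bound keeps it at distance \<open>e / 2\<close> for a fixed time
\<open>\<tau>\<close>.  There the squared speed is at least some \<open>\<mu> > 0\<close>, so \<open>V\<close> drops by \<open>c \<mu> \<tau>\<close> each time this happens.\<close>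

lemma global_solution_converges:
  assumes sol: "solution_on S field {0..} z"
  shows "converges_to_set z {x \<in> S. field x = 0}"
proof (rule ccontr)
  define Z where "Z = {x \<in> S. field x = 0}"
  assume "\<not> converges_to_set z {x \<in> S. field x = 0}"
  then obtain e where e: "0 < e" "\<not> (\<forall>\<^sub>F t in at_top. \<exists>x\<in>Z. dist (z t) x < e)"
    unfolding converges_to_set_def Z_def by blast
  have far: "\<exists>t\<ge>s. \<forall>x\<in>Z. e \<le> dist (z t) x" for s
    using e(2) unfolding eventually_at_top_linorder by (meson not_less)
  define K where "K = {x \<in> S. V x \<le> V (z 0)}"
  have K: "compact K" unfolding K_def by (rule compact_sublevel)
  have zK: "z t \<in> K" if "0 \<le> t" for t
    using solution_in_sublevel[OF sol, of t] that by (simp add: K_def)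
  obtain M where M: "0 < M" "\<forall>x\<in>K. norm (field x) \<le> M"
    unfolding K_def by (rule sublevel_field_bound)
  define K' where "K' = K \<inter> (\<Inter>x\<in>Z. {y. e / 2 \<le> dist y x})"
  have "closed (\<Inter>x\<in>Z. {y. e / 2 \<le> dist y x})"
    by (intro closed_INT ballI closed_Collect_le continuous_intros)
  then have K': "compact K'" unfolding K'_def using K by (rule compact_Int_closed[rotated])
  have "K' \<subseteq> S" by (auto simp: K'_def K_def)
  have nz: "field y \<noteq> 0" if y: "y \<in> K'" for y
  proof
    assume "field y = 0"
    then have "y \<in> Z" using y \<open>K' \<subseteq> S\<close> by (auto simp: Z_def)
    then have "e / 2 \<le> dist y y" using y unfolding K'_def by blast
    then show False using e(1) by simp
  qed
  obtain \<mu> where \<mu>: "0 < \<mu>" "\<forall>y\<in>K'. \<mu> \<le> (norm (field y))\<^sup>2"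
    by (rule field_bounded_away_from_zero[OF K' \<open>K' \<subseteq> S\<close> nz])
  define \<tau> where "\<tau> = e / (2 * M)"
  have \<tau>: "0 < \<tau>" "M * \<tau> = e / 2" using e M(1) by (auto simp: \<tau>_def)
  define \<kappa> where "\<kappa> = c * \<mu> * \<tau>"
  have \<kappa>: "0 < \<kappa>" using c_pos \<mu>(1) \<tau>(1) by (simp add: \<kappa>_def)
  have drop: "\<exists>t\<ge>0. V (z t) \<le> V (z s) - \<kappa>" if s: "0 \<le> s" for s
  proof -
    obtain t where t: "s \<le> t" "\<forall>x\<in>Z. e \<le> dist (z t) x" using far by blast
    have sub: "{t..t + \<tau>} \<subseteq> {0..}" using s t(1) by auto
    have lip: "M-lipschitz_on {t..t + \<tau>} z"
      by (rule solution_Lipschitz[OF sol sub]) (use M zK s t(1) in auto)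
    have "z r \<in> K'" if r: "r \<in> {t..t + \<tau>}" for r
    proof -
      have "dist (z t) (z r) \<le> M * dist t r" by (rule lipschitz_onD[OF lip]) (use r \<tau>(1) in auto)
      also have "\<dots> \<le> M * \<tau>" using r M(1) by (intro mult_left_mono) (auto simp: dist_real_def)
      finally have near: "dist (z t) (z r) \<le> e / 2" using \<tau>(2) by simp
      have "e / 2 \<le> dist (z r) x" if "x \<in> Z" for x
        using t(2) that dist_triangle[of "z t" x "z r"] near by force
      then show ?thesis using zK[of r] r s t(1) by (auto simp: K'_def)
    qed
    then have "V (z (t + \<tau>)) \<le> V (z t) - c * \<mu> * (t + \<tau> - t)"
      by (intro V_decrease[OF sol sub]) (use \<mu>(2) \<tau>(1) in auto)
    moreover have "V (z t) \<le> V (z s)" using V_antimono[OF sol, of s t] s t(1) by simp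
    ultimately show ?thesis using \<tau>(1) s t(1) by (intro exI[of _ "t + \<tau>"]) (auto simp: \<kappa>_def)
  qed
  have down: "\<exists>t\<ge>0. V (z t) \<le> V (z 0) - real n * \<kappa>" for n
  proof (induction n)
    case (Suc n)
    then obtain s where s: "0 \<le> s" "V (z s) \<le> V (z 0) - real n * \<kappa>" by blast
    obtain t where "0 \<le> t" "V (z t) \<le> V (z s) - \<kappa>" using drop[OF s(1)] by blast
    then show ?case using s by (intro exI[of _ t]) (auto simp: algebra_simps)
  qed auto
  have "z 0 \<in> K" using zK by simp
  then obtain y where y: "y \<in> K" "\<forall>x\<in>K. V y \<le> V x"
    using continuous_attains_inf[OF K _ cont_V] by blast
  obtain n where n: "V (z 0) - V y < real n * \<kappa>" using reals_Archimedean3[OF \<kappa>] by blast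
  obtain t where "0 \<le> t" "V (z t) \<le> V (z 0) - real n * \<kappa>" using down by blast
  then show False using n y(2) zK[of t] by force
qed

lemma global_solution_maximal:
  assumes "solution_on S field {0..} z"
  shows "maximal_solution S field {0..} z"
  unfolding maximal_solution_def
proof (intro conjI allI impI)
  fix J y assume "solution_on S field J y \<and> {0..} \<subseteq> J \<and> (\<forall>t\<in>{0..}. y t = z t)"
  then have "{0..} \<subseteq> J" "J \<subseteq> {0..}" unfolding solution_on_def by auto
  then show "J = {0..}" by simp
qed (rule assms)

text \<open>A trajectory started at a nearby point \<open>y\<close> converges to \<open>x\<close> and does not increase \<open>V\<close>, so \<open>V x \<le> V y\<close>.  In case
of equality \<open>V\<close> is constant along it.  The growth estimate for \<open>e \<bullet> z + \<lambda> * V z\<close> with \<open>e = z t - y\<close> then bounds \<open>|e|\<^sup>2\<close> by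
\<open>|e|\<^sup>2 t / (4 \<lambda> c)\<close>, so \<open>e = 0\<close> as \<open>\<lambda>\<close> may be large: the trajectory is at rest, and it can converge to \<open>x\<close> only if
\<open>y = x\<close>.\<close>

lemma asymptotically_stable_imp_strict_local_minimizer:
  assumes as: "asymptotically_stable_equilibrium S field x"
  shows "strict_local_minimizer V S x"
proof -
  have xS: "x \<in> S"
    using as by (simp add: asymptotically_stable_equilibrium_def stable_equilibrium_def equilibrium_def)
  obtain d where d: "0 < d" "\<And>I z. maximal_solution S field I z \<Longrightarrow> dist (z 0) x < d \<Longrightarrow> (z \<longlongrightarrow> x) at_top"
    using as unfolding asymptotically_stable_equilibrium_def by blast
  have "V x < V y" if y: "y \<in> S" "y \<noteq> x" "dist y x < d" for y
  proof (rule ccontr)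
    assume not: "\<not> V x < V y"
    obtain z where z: "z 0 = y" "solution_on S field {0..} z" using global_solution[OF y(1)] by blast
    have lim: "(z \<longlongrightarrow> x) at_top" using d(2)[OF global_solution_maximal[OF z(2)]] z(1) y(3) by simp
    have Vlim: "((\<lambda>t. V (z t)) \<longlongrightarrow> V x) at_top"
      using isCont_tendsto_compose[OF _ lim, of V] cont_V[of UNIV] by (simp add: continuous_on_eq_continuous_at)
    have lower: "V x \<le> V (z t)" if t: "0 \<le> t" for t
    proof (rule tendsto_upperbound[OF Vlim])
      show "\<forall>\<^sub>F s in at_top. V (z s) \<le> V (z t)"
        using eventually_ge_at_top[of t] by (rule eventually_mono) (use V_antimono[OF z(2)] t in auto)
    qed simp
    have const: "V (z t) = V x" if t: "0 \<le> t" for t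
      using lower[OF t] V_antimono[OF z(2), of 0 t] t not z(1) by auto
    have "z t = y" if t: "0 \<le> t" for t
    proof -
      define e where "e = z t - z 0"
      define \<kappa> where "\<kappa> = (t + 1) / 4"
      have \<kappa>: "0 < \<kappa>" and \<kappa>4: "4 * \<kappa> = t + 1" using t by (simp_all add: \<kappa>_def)
      have sub: "{0..t} \<subseteq> {0..}" by auto
      obtain M where M: "M-lipschitz_on {0..t} z" using solution_locally_Lipschitz[OF z(2) sub] by blast
      have der: "((\<lambda>x. e \<bullet> x + (\<kappa> / c) * V x) has_derivative (\<lambda>h. e \<bullet> h + (\<kappa> / c) * V' x h)) (at x)" for x
        by (intro has_derivative_add has_derivative_mult_right V_deriv has_derivative_inner_right has_derivative_ident)
      have "e \<bullet> z t + (\<kappa> / c) * V (z t) - (e \<bullet> z 0 + (\<kappa> / c) * V (z 0)) \<le> (norm e)\<^sup>2 / (4 * \<kappa>) * (t - 0)"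
      proof (rule solution_growth[OF z(2) sub t M der])
        fix s assume "s \<in> {0..t}"
        then have "z s \<in> S" using z(2) unfolding solution_on_def by auto
        define F where "F = field (z s)"
        have "(\<kappa> / c) * V' (z s) F \<le> (\<kappa> / c) * (- c * (norm F)\<^sup>2)"
          unfolding F_def using dissipation[OF \<open>z s \<in> S\<close>] \<kappa> c_pos by (intro mult_left_mono) auto
        moreover have "e \<bullet> F \<le> norm e * norm F" by (rule norm_cauchy_schwarz)
        moreover have "(norm e * norm F - \<kappa> * (norm F)\<^sup>2) * (4 * \<kappa>) \<le> (norm e)\<^sup>2"
          using zero_le_power2[of "norm e - 2 * \<kappa> * norm F"] by (simp add: power2_eq_square algebra_simps)
        then have "norm e * norm F - \<kappa> * (norm F)\<^sup>2 \<le> (norm e)\<^sup>2 / (4 * \<kappa>)"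
          using \<kappa> by (intro pos_le_divide_eq[THEN iffD2]) auto
        ultimately show "e \<bullet> field (z s) + (\<kappa> / c) * V' (z s) (field (z s)) \<le> (norm e)\<^sup>2 / (4 * \<kappa>)"
          using c_pos by (simp add: F_def)
      qed
      then have "e \<bullet> e \<le> (norm e)\<^sup>2 / (4 * \<kappa>) * t"
        using const[OF t] const[of 0] by (simp add: e_def inner_diff_right)
      also have "\<dots> = (norm e)\<^sup>2 * t / (t + 1)" by (simp only: \<kappa>4 times_divide_eq_left)
      finally have "(norm e)\<^sup>2 * (t + 1) \<le> (norm e)\<^sup>2 * t"
        using t by (simp only: pos_le_divide_eq power2_norm_eq_inner)
      then have "(norm e)\<^sup>2 \<le> 0" by (simp add: distrib_left)
      then show ?thesis using z(1) by (simp add: e_def)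
    qed
    then have "(z \<longlongrightarrow> y) at_top"
      by (intro tendsto_eventually) (auto simp: eventually_at_top_linorder)
    then have "y = x" using lim tendsto_unique[of at_top z] by simp
    then show False using y(2) by simp
  qed
  then show ?thesis unfolding strict_local_minimizer_def using xS d(1) by blast
qed

text \<open>On a small sphere around \<open>x\<close> the minimum of \<open>V\<close> exceeds \<open>V x\<close>, so trajectories that start close enough never
cross the sphere.\<close>

lemma strict_local_minimizer_imp_stable:
  assumes min: "strict_local_minimizer V S x"
  shows "stable_equilibrium S field x"
proof -
  obtain r where xS: "x \<in> S" and r: "0 < r" "\<And>y. y \<in> S \<Longrightarrow> y \<noteq> x \<Longrightarrow> dist y x < r \<Longrightarrow> V x < V y"
    using min unfolding strict_local_minimizer_def by blast
  have "V x \<le> V y" if "y \<in> S" "dist y x < r" for y using r(2)[OF that(1) _ that(2)] by (cases "y = x") auto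
  then have "0 \<le> V' x (field x)" by (rule local_minimizer_derivative_nonneg[OF V_deriv r(1) _ field_in_cone[OF xS]])
  also have "\<dots> \<le> - c * (norm (field x))\<^sup>2" by (rule dissipation[OF xS])
  finally have "c * (norm (field x))\<^sup>2 \<le> 0" by simp
  then have "(norm (field x))\<^sup>2 \<le> 0" using c_pos by (simp add: mult_le_0_iff)
  then have eq: "equilibrium S field x" using xS by (simp add: equilibrium_def)
  have "\<exists>d>0. \<forall>I z. solution_on S field I z \<and> dist (z 0) x < d \<longrightarrow> (\<forall>t\<in>I. dist (z t) x < e)" if e: "0 < e" for e
  proof -
    define e' where "e' = min e r / 2"
    have e': "0 < e'" "e' < e" "e' < r" using e r(1) by (auto simp: e'_def)
    define \<Sigma> where "\<Sigma> = S \<inter> sphere x e'"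
    have \<Sigma>: "compact \<Sigma>" unfolding \<Sigma>_def using closed_S by (simp add: closed_Int_compact)
    have gt: "V x < V y" if "y \<in> \<Sigma>" for y
      using r(2)[of y] that e' by (auto simp: \<Sigma>_def dist_commute)
    obtain m where m: "V x < m" "\<And>y. y \<in> \<Sigma> \<Longrightarrow> m \<le> V y"
    proof (cases "\<Sigma> = {}")
      case True
      then show ?thesis using that[of "V x + 1"] by simp
    next
      case False
      then obtain y where "y \<in> \<Sigma>" "\<forall>u\<in>\<Sigma>. V y \<le> V u"
        using continuous_attains_inf[OF \<Sigma> _ cont_V] by blast
      then show ?thesis using that[of "V y"] gt by auto
    qed
    have "isCont V x" using cont_V[of UNIV] by (simp add: continuous_on_eq_continuous_at)
    then obtain d where d: "0 < d" "\<And>y. dist y x < d \<Longrightarrow> dist (V y) (V x) < m - V x"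
      using m(1) unfolding continuous_at_eps_delta by (metis diff_gt_0_iff_gt)
    have "dist (z t) x < e" if sol: "solution_on S field I z" and z0: "dist (z 0) x < min d e'" and t: "t \<in> I"
      for I z t
    proof (rule ccontr)
      assume "\<not> dist (z t) x < e"
      then have far: "e' \<le> dist (z t) x" using e' by simp
      have I: "is_interval I" "0 \<in> I" "0 \<le> t" using sol t unfolding solution_on_def by auto
      then have sub: "{0..t} \<subseteq> I" using t unfolding is_interval_1 by (meson atLeastAtMost_iff subsetI)
      have "continuous_on {0..t} (\<lambda>s. dist (z s) x)"
        by (intro continuous_on_dist solution_on_continuous[OF sol sub] continuous_on_const)
      then obtain s where s: "0 \<le> s" "s \<le> t" "dist (z s) x = e'"
        using IVT'[of "\<lambda>s. dist (z s) x" 0 e' t] far z0 I(3) by auto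
      have "s \<in> I" using s sub by auto
      then have "z s \<in> \<Sigma>" using s(3) sol unfolding solution_on_def by (auto simp: \<Sigma>_def dist_commute)
      then have "m \<le> V (z s)" by (rule m(2))
      also have "\<dots> \<le> V (z 0)" by (rule V_antimono[OF sol I(2) \<open>s \<in> I\<close> s(1)])
      also have "\<dots> < m" using d(2)[of "z 0"] z0 by (auto simp: dist_real_def)
      finally show False by simp
    qed
    then show ?thesis using d(1) e'(1) by (intro exI[of _ "min d e'"]) auto
  qed
  then show ?thesis unfolding stable_equilibrium_def using eq by blast
qed

end

section \<open>Gradients\<close>

lemma GDERIV_unique:
  assumes "GDERIV g x :> D" "GDERIV g x :> E"
  shows "D = E"
proof -
  have "(\<lambda>h. h \<bullet> D) = (\<lambda>h. h \<bullet> E)"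
    using assms has_derivative_unique unfolding gderiv_def by blast
  then have "(D - E) \<bullet> D = (D - E) \<bullet> E" by meson
  then have "(D - E) \<bullet> (D - E) = 0" by (simp add: inner_diff_right)
  then show ?thesis by simp
qed

lemma grad_eqI: "GDERIV g x :> D \<Longrightarrow> grad g x = D"
  unfolding grad_def using GDERIV_unique by blast

lemma has_derivative_grad:
  fixes g :: "'a::euclidean_space \<Rightarrow> real"
  assumes "(g has_derivative g') (at x)"
  shows "g' = (\<lambda>h. grad g x \<bullet> h)"
proof -
  have lin: "linear g'" using assms has_derivative_linear by blast
  have "g' h = h \<bullet> adjoint g' 1" for h using adjoint_works[OF lin, of h 1] by simp
  then have eq: "g' = (\<lambda>h. h \<bullet> adjoint g' 1)" by blast
  then have "GDERIV g x :> adjoint g' 1" using assms unfolding gderiv_def by simp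
  then have "grad g x = adjoint g' 1" by (rule grad_eqI)
  then show ?thesis using eq by (simp add: inner_commute fun_eq_iff)
qed

lemma C1_has_derivative_grad:
  fixes g :: "'a::euclidean_space \<Rightarrow> real"
  assumes "C1 g"
  shows "(g has_derivative (\<lambda>h. grad g x \<bullet> h)) (at x)"
proof -
  obtain G where G: "(g has_derivative blinfun_apply (G x)) (at x)" using assms unfolding C1_def by blast
  then show ?thesis using has_derivative_grad[OF G] by simp
qed

lemma C1_continuous_grad:
  fixes g :: "'a::euclidean_space \<Rightarrow> real"
  assumes "C1 g"
  shows "continuous_on UNIV (grad g)"
proof -
  obtain G where G: "\<And>x. (g has_derivative blinfun_apply (G x)) (at x)" "continuous_on UNIV G"
    using assms unfolding C1_def by blast
  have "grad g x \<bullet> b = blinfun_apply (G x) b" for x b using has_derivative_grad[OF G(1)] by metis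
  then have "continuous_on UNIV (\<lambda>x. grad g x \<bullet> b)" for b
    using G(2) by (simp add: continuous_intros)
  then show ?thesis by (subst continuous_on_componentwise) simp
qed

lemma C1_continuous: "C1 g \<Longrightarrow> continuous_on A g"
  unfolding C1_def by (meson continuous_at_imp_continuous_on has_derivative_continuous)

section \<open>Cones of regular constraint sets\<close>

text \<open>Full rank makes the vectors \<open>a k\<close> distinct and independent; the functional that picks out one of them is
represented by a vector.\<close>

lemma dual_family:
  fixes a :: "'i \<Rightarrow> 'a::euclidean_space"
  assumes J: "finite J" and dim: "dim (a ` J) = card J"
  obtains e where "\<And>k m. k \<in> J \<Longrightarrow> m \<in> J \<Longrightarrow> a k \<bullet> e m = (if k = m then 1 else 0)"
proof -
  have fin: "finite (a ` J)" using J by simp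
  have "card J \<le> card (a ` J)" using dim_le_card'[OF fin] dim by simp
  then have inj: "inj_on a J" using J by (simp add: card_image_le eq_card_imp_inj_on le_antisym)
  have indep: "independent (a ` J)"
    using dim card_image[OF inj] fin by (metis card_eq_dim dim_span order_refl span_superset independent_card_le_dim basis_exists)
  have "\<exists>e. \<forall>k\<in>J. a k \<bullet> e = (if k = m then 1 else 0)" if m: "m \<in> J" for m
  proof -
    obtain \<phi> where \<phi>: "linear \<phi>" "\<forall>x\<in>a ` J. \<phi> x = (if x = a m then 1 else 0 :: real)"
      using linear_independent_extend[OF indep, of "\<lambda>x. if x = a m then 1 else 0 :: real"] by blast
    have "a k \<bullet> adjoint \<phi> 1 = (if k = m then 1 else 0)" if "k \<in> J" for k
      using adjoint_works[OF \<phi>(1), of "a k" 1] \<phi>(2) that m inj by (auto simp: inj_on_eq_iff)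
    then show ?thesis by blast
  qed
  then show ?thesis using that by metis
qed

lemma convex_tangent_cone:
  fixes u :: "real ^ 'p"
  shows "convex (tangent_cone s \<xi> q \<omega> u)"
  unfolding convex_def tangent_cone_def
proof (clarsimp simp: inner_add_right)
  fix x y :: "real ^ 'p" and a b :: real and j
  assume "\<forall>j\<in>active_set q \<omega> u. grad (\<omega> j) u \<bullet> x \<le> 0" "\<forall>j\<in>active_set q \<omega> u. grad (\<omega> j) u \<bullet> y \<le> 0"
    "0 \<le> a" "0 \<le> b" "j \<in> active_set q \<omega> u"
  then show "a * (grad (\<omega> j) u \<bullet> x) + b * (grad (\<omega> j) u \<bullet> y) \<le> 0"
    by (intro add_nonpos_nonpos mult_nonneg_nonpos) auto
qed

locale regular_constraint_set =
  fixes s q :: nat and \<xi> \<omega> :: "nat \<Rightarrow> real ^ 'p \<Rightarrow> real"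
  assumes regular: "regular_constraints s \<xi> q \<omega>"
begin

abbreviation "U \<equiv> constraint_set s \<xi> q \<omega>"

definition constr :: "nat + nat \<Rightarrow> real ^ 'p \<Rightarrow> real" where
  "constr k = (case k of Inl i \<Rightarrow> \<xi> i | Inr j \<Rightarrow> \<omega> j)"

definition active_index :: "real ^ 'p \<Rightarrow> (nat + nat) set" where
  "active_index u = Inl ` {..<s} \<union> Inr ` active_set q \<omega> u"

lemma C1_constr: "k \<in> active_index u \<Longrightarrow> C1 (constr k)"
  using regular unfolding regular_constraints_def active_index_def constr_def active_set_def by auto

lemma constr_zero: "u \<in> U \<Longrightarrow> k \<in> active_index u \<Longrightarrow> constr k u = 0"
  unfolding constraint_set_def active_index_def constr_def active_set_def by auto

lemma finite_active_index: "finite (active_index u)"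
  by (simp add: active_index_def active_set_def)

lemma dual_gradients:
  assumes u: "u \<in> U"
  obtains e where "\<And>k m. k \<in> active_index u \<Longrightarrow> m \<in> active_index u \<Longrightarrow> grad (constr k) u \<bullet> e m = (if k = m then 1 else 0)"
proof -
  have "card (active_index u) = s + card (active_set q \<omega> u)"
    unfolding active_index_def by (subst card_Un_disjoint) (auto simp: card_image active_set_def)
  moreover have "(\<lambda>k. grad (constr k) u) ` active_index u =
      (\<lambda>i. grad (\<xi> i) u) ` {..<s} \<union> (\<lambda>j. grad (\<omega> j) u) ` active_set q \<omega> u"
    by (auto simp: active_index_def constr_def image_Un image_image)
  ultimately have "dim ((\<lambda>k. grad (constr k) u) ` active_index u) = card (active_index u)"
    using regular u unfolding regular_constraints_def by simp
  then show ?thesis using dual_family[OF finite_active_index, of "\<lambda>k. grad (constr k) u" u] that by blast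
qed

lemma tangent_cone_constr:
  "w \<in> tangent_cone s \<xi> q \<omega> u \<longleftrightarrow>
    (\<forall>i<s. grad (constr (Inl i)) u \<bullet> w = 0) \<and> (\<forall>j\<in>active_set q \<omega> u. grad (constr (Inr j)) u \<bullet> w \<le> 0)"
  by (simp add: tangent_cone_def constr_def)

lemma inactive_stays_inactive:
  assumes u: "u \<in> U"
  obtains d where "0 < d" "\<And>y j. dist y u < d \<Longrightarrow> j < q \<Longrightarrow> j \<notin> active_set q \<omega> u \<Longrightarrow> \<omega> j y < 0"
proof -
  have ev: "\<forall>\<^sub>F y in nhds u. \<omega> j y < 0" if j: "j \<in> {j. j < q \<and> j \<notin> active_set q \<omega> u}" for j
  proof -
    have neg: "\<omega> j u < 0" using j u unfolding active_set_def constraint_set_def by (auto simp: less_le)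
    have "C1 (\<omega> j)" using regular j unfolding regular_constraints_def by auto
    then have "isCont (\<omega> j) u"
      using C1_continuous[of "\<omega> j" UNIV] by (simp add: continuous_on_eq_continuous_at)
    then have "(\<omega> j \<longlongrightarrow> \<omega> j u) (nhds u)" by (simp add: isCont_def tendsto_at_iff_tendsto_nhds)
    then show ?thesis using neg by (rule order_tendstoD(2))
  qed
  have "\<forall>\<^sub>F y in nhds u. \<forall>j\<in>{j. j < q \<and> j \<notin> active_set q \<omega> u}. \<omega> j y < 0"
    using ev by (intro eventually_ball_finite) auto
  then obtain d where "0 < d" "\<And>y. dist y u < d \<Longrightarrow> \<forall>j\<in>{j. j < q \<and> j \<notin> active_set q \<omega> u}. \<omega> j y < 0"
    unfolding eventually_nhds_metric by blast
  then show ?thesis using that[of d] by blast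
qed

text \<open>With vectors \<open>e m\<close> dual to the active gradients at \<open>u\<close>, every active gradient at \<open>u\<close> takes the same
value on \<open>v + E y v\<close> as its counterpart at \<open>y\<close> takes on \<open>v\<close>.  The linear map \<open>v + E y v\<close> is close to the identity when \<open>y\<close> is close to \<open>u\<close>, hence bijective, and the preimage of a
tangent vector at \<open>u\<close> is a nearby tangent vector at \<open>y\<close>.\<close>

lemma inner_semicontinuous_tangent_cone:
  "inner_semicontinuous_on U (tangent_cone s \<xi> q \<omega>)"
  unfolding inner_semicontinuous_on_def
proof (intro ballI allI impI)
  fix u w and \<epsilon> :: real
  assume u: "u \<in> U" and w: "w \<in> tangent_cone s \<xi> q \<omega> u" and \<epsilon>: "0 < \<epsilon>"
  obtain e where e: "\<And>k m. k \<in> active_index u \<Longrightarrow> m \<in> active_index u \<Longrightarrow> grad (constr k) u \<bullet> e m = (if k = m then 1 else 0)"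
    by (rule dual_gradients[OF u]) blast
  define E where "E y v = (\<Sum>m\<in>active_index u. ((grad (constr m) y - grad (constr m) u) \<bullet> v) *\<^sub>R e m)" for y v
  define \<kappa> where "\<kappa> y = (\<Sum>m\<in>active_index u. norm (grad (constr m) y - grad (constr m) u) * norm (e m))" for y
  have E_le: "norm (E y v) \<le> \<kappa> y * norm v" for y v
  proof -
    have "norm (E y v) \<le> (\<Sum>m\<in>active_index u. norm (((grad (constr m) y - grad (constr m) u) \<bullet> v) *\<^sub>R e m))"
      unfolding E_def by (rule norm_sum)
    also have "\<dots> \<le> (\<Sum>m\<in>active_index u. norm (grad (constr m) y - grad (constr m) u) * norm (e m) * norm v)"
    proof (rule sum_mono)
      fix m assume "m \<in> active_index u"
      have "\<bar>(grad (constr m) y - grad (constr m) u) \<bullet> v\<bar> * norm (e m)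
          \<le> (norm (grad (constr m) y - grad (constr m) u) * norm v) * norm (e m)"
        by (intro mult_right_mono Cauchy_Schwarz_ineq2) auto
      then show "norm (((grad (constr m) y - grad (constr m) u) \<bullet> v) *\<^sub>R e m)
          \<le> norm (grad (constr m) y - grad (constr m) u) * norm (e m) * norm v"
        by (simp add: mult.commute mult.left_commute)
    qed
    also have "\<dots> = \<kappa> y * norm v" by (simp add: \<kappa>_def sum_distrib_right)
    finally show ?thesis .
  qed
  have linE: "linear (E y)" for y
    unfolding E_def
    by (intro linear_compose_sum ballI linearI) (auto simp: inner_add_right algebra_simps)
  have E_dual: "grad (constr k) u \<bullet> E y v = (grad (constr k) y - grad (constr k) u) \<bullet> v" if k: "k \<in> active_index u" for k y v
  proof -
    have "grad (constr k) u \<bullet> E y v =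
        (\<Sum>m\<in>active_index u. if k = m then (grad (constr m) y - grad (constr m) u) \<bullet> v else 0)"
      unfolding E_def inner_sum_right by (intro sum.cong) (auto simp: e[OF k])
    also have "\<dots> = (grad (constr k) y - grad (constr k) u) \<bullet> v"
      using k finite_active_index by (simp add: sum.delta')
    finally show ?thesis .
  qed
  obtain \<eta> where \<eta>: "0 < \<eta>" "\<eta> \<le> 1 / 2" and \<eta>w: "\<eta> * (2 * norm w) \<le> \<epsilon>"
    using small_positive[of "1 / 2" "1 / 2" \<epsilon> "2 * norm w"] \<epsilon> by auto
  have "isCont \<kappa> u"
  proof -
    have "isCont (\<lambda>y. grad (constr m) y) u" if "m \<in> active_index u" for m
      using C1_continuous_grad[OF C1_constr[OF that]] by (simp add: continuous_on_eq_continuous_at)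
    then show ?thesis unfolding \<kappa>_def by (intro continuous_intros) auto
  qed
  moreover have "\<kappa> u = 0" by (simp add: \<kappa>_def)
  ultimately obtain d1 where d1: "0 < d1" "\<And>y. dist y u < d1 \<Longrightarrow> dist (\<kappa> y) 0 < \<eta>"
    using \<eta>(1) unfolding continuous_at_eps_delta by metis
  obtain d2 where d2: "0 < d2" "\<And>y j. dist y u < d2 \<Longrightarrow> j < q \<Longrightarrow> j \<notin> active_set q \<omega> u \<Longrightarrow> \<omega> j y < 0"
    by (rule inactive_stays_inactive[OF u]) blast
  have "\<exists>w'\<in>tangent_cone s \<xi> q \<omega> y. norm (w' - w) \<le> \<epsilon>" if y: "y \<in> U" "dist y u < min d1 d2" for y
  proof -
    have "\<kappa> y \<le> \<eta>" using d1(2)[of y] y(2) by simp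
    then have small: "norm (E y v) \<le> \<eta> * norm v" for v
      using E_le[of y v] mult_right_mono[of "\<kappa> y" \<eta> "norm v"] by force
    have lin: "linear (\<lambda>v. v + E y v)" using linE by (intro linear_compose_add linear_ident)
    have half: "norm (E y v) \<le> norm v / 2" for v
      using small[of v] mult_right_mono[OF \<eta>(2), of "norm v"] by simp
    have "inj (\<lambda>v. v + E y v)"
      unfolding linear_injective_0[OF lin]
    proof (intro allI impI)
      fix v assume "v + E y v = 0"
      then have "v = - E y v" by (simp add: eq_neg_iff_add_eq_0)
      then have "norm v = norm (E y v)" by (metis norm_minus_cancel)
      then show "v = 0" using half[of v] by simp
    qed
    then obtain w' where w': "w = w' + E y w'"
      using linear_injective_imp_surjective[OF lin] by (metis surjD)
    have "norm w' \<le> norm w + norm (E y w')"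
      using norm_triangle_ineq4[of w "E y w'"] by (simp add: w')
    then have "norm w' \<le> 2 * norm w" using half[of w'] by simp
    then have "\<eta> * norm w' \<le> \<eta> * (2 * norm w)" using \<eta>(1) by (intro mult_left_mono) auto
    moreover have "norm (w' - w) = norm (E y w')" by (simp add: w')
    ultimately have near: "norm (w' - w) \<le> \<epsilon>" using small[of w'] \<eta>w by linarith
    have same: "grad (constr k) y \<bullet> w' = grad (constr k) u \<bullet> w" if "k \<in> active_index u" for k
      using E_dual[OF that, of y w'] by (simp add: w' inner_add_right inner_diff_left)
    have "active_set q \<omega> y \<subseteq> active_set q \<omega> u"
      using d2(2)[of y] y(2) by (fastforce simp: active_set_def)
    then have "w' \<in> tangent_cone s \<xi> q \<omega> y"
      using w unfolding tangent_cone_constr by (auto simp: same active_index_def)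
    then show ?thesis using near by blast
  qed
  then show "\<exists>d>0. \<forall>y\<in>U. dist y u < d \<longrightarrow> (\<exists>w'\<in>tangent_cone s \<xi> q \<omega> y. norm (w' - w) \<le> \<epsilon>)"
    using d1(1) d2(1) by (intro exI[of _ "min d1 d2"]) auto
qed

text \<open>The map \<open>G\<close>, built from vectors dual to the active gradients, straightens the active constraints near \<open>u\<close>: they become
the linear functionals given by their gradients.  Since \<open>G\<close> has the identity as derivative at \<open>u\<close>, Sussmann's open
mapping theorem solves \<open>G y = t *\<^sub>R w\<close> with \<open>y\<close> near \<open>u\<close>, and the solution is feasible and close to \<open>u + t *\<^sub>R w\<close>.\<close>

lemma tangent_cone_subset_contingent_cone:
  assumes u: "u \<in> U"
  shows "tangent_cone s \<xi> q \<omega> u \<subseteq> contingent_cone U u"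
proof
  fix w assume w: "w \<in> tangent_cone s \<xi> q \<omega> u"
  obtain e where e: "\<And>k m. k \<in> active_index u \<Longrightarrow> m \<in> active_index u \<Longrightarrow> grad (constr k) u \<bullet> e m = (if k = m then 1 else 0)"
    by (rule dual_gradients[OF u]) blast
  define G where "G y = (y - u) + (\<Sum>m\<in>active_index u. (constr m y - grad (constr m) u \<bullet> (y - u)) *\<^sub>R e m)" for y
  have G_dual: "grad (constr k) u \<bullet> G y = constr k y" if k: "k \<in> active_index u" for k y
  proof -
    have "grad (constr k) u \<bullet> (\<Sum>m\<in>active_index u. (constr m y - grad (constr m) u \<bullet> (y - u)) *\<^sub>R e m) =
        (\<Sum>m\<in>active_index u. if k = m then constr m y - grad (constr m) u \<bullet> (y - u) else 0)"
      unfolding inner_sum_right by (intro sum.cong) (auto simp: e[OF k])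
    also have "\<dots> = constr k y - grad (constr k) u \<bullet> (y - u)"
      using k finite_active_index by (simp add: sum.delta')
    finally show ?thesis by (simp add: G_def inner_add_right)
  qed
  have contG: "continuous_on UNIV G"
    unfolding G_def by (intro continuous_intros C1_continuous C1_constr)
  have Gu: "G u = 0" using constr_zero[OF u] by (simp add: G_def)
  have derG: "(G has_derivative (\<lambda>h. h)) (at u)"
  proof -
    have d: "((\<lambda>y. (constr m y - grad (constr m) u \<bullet> (y - u)) *\<^sub>R e m) has_derivative (\<lambda>h. 0)) (at u)"
      if "m \<in> active_index u" for m
      by (rule has_derivative_eq_rhs) (auto intro!: derivative_eq_intros C1_has_derivative_grad[OF C1_constr[OF that]])
    have "(G has_derivative (\<lambda>h. h + (\<Sum>m\<in>active_index u. 0))) (at u)"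
      unfolding G_def using d by (intro has_derivative_add has_derivative_sum) (auto intro!: derivative_eq_intros)
    then show ?thesis by simp
  qed
  show "w \<in> contingent_cone U u"
    unfolding contingent_cone_def
  proof (intro CollectI allI impI)
    fix \<epsilon> :: real assume \<epsilon>: "0 < \<epsilon>"
    obtain \<eta> where \<eta>: "0 < \<eta>" "\<eta> \<le> 1 / 2" and \<eta>w: "\<eta> * (2 * norm w) \<le> \<epsilon>"
      using small_positive[of "1 / 2" "1 / 2" \<epsilon> "2 * norm w"] \<epsilon> by auto
    obtain d1 where d1: "0 < d1" "\<And>y. norm (y - u) < d1 \<Longrightarrow> norm (G y - G u - (y - u)) \<le> \<eta> * norm (y - u)"
      using derG \<eta>(1) unfolding has_derivative_at_alt by blast
    obtain d2 where d2: "0 < d2" "\<And>y j. dist y u < d2 \<Longrightarrow> j < q \<Longrightarrow> j \<notin> active_set q \<omega> u \<Longrightarrow> \<omega> j y < 0"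
      by (rule inactive_stays_inactive[OF u]) blast
    define r where "r = min d1 d2"
    have r: "0 < r" using d1 d2 by (simp add: r_def)
    have "G u \<in> interior (G ` ball u r)"
      by (rule sussmann_open_mapping[OF open_UNIV contG UNIV_I derG, of "\<lambda>h. h"])
        (use r in \<open>auto simp: fun_eq_iff bounded_linear_ident\<close>)
    then obtain \<rho> where \<rho>: "0 < \<rho>" "ball 0 \<rho> \<subseteq> G ` ball u r"
      unfolding Gu mem_interior by blast
    have nw: "0 < norm w + 1" by (simp add: add_nonneg_pos)
    have "0 < min \<epsilon> (\<rho> / (norm w + 1))" using \<epsilon> \<rho>(1) nw by simp
    then obtain t where "0 < t" "t < min \<epsilon> (\<rho> / (norm w + 1))" using dense by blast
    then have t: "0 < t" "t < \<epsilon>" "t < \<rho> / (norm w + 1)" by auto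
    have "norm (t *\<^sub>R w) < \<rho>"
    proof -
      have "norm (t *\<^sub>R w) \<le> t * (norm w + 1)" using t(1) by simp
      also have "\<dots> < \<rho>" using t(3) nw by (simp add: pos_less_divide_eq)
      finally show ?thesis .
    qed
    then have "t *\<^sub>R w \<in> ball 0 \<rho>" by (simp add: dist_norm)
    then have "t *\<^sub>R w \<in> G ` ball u r" using \<rho>(2) by (rule subsetD[rotated])
    then obtain y where y: "y \<in> ball u r" "G y = t *\<^sub>R w" by (metis imageE)
    have yr: "norm (y - u) < d1" "dist y u < d2" using y(1) by (simp_all add: r_def dist_norm norm_minus_commute)
    have close: "norm (y - u - t *\<^sub>R w) \<le> \<eta> * norm (y - u)"
      using d1(2)[OF yr(1)] by (simp add: Gu y(2) norm_minus_commute)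
    have constr_y: "constr k y = t * (grad (constr k) u \<bullet> w)" if "k \<in> active_index u" for k
      using G_dual[OF that, of y] by (simp add: y(2))
    have "y \<in> U"
      unfolding constraint_set_def
    proof (intro CollectI conjI allI impI)
      fix i assume "i < s"
      then show "\<xi> i y = 0" using constr_y[of "Inl i"] w unfolding tangent_cone_constr by (simp add: active_index_def constr_def)
    next
      fix j assume j: "j < q"
      show "\<omega> j y \<le> 0"
      proof (cases "j \<in> active_set q \<omega> u")
        case True
        then have "\<omega> j y = t * (grad (constr (Inr j)) u \<bullet> w)" using constr_y[of "Inr j"] by (simp add: active_index_def constr_def)
        then show ?thesis using w True t(1) unfolding tangent_cone_constr by (simp add: mult_nonneg_nonpos)
      next
        case False
        then show ?thesis using d2(2)[OF yr(2) j] by simp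
      qed
    qed
    moreover have "norm (y - u - t *\<^sub>R w) \<le> \<epsilon> * t"
    proof -
      have "norm (y - u) \<le> norm (y - u - t *\<^sub>R w) + norm (t *\<^sub>R w)"
        using norm_triangle_ineq[of "y - u - t *\<^sub>R w" "t *\<^sub>R w"] by simp
      moreover have "\<eta> * norm (y - u) \<le> 1 / 2 * norm (y - u)" using \<eta>(2) by (intro mult_right_mono) auto
      ultimately have "norm (y - u) \<le> 2 * (t * norm w)" using close t(1) by simp
      then have "\<eta> * norm (y - u) \<le> \<eta> * (2 * (t * norm w))" using \<eta>(1) by (intro mult_left_mono) auto
      also have "\<dots> = t * (\<eta> * (2 * norm w))" by simp
      also have "\<dots> \<le> t * \<epsilon>" using \<eta>w t(1) by (intro mult_left_mono) auto
      finally show ?thesis using close by (simp add: mult.commute)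
    qed
    ultimately show "\<exists>s>0. s < \<epsilon> \<and> (\<exists>y\<in>U. norm (y - u - s *\<^sub>R w) \<le> \<epsilon> * s)"
      using t by blast
  qed
qed

lemma contingent_cone_subset_tangent_cone:
  assumes u: "u \<in> U"
  shows "contingent_cone U u \<subseteq> tangent_cone s \<xi> q \<omega> u"
proof
  fix w assume w: "w \<in> contingent_cone U u"
  have le: "grad (constr k) u \<bullet> w \<le> 0" if k: "k \<in> active_index u" for k
  proof -
    have "((\<lambda>y. - constr k y) has_derivative (\<lambda>h. - (grad (constr k) u \<bullet> h))) (at u)"
      by (intro has_derivative_minus C1_has_derivative_grad C1_constr[OF k])
    from local_minimizer_derivative_nonneg[OF this zero_less_one _ w]
    have "0 \<le> - (grad (constr k) u \<bullet> w)"
      using constr_zero[OF u k] k by (auto simp: constraint_set_def constr_def active_index_def active_set_def)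
    then show ?thesis by simp
  qed
  have ge: "0 \<le> grad (constr k) u \<bullet> w" if k: "k \<in> Inl ` {..<s}" for k
  proof (rule local_minimizer_derivative_nonneg[OF _ zero_less_one _ w])
    show "(constr k has_derivative (\<lambda>h. grad (constr k) u \<bullet> h)) (at u)"
      using k by (intro C1_has_derivative_grad C1_constr[of k u]) (auto simp: active_index_def)
  qed (use k u in \<open>auto simp: constraint_set_def constr_def\<close>)
  show "w \<in> tangent_cone s \<xi> q \<omega> u"
    unfolding tangent_cone_constr using le ge by (auto simp: active_index_def intro: antisym)
qed

lemma contingent_cone_eq: "u \<in> U \<Longrightarrow> contingent_cone U u = tangent_cone s \<xi> q \<omega> u"
  using contingent_cone_subset_tangent_cone tangent_cone_subset_contingent_cone by blast

lemma closed_U: "closed U"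
proof -
  have "U = (\<Inter>i<s. {u. \<xi> i u = 0}) \<inter> (\<Inter>j<q. {u. \<omega> j u \<le> 0})"
    by (auto simp: constraint_set_def)
  also have "closed \<dots>"
    using regular unfolding regular_constraints_def
    by (intro closed_Int closed_INT ballI closed_Collect_eq closed_Collect_le C1_continuous continuous_on_const) auto
  finally show ?thesis .
qed

end

section \<open>The state space as a product\<close>

lemma contingent_cone_UNIV_Times:
  "contingent_cone (UNIV \<times> U) (x, u) = (UNIV :: 'a::real_normed_vector set) \<times> contingent_cone U u"
proof (intro set_eqI iffI)
  fix v assume v: "v \<in> contingent_cone (UNIV \<times> U) (x, u)"
  have "snd v \<in> contingent_cone U u"
    unfolding contingent_cone_def
  proof (intro CollectI allI impI)
    fix e :: real assume "0 < e"
    then obtain s y where s: "0 < s" "s < e" "y \<in> UNIV \<times> U" "norm (y - (x, u) - s *\<^sub>R v) \<le> e * s"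
      using v unfolding contingent_cone_def by blast
    define p where "p = y - (x, u) - s *\<^sub>R v"
    have "norm (snd p) \<le> norm p" using norm_snd_le[of "snd p" "fst p"] by simp
    then have "norm (snd y - u - s *\<^sub>R snd v) \<le> norm (y - (x, u) - s *\<^sub>R v)" by (simp add: p_def)
    then show "\<exists>s>0. s < e \<and> (\<exists>y\<in>U. norm (y - u - s *\<^sub>R snd v) \<le> e * s)"
      using s by (intro exI[of _ s]) (auto intro!: bexI[of _ "snd y"])
  qed
  then show "v \<in> UNIV \<times> contingent_cone U u" by (simp add: mem_Times_iff)
next
  fix v :: "'a \<times> 'b" assume v: "v \<in> UNIV \<times> contingent_cone U u"
  show "v \<in> contingent_cone (UNIV \<times> U) (x, u)"
    unfolding contingent_cone_def
  proof (intro CollectI allI impI)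
    fix e :: real assume "0 < e"
    then obtain s y where s: "0 < s" "s < e" "y \<in> U" "norm (y - u - s *\<^sub>R snd v) \<le> e * s"
      using v unfolding contingent_cone_def by (auto simp: mem_Times_iff)
    have "(x + s *\<^sub>R fst v, y) - (x, u) - s *\<^sub>R v = (0, y - u - s *\<^sub>R snd v)"
      by (simp add: prod_eq_iff)
    then have "norm ((x + s *\<^sub>R fst v, y) - (x, u) - s *\<^sub>R v) \<le> e * s" using s(4) by (simp add: norm_Pair)
    then show "\<exists>s>0. s < e \<and> (\<exists>y\<in>UNIV \<times> U. norm (y - (x, u) - s *\<^sub>R v) \<le> e * s)"
      using s by (intro exI[of _ s] conjI bexI[of _ "(x + s *\<^sub>R fst v, y)"]) auto
  qed
qed

lemma inner_semicontinuous_on_UNIV_Times: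
  assumes "inner_semicontinuous_on U (contingent_cone U)"
  shows "inner_semicontinuous_on (UNIV \<times> U) (contingent_cone ((UNIV :: 'a::real_normed_vector set) \<times> U))"
  unfolding inner_semicontinuous_on_def
proof (intro ballI allI impI)
  fix z w and e :: real
  assume z: "z \<in> (UNIV :: 'a set) \<times> U" and w: "w \<in> contingent_cone (UNIV \<times> U) z" and e: "0 < e"
  have zu: "snd z \<in> U" "snd w \<in> contingent_cone U (snd z)"
    using z w contingent_cone_UNIV_Times[of U "fst z" "snd z"] by (auto simp: mem_Times_iff)
  obtain d where d: "0 < d"
      "\<forall>y\<in>U. dist y (snd z) < d \<longrightarrow> (\<exists>w'\<in>contingent_cone U y. norm (w' - snd w) \<le> e)"
    using assms zu e unfolding inner_semicontinuous_on_def by blast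
  show "\<exists>d>0. \<forall>y\<in>UNIV \<times> U. dist y z < d \<longrightarrow> (\<exists>w'\<in>contingent_cone (UNIV \<times> U) y. norm (w' - w) \<le> e)"
  proof (intro exI[of _ d] conjI ballI impI d(1))
    fix y assume y: "y \<in> (UNIV :: 'a set) \<times> U" "dist y z < d"
    then obtain w' where w': "w' \<in> contingent_cone U (snd y)" "norm (w' - snd w) \<le> e"
      using d(2) dist_snd_le[of y z] by (auto simp: mem_Times_iff intro: le_less_trans)
    have "(fst w, w') - w = (0, w' - snd w)" by (simp add: prod_eq_iff)
    then have "norm ((fst w, w') - w) \<le> e" using w'(2) by (simp add: norm_Pair)
    moreover have "(fst w, w') \<in> contingent_cone (UNIV \<times> U) y"
      using w'(1) contingent_cone_UNIV_Times[of U "fst y" "snd y"] by simp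
    ultimately show "\<exists>w'\<in>contingent_cone (UNIV \<times> U) y. norm (w' - w) \<le> e" by blast
  qed
qed

lemma closest_point_UNIV_Times:
  fixes x :: "'a::euclidean_space" and v :: "'b::euclidean_space"
  assumes T: "convex T" "closed T" "T \<noteq> {}"
  shows "closest_point (UNIV \<times> T) (x, v) = (x, closest_point T v)"
proof (rule closest_point_unique[symmetric])
  show "convex ((UNIV :: 'a set) \<times> T)" "closed ((UNIV :: 'a set) \<times> T)"
    using T by (auto intro: convex_Times closed_Times)
  show "(x, closest_point T v) \<in> UNIV \<times> T" using closest_point_in_set[OF T(2,3)] by simp
  show "\<forall>z\<in>UNIV \<times> T. dist (x, v) (x, closest_point T v) \<le> dist (x, v) z"
  proof
    fix z :: "'a \<times> 'b" assume "z \<in> UNIV \<times> T"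
    then have "snd z \<in> T" by (auto simp: mem_Times_iff)
    then have "dist v (closest_point T v) \<le> dist v (snd z)" using closest_point_le[OF T(2)] by blast
    also have "\<dots> \<le> dist (x, v) z" using dist_snd_le[of "(x, v)" z] by simp
    finally show "dist (x, v) (x, closest_point T v) \<le> dist (x, v) z" by (simp add: dist_Pair_Pair)
  qed
qed

lemma tangent_proj_eq_closest_point:
  fixes u v :: "real ^ 'p"
  assumes T: "closed (tangent_cone s \<xi> q \<omega> u)"
  shows "tangent_proj s \<xi> q \<omega> u v = closest_point (tangent_cone s \<xi> q \<omega> u) v"
proof -
  let ?T = "tangent_cone s \<xi> q \<omega> u" and ?p = "tangent_proj s \<xi> q \<omega> u v"
  have "0 \<in> ?T" by (simp add: tangent_cone_def)
  then have c: "closest_point ?T v \<in> ?T" "\<forall>w\<in>?T. dist v (closest_point ?T v) \<le> dist v w"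
    using closest_point_exists[OF T] by blast+
  have iff: "(norm (v - a))\<^sup>2 < (norm (v - b))\<^sup>2 \<longleftrightarrow> dist v a < dist v b" for a b :: "real ^ 'p"
    by (simp add: dist_norm flip: not_le)
  have "is_arg_min (\<lambda>w. (norm (v - w))\<^sup>2) (\<lambda>w. w \<in> ?T) (closest_point ?T v)"
    unfolding is_arg_min_def iff using c by (auto simp: not_less)
  then have "is_arg_min (\<lambda>w. (norm (v - w))\<^sup>2) (\<lambda>w. w \<in> ?T) ?p"
    unfolding tangent_proj_def arg_min_on_def arg_min_def by (rule someI)
  then have "?p \<in> ?T" "\<forall>w\<in>?T. dist v ?p \<le> dist v w"
    unfolding is_arg_min_def iff by (auto simp: not_less)
  then show ?thesis by (rule closest_point_unique[OF convex_tangent_cone T])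
qed

section \<open>The feedback loop\<close>

text \<open>The operator \<open>HT h u\<close> is the adjoint of the derivative of \<open>u \<mapsto> (h u, u)\<close>, so it maps gradients of \<open>\<Phi>\<close> on
the graph of \<open>h\<close> to gradients of the reduced cost.\<close>

lemma HT_inner:
  fixes h :: "real ^ 'p \<Rightarrow> real ^ 'n"
  assumes h: "(h has_derivative h') (at u)"
  shows "HT h u v \<bullet> w = fst v \<bullet> h' w + snd v \<bullet> w"
proof -
  have "frechet_derivative h (at u) = h'" using frechet_derivative_at[OF h] by simp
  then have "jacobian h (at u) *v w = h' w"
    using matrix_works[of h' w] h has_derivative_linear unfolding jacobian_def by auto
  then show ?thesis
    by (simp add: HT_def inner_add_left transpose_matrix_vector dot_lmul_matrix)
qed

text \<open>The smaller eigenvalue of a positive definite symmetric matrix of order two is at least determinant over trace, which is the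
witness.\<close>

lemma dissipation_quadratic:
  fixes A B L :: real
  assumes AB: "0 < A" "0 < B" "L\<^sup>2 < A * B"
  obtains k where "0 < k" "\<And>r w. - A * w\<^sup>2 + 2 * L * r * w - B * r\<^sup>2 \<le> - k * (r\<^sup>2 + w\<^sup>2)"
proof -
  define k where "k = (A * B - L\<^sup>2) / (A + B)"
  have k: "0 < k" using AB by (simp add: k_def)
  have kAB: "k * (A + B) = A * B - L\<^sup>2" using AB by (simp add: k_def)
  have "k * (A + B) \<le> A * B" unfolding kAB by simp
  also have "\<dots> < A * (A + B)" using AB by (simp add: distrib_left)
  finally have kA: "k < A" using AB by (simp add: mult_less_cancel_right)
  have det: "L\<^sup>2 \<le> (A - k) * (B - k)"
  proof -
    have "(A - k) * (B - k) = A * B - k * (A + B) + k\<^sup>2" by (simp add: algebra_simps power2_eq_square)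
    then show ?thesis unfolding kAB by simp
  qed
  have "- A * w\<^sup>2 + 2 * L * r * w - B * r\<^sup>2 \<le> - k * (r\<^sup>2 + w\<^sup>2)" for r w
  proof -
    have "0 \<le> ((A - k) * w - L * r)\<^sup>2 + ((A - k) * (B - k) - L\<^sup>2) * r\<^sup>2"
      using det by simp
    also have "\<dots> = (A - k) * ((A - k) * w\<^sup>2 - 2 * L * r * w + (B - k) * r\<^sup>2)"
      by (simp add: power2_eq_square algebra_simps)
    finally have "0 \<le> (A - k) * w\<^sup>2 - 2 * L * r * w + (B - k) * r\<^sup>2"
      using kA by (simp add: zero_le_mult_iff)
    then show ?thesis by (simp add: algebra_simps)
  qed
  with k show ?thesis by (rule that)
qed

lemma partial_gradients:
  fixes W :: "'a::euclidean_space \<times> 'b::euclidean_space \<Rightarrow> real"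
  assumes W: "(W has_derivative W') (at (x, u))"
  shows "W' (a, b) = grad_x W (x, u) \<bullet> a + grad_u W (x, u) \<bullet> b"
proof -
  have "((\<lambda>y. (y, u)) has_derivative (\<lambda>a. (a, 0))) (at x)"
    by (intro has_derivative_Pair has_derivative_ident has_derivative_const)
  from has_derivative_compose[OF this, of W W'] W
  have "((\<lambda>y. W (y, u)) has_derivative (\<lambda>a. W' (a, 0))) (at x)" by simp
  from has_derivative_grad[OF this] have 1: "W' (a, 0) = grad_x W (x, u) \<bullet> a"
    by (simp add: grad_x_def fun_eq_iff)
  have "((\<lambda>v. (x, v)) has_derivative (\<lambda>b. (0, b))) (at u)"
    by (intro has_derivative_Pair has_derivative_ident has_derivative_const)
  from has_derivative_compose[OF this, of W W'] W
  have "((\<lambda>v. W (x, v)) has_derivative (\<lambda>b. W' (0, b))) (at u)" by simp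
  from has_derivative_grad[OF this] have 2: "W' (0, b) = grad_u W (x, u) \<bullet> b"
    by (simp add: grad_u_def fun_eq_iff)
  have "linear W'" using W has_derivative_linear by blast
  then have "W' (a, b) = W' (a, 0) + W' (0, b)" using linear_add[of W' "(a, 0)" "(0, b)"] by simp
  then show ?thesis using 1 2 by simp
qed

locale feedback_loop = regular_constraint_set s q \<xi> \<omega>
  for s q :: nat and \<xi> \<omega> :: "nat \<Rightarrow> real ^ 'p \<Rightarrow> real" +
  fixes f :: "(real ^ 'n) \<times> (real ^ 'p) \<Rightarrow> real ^ 'n"
    and h :: "real ^ 'p \<Rightarrow> real ^ 'n"
    and \<Phi> W :: "(real ^ 'n) \<times> (real ^ 'p) \<Rightarrow> real"
    and lx L \<alpha> \<beta> \<gamma> \<zeta> \<epsilon> :: real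
  assumes C1_f: "C1 f" and C1_h: "C1 h" and C1_\<Phi>: "C1 \<Phi>"
    and f_lipschitz: "\<And>u. u \<in> U \<Longrightarrow> lx-lipschitz_on UNIV (\<lambda>x. f (x, u))"
    and f_steady: "\<And>u. u \<in> U \<Longrightarrow> f (h u, u) = 0"
    and L: "0 < L" "\<And>x x' u. u \<in> U \<Longrightarrow>
         norm (HT h u (grad \<Phi> (x', u) - grad \<Phi> (x, u))) \<le> L * norm (x' - x)"
    and Lyapunov: "plant_Lyapunov U f h W \<alpha> \<beta> \<gamma> \<zeta>"
    and level_sets: "compact_level_sets (\<lambda>u. \<Phi> (h u, u))"
    and eps: "0 < \<epsilon>" "\<epsilon> < \<gamma> / (\<zeta> * L)"
begin

abbreviation "Dh u \<equiv> frechet_derivative h (at u)"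

definition drive :: "(real ^ 'n) \<times> (real ^ 'p) \<Rightarrow> (real ^ 'n) \<times> (real ^ 'p)" where
  "drive z = (f z, - \<epsilon> *\<^sub>R HT h (snd z) (grad \<Phi> z))"

text \<open>The weight \<open>L / \<zeta>\<close> makes the two cross terms in the dissipation equal, which is what allows the full range of step sizes
\<open>\<epsilon>\<close>.\<close>

definition V :: "(real ^ 'n) \<times> (real ^ 'p) \<Rightarrow> real" where
  "V z = \<Phi> (h (snd z), snd z) + (L / \<zeta>) * W z"

definition V' :: "(real ^ 'n) \<times> (real ^ 'p) \<Rightarrow> (real ^ 'n) \<times> (real ^ 'p) \<Rightarrow> real" where
  "V' z v = HT h (snd z) (grad \<Phi> (h (snd z), snd z)) \<bullet> snd v
     + (L / \<zeta>) * (grad_x W z \<bullet> fst v + grad_u W z \<bullet> snd v)"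

lemma Lyapunov_pos: "0 < \<alpha>" "0 < \<gamma>" "0 < \<zeta>"
  using Lyapunov unfolding plant_Lyapunov_def by auto

lemma Lyapunov_bounds:
  assumes "u \<in> U"
  shows "\<alpha> * (norm (x - h u))\<^sup>2 \<le> W (x, u)" "W (x, u) \<le> \<beta> * (norm (x - h u))\<^sup>2"
    "grad_x W (x, u) \<bullet> f (x, u) \<le> - \<gamma> * (norm (x - h u))\<^sup>2"
    "norm (grad_u W (x, u)) \<le> \<zeta> * norm (x - h u)"
  using Lyapunov assms unfolding plant_Lyapunov_def by auto

lemma h_derivative: "(h has_derivative Dh u) (at u)"
  using C1_h unfolding C1_def by (metis frechet_derivative_at)

lemma continuous_Dh: "continuous_on UNIV (\<lambda>u. Dh u b)"
proof -
  obtain H where H: "\<And>x. (h has_derivative blinfun_apply (H x)) (at x)" "continuous_on UNIV H"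
    using C1_h unfolding C1_def by blast
  have "Dh u = blinfun_apply (H u)" for u using frechet_derivative_at[OF H(1)] by metis
  then show ?thesis using H(2) by (simp add: continuous_intros)
qed

lemma HT_diff: "HT h u (a - b) = HT h u a - HT h u b"
  by (rule vector_eq_rdot[THEN iffD1]) (simp add: HT_inner[OF h_derivative] inner_diff_left)

lemma continuous_drive: "continuous_on UNIV drive"
proof -
  have "continuous_on UNIV (\<lambda>z. HT h (snd z) (grad \<Phi> z) \<bullet> b)" for b
    unfolding HT_inner[OF h_derivative]
    by (intro continuous_intros C1_continuous_grad[OF C1_\<Phi>]
        continuous_on_compose2[OF continuous_Dh continuous_on_snd[OF continuous_on_id]]) auto
  then have "continuous_on UNIV (\<lambda>z. HT h (snd z) (grad \<Phi> z))"
    by (subst continuous_on_componentwise) simp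
  then show ?thesis
    unfolding drive_def using C1_continuous[OF C1_f, of UNIV]
    by (intro continuous_on_Pair continuous_on_scaleR continuous_on_const) simp_all
qed

lemma product_cone:
  "u \<in> U \<Longrightarrow> contingent_cone (UNIV \<times> U) (x, u) = UNIV \<times> tangent_cone s \<xi> q \<omega> u"
  by (simp add: contingent_cone_UNIV_Times contingent_cone_eq)

lemma closed_tangent_cone: "u \<in> U \<Longrightarrow> closed (tangent_cone s \<xi> q \<omega> u)"
  using closed_contingent_cone[of U u] by (simp add: contingent_cone_eq)

sublocale projected_system "UNIV \<times> U" drive
proof
  show "closed ((UNIV :: (real ^ 'n) set) \<times> U)" by (intro closed_Times closed_UNIV closed_U)
  show "continuous_on UNIV drive" by (rule continuous_drive)
  show "convex (contingent_cone (UNIV \<times> U) z)" if "z \<in> (UNIV :: (real ^ 'n) set) \<times> U" for z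
    using that by (cases z) (auto simp: product_cone intro: convex_Times convex_tangent_cone)
  have "inner_semicontinuous_on U (contingent_cone U)"
    using inner_semicontinuous_tangent_cone unfolding inner_semicontinuous_on_def
    by (simp add: contingent_cone_eq cong: bex_cong)
  then show "inner_semicontinuous_on ((UNIV :: (real ^ 'n) set) \<times> U) (contingent_cone (UNIV \<times> U))"
    by (rule inner_semicontinuous_on_UNIV_Times)
qed

lemma field_eq:
  assumes u: "u \<in> U"
  shows "field (x, u) = feedback_system s \<xi> q \<omega> f h \<Phi> \<epsilon> (x, u)"
proof -
  have "0 \<in> tangent_cone s \<xi> q \<omega> u" by (simp add: tangent_cone_def)
  then show ?thesis
    unfolding field_def feedback_system_def drive_def product_cone[OF u]
    using closest_point_UNIV_Times[OF convex_tangent_cone closed_tangent_cone[OF u]]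
    by (auto simp: tangent_proj_eq_closest_point[OF closed_tangent_cone[OF u]])
qed

lemma V_has_derivative: "(V has_derivative V' z) (at z)"
proof -
  obtain x u where z: "z = (x, u)" by fastforce
  have "W differentiable (at z)" using Lyapunov unfolding plant_Lyapunov_def by blast
  then obtain W' where W': "(W has_derivative W') (at z)" unfolding differentiable_def by blast
  have W'eq: "W' v = grad_x W z \<bullet> fst v + grad_u W z \<bullet> snd v" for v
    using partial_gradients[OF W'[unfolded z], of "fst v" "snd v"] by (simp add: z)
  have hd: "((\<lambda>z. h (snd z)) has_derivative (\<lambda>v. Dh (snd z) (snd v))) (at z)"
    by (rule has_derivative_compose[OF has_derivative_snd[OF has_derivative_ident] h_derivative])
  have "((\<lambda>z. (h (snd z), snd z)) has_derivative (\<lambda>v. (Dh (snd z) (snd v), snd v))) (at z)"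
    by (intro has_derivative_Pair hd has_derivative_snd has_derivative_ident)
  from has_derivative_compose[OF this C1_has_derivative_grad[OF C1_\<Phi>]]
  have "((\<lambda>z. \<Phi> (h (snd z), snd z)) has_derivative
      (\<lambda>v. grad \<Phi> (h (snd z), snd z) \<bullet> (Dh (snd z) (snd v), snd v))) (at z)" .
  then have "(V has_derivative (\<lambda>v. grad \<Phi> (h (snd z), snd z) \<bullet> (Dh (snd z) (snd v), snd v) + (L / \<zeta>) * W' v)) (at z)"
    unfolding V_def using W' by (intro has_derivative_add has_derivative_mult_right)
  moreover have "V' z = (\<lambda>v. grad \<Phi> (h (snd z), snd z) \<bullet> (Dh (snd z) (snd v), snd v) + (L / \<zeta>) * W' v)"
    by (simp add: V'_def HT_inner[OF h_derivative] W'eq inner_prod_def fun_eq_iff)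
  ultimately show ?thesis by simp
qed

lemma norm_f_le:
  assumes u: "u \<in> U"
  shows "norm (f (x, u)) \<le> lx * norm (x - h u)"
  using lipschitz_onD[OF f_lipschitz[OF u], of x "h u"] f_steady[OF u] by (simp add: dist_norm)

lemma V_dissipation_pointwise:
  fixes x :: "real ^ 'n"
  assumes u: "u \<in> U"
  defines "w \<equiv> snd (field (x, u))" and "r \<equiv> norm (x - h u)"
  shows "V' (x, u) (field (x, u)) \<le>
    - (1 / \<epsilon>) * (norm w)\<^sup>2 + 2 * L * r * norm w - (L * \<gamma> / \<zeta>) * r\<^sup>2"
proof -
  have z: "(x, u) \<in> UNIV \<times> U" using u by simp
  have fst_field: "fst (field (x, u)) = f (x, u)" by (simp add: field_eq[OF u] feedback_system_def)
  define p where "p = HT h u (grad \<Phi> (x, u))"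
  define p0 where "p0 = HT h u (grad \<Phi> (h u, u))"
  have "(- \<epsilon> *\<^sub>R p - w) \<bullet> w = 0"
    using field_orthogonal[OF z] fst_field by (simp add: inner_prod_def drive_def p_def w_def)
  then have "- \<epsilon> * (p \<bullet> w) = (norm w)\<^sup>2" by (simp add: inner_diff_left power2_norm_eq_inner)
  then have pw: "p \<bullet> w = - (1 / \<epsilon>) * (norm w)\<^sup>2" using eps(1) by (simp add: field_simps)
  have "norm (p0 - p) \<le> L * r"
    using L(2)[OF u, of "h u" x] by (simp add: p_def p0_def HT_diff r_def norm_minus_commute)
  then have "norm (p0 - p) * norm w \<le> L * r * norm w" by (intro mult_right_mono) auto
  then have "(p0 - p) \<bullet> w \<le> L * r * norm w" using norm_cauchy_schwarz order_trans by blast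
  then have 1: "p0 \<bullet> w \<le> - (1 / \<epsilon>) * (norm w)\<^sup>2 + L * r * norm w"
    using pw by (simp add: inner_diff_left)
  have "norm (grad_u W (x, u)) * norm w \<le> \<zeta> * r * norm w"
    using Lyapunov_bounds(4)[OF u, of x] by (intro mult_right_mono) (auto simp: r_def)
  then have "grad_u W (x, u) \<bullet> w \<le> \<zeta> * r * norm w" using norm_cauchy_schwarz order_trans by blast
  then have "grad_x W (x, u) \<bullet> f (x, u) + grad_u W (x, u) \<bullet> w \<le> - \<gamma> * r\<^sup>2 + \<zeta> * r * norm w"
    using Lyapunov_bounds(3)[OF u, of x] by (simp add: r_def)
  then have "(L / \<zeta>) * (grad_x W (x, u) \<bullet> f (x, u) + grad_u W (x, u) \<bullet> w)
      \<le> (L / \<zeta>) * (- \<gamma> * r\<^sup>2 + \<zeta> * r * norm w)"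
    using L(1) Lyapunov_pos by (intro mult_left_mono) auto
  also have "\<dots> = - (L * \<gamma> / \<zeta>) * r\<^sup>2 + L * r * norm w"
    using Lyapunov_pos(3) by (simp add: field_simps)
  finally have 2: "(L / \<zeta>) * (grad_x W (x, u) \<bullet> f (x, u) + grad_u W (x, u) \<bullet> w)
      \<le> - (L * \<gamma> / \<zeta>) * r\<^sup>2 + L * r * norm w" .
  have "V' (x, u) (field (x, u)) =
      p0 \<bullet> w + (L / \<zeta>) * (grad_x W (x, u) \<bullet> f (x, u) + grad_u W (x, u) \<bullet> w)"
    by (simp add: V'_def p0_def fst_field w_def)
  then show ?thesis using 1 2 by simp
qed

lemma V_dissipation:
  obtains c where "0 < c" "\<And>z. z \<in> UNIV \<times> U \<Longrightarrow> V' z (field z) \<le> - c * (norm (field z))\<^sup>2"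
proof -
  have AB: "0 < 1 / \<epsilon>" "0 < L * \<gamma> / \<zeta>" using eps(1) L(1) Lyapunov_pos by auto
  have "L * (\<zeta> * L * \<epsilon>) < L * \<gamma>"
    using eps L(1) Lyapunov_pos by (intro mult_strict_left_mono) (simp_all add: pos_less_divide_eq mult.commute mult.left_commute)
  then have "L\<^sup>2 < (1 / \<epsilon>) * (L * \<gamma> / \<zeta>)"
    using eps(1) Lyapunov_pos by (simp add: power2_eq_square pos_less_divide_eq mult.commute mult.left_commute)
  then obtain k where k: "0 < k" "\<And>r w. - (1 / \<epsilon>) * w\<^sup>2 + 2 * L * r * w - (L * \<gamma> / \<zeta>) * r\<^sup>2 \<le> - k * (r\<^sup>2 + w\<^sup>2)"
    using dissipation_quadratic[OF AB, of L] by metis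
  define c where "c = k / (1 + lx\<^sup>2)"
  have pos: "0 < 1 + lx\<^sup>2" by (simp add: add_pos_nonneg)
  have c: "0 < c" "c * (1 + lx\<^sup>2) = k" using k(1) pos by (auto simp: c_def)
  have "V' z (field z) \<le> - c * (norm (field z))\<^sup>2" if zU: "z \<in> UNIV \<times> U" for z
  proof -
    obtain x u where z: "z = (x, u)" "u \<in> U" using zU by auto
    define r where "r = norm (x - h u)"
    define w where "w = snd (field (x, u))"
    have fst_field: "fst (field (x, u)) = f (x, u)" by (simp add: field_eq[OF z(2)] feedback_system_def)
    have "(norm (f (x, u)))\<^sup>2 \<le> (lx * r)\<^sup>2" using norm_f_le[OF z(2), of x] by (simp add: r_def power_mono)
    then have "(norm (field (x, u)))\<^sup>2 \<le> lx\<^sup>2 * r\<^sup>2 + (norm w)\<^sup>2"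
      by (simp add: norm_prod_def fst_field w_def power_mult_distrib)
    also have "\<dots> \<le> (1 + lx\<^sup>2) * (r\<^sup>2 + (norm w)\<^sup>2)" by (simp add: algebra_simps)
    finally have "c * (norm (field (x, u)))\<^sup>2 \<le> c * ((1 + lx\<^sup>2) * (r\<^sup>2 + (norm w)\<^sup>2))"
      using c(1) by (intro mult_left_mono) auto
    also have "\<dots> = k * (r\<^sup>2 + (norm w)\<^sup>2)" by (simp only: mult.assoc[symmetric] c(2))
    finally show ?thesis
      using V_dissipation_pointwise[OF z(2), of x] k(2)[of "norm w" r] by (simp add: z(1) r_def w_def)
  qed
  with c(1) show ?thesis by (rule that)
qed

text \<open>The reduced cost bounds \<open>u\<close>, and being bounded below on the resulting compact set it leaves only a bounded amount of
\<open>V\<close> for \<open>W\<close>, which controls the distance of \<open>x\<close> from \<open>h u\<close>.\<close>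

lemma compact_V_sublevel: "compact {z \<in> UNIV \<times> U. V z \<le> b}"
proof -
  define \<phi> where "\<phi> u = \<Phi> (h u, u)" for u
  define K where "K = {u. \<phi> u \<le> b}"
  have K: "compact K" using level_sets by (simp add: K_def \<phi>_def compact_level_sets_def)
  have cont\<phi>: "continuous_on A \<phi>" for A
    unfolding \<phi>_def
    by (rule continuous_on_compose2[OF C1_continuous[OF C1_\<Phi>, of UNIV]])
      (auto intro!: continuous_intros C1_continuous[OF C1_h])
  have contV: "continuous_on UNIV V"
    using V_has_derivative by (meson continuous_at_imp_continuous_on has_derivative_continuous)
  obtain m where m: "\<And>u. u \<in> K \<Longrightarrow> m \<le> \<phi> u"
  proof (cases "K = {}")
    case False
    then show ?thesis using continuous_attains_inf[OF K False cont\<phi>] that by blast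
  qed (use that in auto)
  have "compact (h ` K)" using K C1_continuous[OF C1_h] by (rule compact_continuous_image[rotated])
  then obtain B where B: "\<And>u. u \<in> K \<Longrightarrow> norm (h u) \<le> B"
    using compact_imp_bounded bounded_iff by (metis image_eqI)
  define R where "R = (b - m) * \<zeta> / (L * \<alpha>)"
  have bound: "fst z \<in> cball 0 (B + (R + 1)) \<and> snd z \<in> K" if z: "z \<in> UNIV \<times> U" "V z \<le> b" for z
  proof -
    obtain x u where xu: "z = (x, u)" "u \<in> U" using z(1) by auto
    have W0: "\<alpha> * (norm (x - h u))\<^sup>2 \<le> W (x, u)" by (rule Lyapunov_bounds(1)[OF xu(2)])
    have Lz: "0 < L / \<zeta>" using L(1) Lyapunov_pos by simp
    have "(L / \<zeta>) * (\<alpha> * (norm (x - h u))\<^sup>2) \<le> (L / \<zeta>) * W (x, u)"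
      using W0 Lz by (intro mult_left_mono) auto
    then have le: "\<phi> u + (L / \<zeta>) * (\<alpha> * (norm (x - h u))\<^sup>2) \<le> b" using z(2) by (simp add: V_def xu \<phi>_def)
    moreover have "0 \<le> (L / \<zeta>) * (\<alpha> * (norm (x - h u))\<^sup>2)"
      using Lz Lyapunov_pos(1) by (intro mult_nonneg_nonneg) auto
    ultimately have uK: "u \<in> K" by (simp add: K_def)
    have "(L / \<zeta>) * (\<alpha> * (norm (x - h u))\<^sup>2) \<le> b - m" using le m[OF uK] by linarith
    then have sq: "(norm (x - h u))\<^sup>2 \<le> R"
      using L(1) Lyapunov_pos by (simp add: R_def field_simps)
    have "norm (x - h u) \<le> R + 1"
    proof (cases "norm (x - h u) \<le> 1")
      case True
      then show ?thesis using sq order_trans[OF zero_le_power2 sq] by linarith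
    next
      case False
      then have "norm (x - h u) * 1 \<le> norm (x - h u) * norm (x - h u)" by (intro mult_left_mono) auto
      then show ?thesis using sq by (simp add: power2_eq_square)
    qed
    then have "norm x \<le> B + (R + 1)" using B[OF uK] norm_triangle_sub[of x "h u"] by linarith
    then show ?thesis using uK by (simp add: xu)
  qed
  have sub: "{z \<in> UNIV \<times> U. V z \<le> b} \<subseteq> cball 0 (B + (R + 1)) \<times> K"
    using bound by (auto simp: mem_Times_iff)
  have cl: "closed {z \<in> UNIV \<times> U. V z \<le> b}"
    by (intro continuous_on_closed_Collect_le continuous_on_subset[OF contV] continuous_on_const closed_S) simp
  have "compact (cball (0 :: real ^ 'n) (B + (R + 1)) \<times> K)" using K by (intro compact_Times compact_cball)
  from compact_Int_closed[OF this cl] show ?thesis using sub by (simp add: Int_absorb1)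
qed

lemma f_zero_iff: "u \<in> U \<Longrightarrow> f (x, u) = 0 \<longleftrightarrow> x = h u"
  using Lyapunov_bounds(3)[of u x] Lyapunov_pos(2) f_steady by (auto simp: zero_le_mult_iff mult_le_0_iff)

text \<open>The Lyapunov inequality excludes plant equilibria off the graph of \<open>h\<close>, and the projection of a vector onto a convex
cone vanishes if and only if the vector lies in the polar cone.\<close>

lemma field_zero_iff:
  assumes u: "u \<in> U"
  shows "field (x, u) = 0 \<longleftrightarrow> x = h u \<and> - HT h u (grad \<Phi> (x, u)) \<in> normal_cone s \<xi> q \<omega> u"
proof -
  let ?T = "tangent_cone s \<xi> q \<omega> u" and ?p = "HT h u (grad \<Phi> (x, u))"
  have z: "(x, u) \<in> UNIV \<times> U" using u by simp
  have eq: "field (x, u) = (f (x, u), closest_point ?T (- \<epsilon> *\<^sub>R ?p))"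
    by (simp add: field_eq[OF u] feedback_system_def tangent_proj_eq_closest_point[OF closed_tangent_cone[OF u]])
  have 0: "0 \<in> ?T" by (simp add: tangent_cone_def)
  have polar: "(\<forall>w\<in>?T. (- \<epsilon> *\<^sub>R ?p) \<bullet> w \<le> 0) \<longleftrightarrow> - ?p \<in> normal_cone s \<xi> q \<omega> u"
    using eps(1) by (auto simp: normal_cone_def inner_commute mult_le_0_iff zero_le_mult_iff)
  have "closest_point ?T (- \<epsilon> *\<^sub>R ?p) = 0 \<longleftrightarrow> (\<forall>w\<in>?T. (- \<epsilon> *\<^sub>R ?p) \<bullet> w \<le> 0)"
  proof
    assume cp: "closest_point ?T (- \<epsilon> *\<^sub>R ?p) = 0"
    show "\<forall>w\<in>?T. (- \<epsilon> *\<^sub>R ?p) \<bullet> w \<le> 0"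
      using closest_point_dot[OF convex_tangent_cone closed_tangent_cone[OF u], of _ "- \<epsilon> *\<^sub>R ?p"] cp by auto
  next
    assume "\<forall>w\<in>?T. (- \<epsilon> *\<^sub>R ?p) \<bullet> w \<le> 0"
    then show "closest_point ?T (- \<epsilon> *\<^sub>R ?p) = 0"
      by (intro closest_point_cone_eqI[OF convex_tangent_cone closed_tangent_cone[OF u] 0]) auto
  qed
  then show ?thesis unfolding eq using polar f_zero_iff[OF u, of x] by (simp add: zero_prod_def)
qed

lemma zeros_eq_critical_points: "{z \<in> UNIV \<times> U. field z = 0} = critical_points s \<xi> q \<omega> h \<Phi>"
  unfolding critical_points_def by (auto simp: field_zero_iff)

lemma V_on_graph: "u \<in> U \<Longrightarrow> V (h u, u) = \<Phi> (h u, u)"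
  using Lyapunov_bounds(1,2)[of u "h u"] by (simp add: V_def)

lemma V_ge: "u \<in> U \<Longrightarrow> \<Phi> (h u, u) \<le> V (x, u)"
  and V_gt: "u \<in> U \<Longrightarrow> x \<noteq> h u \<Longrightarrow> \<Phi> (h u, u) < V (x, u)"
proof -
  assume u: "u \<in> U"
  have Lz: "0 < L / \<zeta>" using L(1) Lyapunov_pos by simp
  have "0 \<le> \<alpha> * (norm (x - h u))\<^sup>2" using Lyapunov_pos by simp
  then have "0 \<le> (L / \<zeta>) * W (x, u)" using Lyapunov_bounds(1)[OF u, of x] Lz by (intro mult_nonneg_nonneg) auto
  then show "\<Phi> (h u, u) \<le> V (x, u)" by (simp add: V_def)
  assume "x \<noteq> h u"
  then have "0 < \<alpha> * (norm (x - h u))\<^sup>2" using Lyapunov_pos by simp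
  then have "0 < (L / \<zeta>) * W (x, u)" using Lyapunov_bounds(1)[OF u, of x] Lz by (intro mult_pos_pos) auto
  then show "\<Phi> (h u, u) < V (x, u)" by (simp add: V_def)
qed

lemma strict_local_minimizer_V_iff:
  assumes u: "u \<in> U"
  shows "strict_local_minimizer V (UNIV \<times> U) (h u, u) \<longleftrightarrow>
    strict_local_minimizer \<Phi> {(x, u). x = h u \<and> u \<in> U} (h u, u)"
proof
  assume "strict_local_minimizer V (UNIV \<times> U) (h u, u)"
  then obtain r where r: "0 < r"
      "\<And>z. z \<in> UNIV \<times> U \<Longrightarrow> z \<noteq> (h u, u) \<Longrightarrow> dist z (h u, u) < r \<Longrightarrow> V (h u, u) < V z"
    unfolding strict_local_minimizer_def by blast
  show "strict_local_minimizer \<Phi> {(x, u). x = h u \<and> u \<in> U} (h u, u)"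
    unfolding strict_local_minimizer_def
  proof (intro conjI exI[of _ r] ballI impI)
    fix z assume z: "z \<in> {(x, u). x = h u \<and> u \<in> U}" "z \<noteq> (h u, u) \<and> dist z (h u, u) < r"
    then obtain v where v: "z = (h v, v)" "v \<in> U" by auto
    then show "\<Phi> (h u, u) < \<Phi> z" using r(2)[of z] z V_on_graph[OF u] V_on_graph[OF v(2)] by simp
  qed (use r u in auto)
next
  assume "strict_local_minimizer \<Phi> {(x, u). x = h u \<and> u \<in> U} (h u, u)"
  then obtain r where r: "0 < r" "\<And>v. v \<in> U \<Longrightarrow> v \<noteq> u \<Longrightarrow> dist (h v, v) (h u, u) < r \<Longrightarrow> \<Phi> (h u, u) < \<Phi> (h v, v)"
    unfolding strict_local_minimizer_def by (auto 0 3)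
  have "isCont (\<lambda>v. (h v, v)) u"
    using C1_continuous[OF C1_h, of UNIV] by (auto intro!: continuous_intros simp: continuous_on_eq_continuous_at)
  then obtain d where d: "0 < d" "\<And>v. dist v u < d \<Longrightarrow> dist (h v, v) (h u, u) < r"
    using r(1) unfolding continuous_at_eps_delta by metis
  show "strict_local_minimizer V (UNIV \<times> U) (h u, u)"
    unfolding strict_local_minimizer_def
  proof (intro conjI exI[of _ d] ballI impI)
    fix z assume z: "z \<in> UNIV \<times> U" "z \<noteq> (h u, u) \<and> dist z (h u, u) < d"
    obtain x v where xv: "z = (x, v)" "v \<in> U" using z(1) by auto
    show "V (h u, u) < V z"
    proof (cases "v = u")
      case True
      then show ?thesis using z(2) V_gt[OF u, of x] V_on_graph[OF u] by (auto simp: xv)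
    next
      case False
      have "dist v u < d" using z(2) dist_snd_le[of z "(h u, u)"] by (simp add: xv)
      then have "\<Phi> (h u, u) < \<Phi> (h v, v)" using r(2)[OF xv(2) False] d(2) by blast
      also have "\<dots> \<le> V z" using V_ge[OF xv(2)] by (simp add: xv)
      finally show ?thesis by (simp add: V_on_graph[OF u])
    qed
  qed (use d u in auto)
qed

end

theorem mainTheorem3:
  fixes \<xi> \<omega> :: "nat \<Rightarrow> real ^ 'p \<Rightarrow> real" and s q :: nat
    and U :: "(real ^ 'p) set"
    and f :: "(real ^ 'n) \<times> (real ^ 'p) \<Rightarrow> real ^ 'n"
    and h :: "real ^ 'p \<Rightarrow> real ^ 'n"
    and \<Phi> W :: "(real ^ 'n) \<times> (real ^ 'p) \<Rightarrow> real"
    and lx lu l L \<alpha> \<beta> \<gamma> \<zeta> \<epsilon> :: real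
    and F :: "(real ^ 'n) \<times> (real ^ 'p) \<Rightarrow> (real ^ 'n) \<times> (real ^ 'p)"
  assumes U_def: "U = constraint_set s \<xi> q \<omega>"
    and regular: "regular_constraints s \<xi> q \<omega>"
    and plant: "plant_assumption U f h lx lu l"
    and Phi: "C1 \<Phi>" "locally_Lipschitz (grad \<Phi>)"
    and L: "0 < L"
      "\<And>x x' u. u \<in> U \<Longrightarrow>
         norm (HT h u (grad \<Phi> (x', u) - grad \<Phi> (x, u))) \<le> L * norm (x' - x)"
    and Lyapunov: "plant_Lyapunov U f h W \<alpha> \<beta> \<gamma> \<zeta>"
    and level_sets: "compact_level_sets (\<lambda>u. \<Phi> (h u, u))"
    and eps: "0 < \<epsilon>" "\<epsilon> < \<gamma> / (\<zeta> * L)"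
    and F_def: "F = feedback_system s \<xi> q \<omega> f h \<Phi> \<epsilon>"
  shows "(\<forall>I z. maximal_solution (UNIV \<times> U) F I z \<longrightarrow>
            I = {0..} \<and> converges_to_set z (critical_points s \<xi> q \<omega> h \<Phi>))
       \<and> (\<forall>c. asymptotically_stable_equilibrium (UNIV \<times> U) F c \<longrightarrow>
            strict_local_minimizer \<Phi> {(x, u). x = h u \<and> u \<in> U} c)
       \<and> (\<forall>c. strict_local_minimizer \<Phi> {(x, u). x = h u \<and> u \<in> U} c \<longrightarrow>
            stable_equilibrium (UNIV \<times> U) F c)"
proof -
  interpret feedback_loop s q \<xi> \<omega> f h \<Phi> W lx L \<alpha> \<beta> \<gamma> \<zeta> \<epsilon>
    by unfold_locales
      (use regular plant Phi L Lyapunov level_sets eps in \<open>auto simp: plant_assumption_def U_def\<close>)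
  obtain c where c: "0 < c"
      "\<And>z. z \<in> UNIV \<times> constraint_set s \<xi> q \<omega> \<Longrightarrow> V' z (field z) \<le> - c * (norm (field z))\<^sup>2"
    using V_dissipation by blast
  interpret dissipative_projected_system "UNIV \<times> constraint_set s \<xi> q \<omega>" drive V V' c
    by unfold_locales (use V_has_derivative c compact_V_sublevel in auto)
  have F: "F z = field z" if "z \<in> UNIV \<times> U" for z
    using that field_eq unfolding F_def U_def by (cases z) simp
  \<comment> \<open>Outside the state space \<open>F\<close> and \<open>field\<close> may differ, but solutions never leave it.\<close>
  have sol: "solution_on (UNIV \<times> U) F I z \<longleftrightarrow> solution_on (UNIV \<times> U) field I z" for I z
  proof
    show "solution_on (UNIV \<times> U) field I z" if "solution_on (UNIV \<times> U) F I z"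
      using that by (rule solution_on_field_cong) (use that F in \<open>auto simp: solution_on_def\<close>)
    show "solution_on (UNIV \<times> U) F I z" if "solution_on (UNIV \<times> U) field I z"
      using that by (rule solution_on_field_cong) (use that F in \<open>auto simp: solution_on_def\<close>)
  qed
  have max: "maximal_solution (UNIV \<times> U) F I z \<longleftrightarrow> maximal_solution (UNIV \<times> U) field I z" for I z
    by (simp add: maximal_solution_def sol)
  have equ: "equilibrium (UNIV \<times> U) F x \<longleftrightarrow> equilibrium (UNIV \<times> U) field x" for x
    using F unfolding equilibrium_def by auto
  have stable: "stable_equilibrium (UNIV \<times> U) F x \<longleftrightarrow> stable_equilibrium (UNIV \<times> U) field x" for x
    by (simp add: stable_equilibrium_def sol equ)
  have as: "asymptotically_stable_equilibrium (UNIV \<times> U) F x \<longleftrightarrow>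
      asymptotically_stable_equilibrium (UNIV \<times> U) field x" for x
    by (simp add: asymptotically_stable_equilibrium_def stable max)
  show ?thesis
  proof (intro conjI allI impI)
    fix I z assume "maximal_solution (UNIV \<times> U) F I z"
    then have m: "maximal_solution (UNIV \<times> constraint_set s \<xi> q \<omega>) field I z"
      unfolding max unfolding U_def .
    then show I: "I = {0..}" by (rule maximal_solution_complete)
    have "solution_on (UNIV \<times> constraint_set s \<xi> q \<omega>) field {0..} z"
      using m I by (simp add: maximal_solution_def)
    then show "converges_to_set z (critical_points s \<xi> q \<omega> h \<Phi>)"
      using global_solution_converges zeros_eq_critical_points by simp
  next
    fix x assume "asymptotically_stable_equilibrium (UNIV \<times> U) F x"
    then have a: "asymptotically_stable_equilibrium (UNIV \<times> constraint_set s \<xi> q \<omega>) field x"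
      unfolding as unfolding U_def .
    then have min: "strict_local_minimizer V (UNIV \<times> constraint_set s \<xi> q \<omega>) x"
      by (rule asymptotically_stable_imp_strict_local_minimizer)
    have "x \<in> {z \<in> UNIV \<times> constraint_set s \<xi> q \<omega>. field z = 0}"
      using a unfolding asymptotically_stable_equilibrium_def stable_equilibrium_def equilibrium_def by blast
    then obtain u where "u \<in> constraint_set s \<xi> q \<omega>" "x = (h u, u)"
      unfolding zeros_eq_critical_points critical_points_def by auto
    then show "strict_local_minimizer \<Phi> {(x, u). x = h u \<and> u \<in> U} x"
      using min strict_local_minimizer_V_iff unfolding U_def by simp
  next
    fix x assume m: "strict_local_minimizer \<Phi> {(x, u). x = h u \<and> u \<in> U} x"
    then obtain u where u: "u \<in> U" "x = (h u, u)" unfolding strict_local_minimizer_def by auto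
    then have "strict_local_minimizer V (UNIV \<times> constraint_set s \<xi> q \<omega>) x"
      using m strict_local_minimizer_V_iff[of u] unfolding U_def by simp
    then have "stable_equilibrium (UNIV \<times> constraint_set s \<xi> q \<omega>) field x"
      by (rule strict_local_minimizer_imp_stable)
    then show "stable_equilibrium (UNIV \<times> U) F x" unfolding stable unfolding U_def .
  qed
qed

end
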